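(* Let $n\ge1$, $R'=\mathbb Q[x_2,x_3]$, $w=x_2^{n+1}-x_3^{n+1}$. Let $C(\Gamma_1)=L^2_3$ be the factorization of a single arc oriented from $x_3$ to $x_2$, and let $C(\Gamma)=W(x_1,x_2;x_3,x_4)/(x_4-x_1)$ be the factorization of the graph $\Gamma$ with one wide edge, one of whose outgoing edges is joined to one of its incoming edges (common mark $x_1$), the other outgoing and incoming edges ending at boundary points $x_2$ and $x_3$; $C(\Gamma)$ is regarded as a (infinite rank) graded $(R',w)$-factorization. Then there is an isomorphism in $\mathrm{hmf}_w$ $$C(\Gamma)\langle1\rangle\;\cong\;\bigoplus_{i=0}^{n-2}C(\Gamma_1)\{2-n+2i\}.$$
   Context: **Graded factorizations.** Let $R$ be a polynomial ring over $\mathbb Q$ in finitely many variables of degree $2$, $w\in R$ homogeneous of degree $2(n+1)$. $\{m\}$ shifts the grading of a graded module up by $m$. A graded $(R,w)$-factorization is a pair of free graded $R$-modules $M^0,M^1$ (possibly of infinite rank) with $R$-linear maps $M^0\xrightarrow{d}M^1\xrightarrow{d}M^0$ of degree $n+1$, $d^2=w$. Morphisms are pairs of degree $0$ maps commuting with $d$; $f,g$ are homotopic if $f-g=hd+dh$ with $h^i:M^i\to N^{i-1}$ of degree $-n-1$. $H(M)$ is the cohomology of $M/\mathfrak mM$, $\mathfrak m$ the ideal generated by the variables. $\mathrm{hmf}_w$ is the category of graded $(R,w)$-factorizations with $\dim_{\mathbb Q}H(M)<\infty$ and morphisms up to homotopy. $M\langle1\rangle^i=M^{i+1}$ with differential $-d$.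 If $R\subset S$ and $w\in R$, an $(S,w)$-factorization is regarded as an $(R,w)$-factorization. Tensor products have $d(m\otimes m')=dm\otimes m'+(-1)^im\otimes dm'$, $m\in M^i$. For homogeneous $a,b$ with $\deg a+\deg b=2n+2$, $\{a,b\}$ is $R\xrightarrow{a}R\{n+1-\deg a\}\xrightarrow{b}R$; $\{(a_i),(b_i)\}=\bigotimes_i\{a_i,b_i\}$. **Arcs and wide edges.** $L^i_j=\{\pi_{ij},x_i-x_j\}$ over $\mathbb Q[x_i,x_j]$, $\pi_{ij}=(x_i^{n+1}-x_j^{n+1})/(x_i-x_j)$. Let $g$ be the polynomial with $g(x+y,xy)=x^{n+1}+y^{n+1}$. For a wide edge with outgoing marks $x_1,x_2$ and incoming marks $x_3,x_4$, $$W(x_1,x_2;x_3,x_4)=\{(u_1,u_2),(x_1+x_2-x_3-x_4,\;x_1x_2-x_3x_4)\}\{-1\}$$ over $\mathbb Q[x_1,x_2,x_3,x_4]$, where $u_1=\frac{g(x_1+x_2,x_1x_2)-g(x_3+x_4,x_1x_2)}{x_1+x_2-x_3-x_4}$, $u_2=\frac{g(x_3+x_4,x_1x_2)-g(x_3+x_4,x_3x_4)}{x_1x_2-x_3x_4}$. An empty direct sum is $0$. *)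

theory Defs
  imports
    Complex_Main
    "HOL-Algebra.QuotRing"
    "HOL-Algebra.Module"
    "HOL-Library.Poly_Mapping"
    "HOL-Library.Z2"
begin

section \<open>Polynomials over the rationals\<close>

text \<open>
  All polynomials live in one type, with variables $x_i$ indexed by the natural numbers
  (these indices are the marks of the graphs); $\mathbb{Q}[x_i : i \in V]$ is a subring of it.
\<close>

type_synonym qpoly = "(nat \<Rightarrow>\<^sub>0 nat) \<Rightarrow>\<^sub>0 rat"

definition var :: "nat \<Rightarrow> qpoly" where
  "var i = Poly_Mapping.single (Poly_Mapping.single i 1) 1"

definition poly_ring :: "nat set \<Rightarrow> qpoly ring" where
  "poly_ring V =
     \<lparr>carrier = {p. \<forall>m \<in> Poly_Mapping.keys p. Poly_Mapping.keys m \<subseteq> V},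
      mult = (*), one = 1, zero = 0, add = (+)\<rparr>"

text \<open>Every variable has degree 2.\<close>

definition mdeg :: "(nat \<Rightarrow>\<^sub>0 nat) \<Rightarrow> int" where
  "mdeg m = 2 * int (\<Sum>i \<in> Poly_Mapping.keys m. Poly_Mapping.lookup m i)"

definition hom_poly :: "nat set \<Rightarrow> int \<Rightarrow> qpoly set" where
  "hom_poly V k = {p \<in> carrier (poly_ring V). \<forall>m \<in> Poly_Mapping.keys p. mdeg m = k}"

definition pdeg :: "qpoly \<Rightarrow> int" where
  "pdeg p = Max (insert 0 (mdeg ` Poly_Mapping.keys p))"

definition psubst :: "(nat \<Rightarrow> qpoly) \<Rightarrow> qpoly \<Rightarrow> qpoly" where
  "psubst s p =
     (\<Sum>m \<in> Poly_Mapping.keys p. Poly_Mapping.single 0 (Poly_Mapping.lookup p m) *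
        (\<Prod>i \<in> Poly_Mapping.keys m. s i ^ Poly_Mapping.lookup m i))"

text \<open>Exact division; the type \<^typ>\<open>qpoly\<close> is an integral domain.\<close>

definition pquot :: "qpoly \<Rightarrow> qpoly \<Rightarrow> qpoly" where
  "pquot p q = (THE c. c * q = p)"


section \<open>Graded modules\<close>

text \<open>
  \<open>hcomp M k\<close> is the degree \<open>k\<close> part of \<open>M\<close>. The fields \<open>mult\<close> and \<open>one\<close>, inherited
  from the library's record of modules, play no role. As the ring is not part of the record,
  restriction of scalars to a subring \<^term>\<open>poly_ring V\<close> leaves the record unchanged.
\<close>

record ('a, 'b) gmodule = "('a, 'b) module" +
  hcomp :: "int \<Rightarrow> 'b set"

type_synonym 'b qmodule = "(qpoly, 'b) gmodule"

definition graded_module :: "nat set \<Rightarrow> 'b qmodule \<Rightarrow> bool" where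
  "graded_module V M \<longleftrightarrow>
     Module.module (poly_ring V) M \<and>
     (\<forall>k. subgroup (hcomp M k) (add_monoid M)) \<and>
     (\<forall>j k. \<forall>r \<in> hom_poly V j. \<forall>x \<in> hcomp M k. r \<odot>\<^bsub>M\<^esub> x \<in> hcomp M (j + k)) \<and>
     (\<forall>x \<in> carrier M. \<exists>!c. (\<forall>k. c k \<in> hcomp M k) \<and> finite {k. c k \<noteq> \<zero>\<^bsub>M\<^esub>} \<and>
        x = (\<Oplus>\<^bsub>M\<^esub>k \<in> {k. c k \<noteq> \<zero>\<^bsub>M\<^esub>}. c k))"

definition module_basis :: "nat set \<Rightarrow> 'b qmodule \<Rightarrow> 'b set \<Rightarrow> bool" where
  "module_basis V M B \<longleftrightarrow> B \<subseteq> carrier M \<and>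
     (\<forall>x \<in> carrier M. \<exists>!c. (\<forall>b \<in> B. c b \<in> carrier (poly_ring V)) \<and> (\<forall>b. b \<notin> B \<longrightarrow> c b = 0) \<and>
        finite {b. c b \<noteq> 0} \<and> x = (\<Oplus>\<^bsub>M\<^esub>b \<in> {b. c b \<noteq> 0}. c b \<odot>\<^bsub>M\<^esub> b))"

definition graded_free :: "nat set \<Rightarrow> 'b qmodule \<Rightarrow> bool" where
  "graded_free V M \<longleftrightarrow> graded_module V M \<and>
     (\<exists>B. module_basis V M B \<and> (\<forall>b \<in> B. \<exists>k. b \<in> hcomp M k))"

definition graded_hom :: "nat set \<Rightarrow> int \<Rightarrow> 'b qmodule \<Rightarrow> 'c qmodule \<Rightarrow> ('b \<Rightarrow> 'c) set" where
  "graded_hom V k M N = {f \<in> carrier M \<rightarrow> carrier N.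
     (\<forall>x \<in> carrier M. \<forall>y \<in> carrier M. f (x \<oplus>\<^bsub>M\<^esub> y) = f x \<oplus>\<^bsub>N\<^esub> f y) \<and>
     (\<forall>r \<in> carrier (poly_ring V). \<forall>x \<in> carrier M. f (r \<odot>\<^bsub>M\<^esub> x) = r \<odot>\<^bsub>N\<^esub> f x) \<and>
     (\<forall>j. f ` hcomp M j \<subseteq> hcomp N (j + k))}"

definition module_shift :: "int \<Rightarrow> 'b qmodule \<Rightarrow> 'b qmodule" where
  "module_shift m M = M\<lparr>hcomp := \<lambda>k. hcomp M (k - m)\<rparr>"

text \<open>Quotients by a submodule \<open>N\<close>, with cosets as elements, and the maps they induce.\<close>

definition quot_module :: "'b qmodule \<Rightarrow> 'b set \<Rightarrow> 'b set qmodule" where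
  "quot_module M N =
     \<lparr>carrier = a_rcosets\<^bsub>M\<^esub> N, mult = undefined, one = undefined, zero = N, add = set_add M,
      smult = (\<lambda>r C. \<Union>x \<in> C. N +>\<^bsub>M\<^esub> (r \<odot>\<^bsub>M\<^esub> x)),
      hcomp = (\<lambda>k. (\<lambda>x. N +>\<^bsub>M\<^esub> x) ` hcomp M k)\<rparr>"

definition quot_map :: "'c qmodule \<Rightarrow> 'c set \<Rightarrow> ('b \<Rightarrow> 'c) \<Rightarrow> 'b set \<Rightarrow> 'c set" where
  "quot_map M' N' f C = (\<Union>x \<in> C. N' +>\<^bsub>M'\<^esub> f x)"

text \<open>The submodule $I M$.\<close>

definition ideal_smult :: "nat set \<Rightarrow> qpoly set \<Rightarrow> 'b qmodule \<Rightarrow> 'b set" where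
  "ideal_smult V I M =
     \<Inter>{H. submodule H (poly_ring V) M \<and> (\<forall>r \<in> I. \<forall>x \<in> carrier M. r \<odot>\<^bsub>M\<^esub> x \<in> H)}"

text \<open>\<^term>\<open>poly_ring {}\<close> is the field $\mathbb{Q}$ of constants.\<close>

definition finite_dim :: "'b qmodule \<Rightarrow> bool" where
  "finite_dim M \<longleftrightarrow> (\<exists>A. finite A \<and> A \<subseteq> carrier M \<and>
     (\<forall>x \<in> carrier M. \<exists>c. (\<forall>a \<in> A. c a \<in> carrier (poly_ring {})) \<and>
        x = (\<Oplus>\<^bsub>M\<^esub>a \<in> A. c a \<odot>\<^bsub>M\<^esub> a)))"


section \<open>Graded factorizations and their homotopy category\<close>

text \<open>The index \<open>i\<close> of $M^i$ is taken modulo 2.\<close>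

record 'b factorization =
  obj :: "bit \<Rightarrow> 'b qmodule"
  diff :: "bit \<Rightarrow> 'b \<Rightarrow> 'b"

definition graded_factorization :: "nat set \<Rightarrow> nat \<Rightarrow> qpoly \<Rightarrow> 'b factorization \<Rightarrow> bool" where
  "graded_factorization V n w M \<longleftrightarrow>
     finite V \<and> w \<in> hom_poly V (2 * (int n + 1)) \<and>
     (\<forall>i. graded_free V (obj M i)) \<and>
     (\<forall>i. diff M i \<in> graded_hom V (int n + 1) (obj M i) (obj M (i + 1))) \<and>
     (\<forall>i. \<forall>x \<in> carrier (obj M i). diff M (i + 1) (diff M i x) = w \<odot>\<^bsub>obj M i\<^esub> x)"

definition fact_hom ::
  "nat set \<Rightarrow> 'b factorization \<Rightarrow> 'c factorization \<Rightarrow> (bit \<Rightarrow> 'b \<Rightarrow> 'c) set" where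
  "fact_hom V M N = {f. \<forall>i. f i \<in> graded_hom V 0 (obj M i) (obj N i) \<and>
     (\<forall>x \<in> carrier (obj M i). f (i + 1) (diff M i x) = diff N i (f i x))}"

definition homotopic ::
  "nat set \<Rightarrow> nat \<Rightarrow> 'b factorization \<Rightarrow> 'c factorization \<Rightarrow>
     (bit \<Rightarrow> 'b \<Rightarrow> 'c) \<Rightarrow> (bit \<Rightarrow> 'b \<Rightarrow> 'c) \<Rightarrow> bool" where
  "homotopic V n M N f g \<longleftrightarrow>
     (\<exists>h. \<forall>i. h i \<in> graded_hom V (- int n - 1) (obj M i) (obj N (i - 1)) \<and>
       (\<forall>x \<in> carrier (obj M i). f i x \<ominus>\<^bsub>obj N i\<^esub> g i x =
          h (i + 1) (diff M i x) \<oplus>\<^bsub>obj N i\<^esub> diff N (i - 1) (h i x)))"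

definition quot_fact :: "nat set \<Rightarrow> qpoly set \<Rightarrow> 'b factorization \<Rightarrow> 'b set factorization" where
  "quot_fact V I M =
     \<lparr>obj = (\<lambda>i. quot_module (obj M i) (ideal_smult V I (obj M i))),
      diff = (\<lambda>i. quot_map (obj M (i + 1)) (ideal_smult V I (obj M (i + 1))) (diff M i))\<rparr>"

definition cohomology :: "'b factorization \<Rightarrow> bit \<Rightarrow> 'b set qmodule" where
  "cohomology M i =
     (let Z = {x \<in> carrier (obj M i). diff M i x = \<zero>\<^bsub>obj M (i + 1)\<^esub>} in
      quot_module
        ((obj M i)\<lparr>carrier := Z, hcomp := \<lambda>k. hcomp (obj M i) k \<inter> Z\<rparr>)
        (diff M (i - 1) ` carrier (obj M (i - 1))))"

definition max_ideal :: "nat set \<Rightarrow> qpoly set" where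
  "max_ideal V = genideal (poly_ring V) (var ` V)"

definition hmf_obj :: "nat set \<Rightarrow> nat \<Rightarrow> qpoly \<Rightarrow> 'b factorization \<Rightarrow> bool" where
  "hmf_obj V n w M \<longleftrightarrow> graded_factorization V n w M \<and>
     (\<forall>i. finite_dim (cohomology (quot_fact V (max_ideal V) M) i))"

definition hmf_iso ::
  "nat set \<Rightarrow> nat \<Rightarrow> qpoly \<Rightarrow> 'b factorization \<Rightarrow> 'c factorization \<Rightarrow> bool" where
  "hmf_iso V n w M N \<longleftrightarrow> hmf_obj V n w M \<and> hmf_obj V n w N \<and>
     (\<exists>f \<in> fact_hom V M N. \<exists>g \<in> fact_hom V N M.
        homotopic V n M M (\<lambda>i. g i \<circ> f i) (\<lambda>i. id) \<and>
        homotopic V n N N (\<lambda>i. f i \<circ> g i) (\<lambda>i. id))"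

definition fact_shift :: "int \<Rightarrow> 'b factorization \<Rightarrow> 'b factorization" where
  "fact_shift m M = M\<lparr>obj := \<lambda>i. module_shift m (obj M i)\<rparr>"

text \<open>The translation $M\langle 1\rangle$.\<close>

definition fact_translate :: "'b factorization \<Rightarrow> 'b factorization" where
  "fact_translate M =
     \<lparr>obj = (\<lambda>i. obj M (i + 1)), diff = (\<lambda>i x. \<ominus>\<^bsub>obj M i\<^esub> diff M (i + 1) x)\<rparr>"

definition module_sum :: "'i set \<Rightarrow> ('i \<Rightarrow> 'b qmodule) \<Rightarrow> ('i \<Rightarrow> 'b) qmodule" where
  "module_sum J M =
     (let D = {f \<in> (\<Pi>\<^sub>E j \<in> J. carrier (M j)). finite {j \<in> J. f j \<noteq> \<zero>\<^bsub>M j\<^esub>}} in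
      \<lparr>carrier = D, mult = undefined, one = undefined,
       zero = (\<lambda>j \<in> J. \<zero>\<^bsub>M j\<^esub>),
       add = (\<lambda>f g. \<lambda>j \<in> J. f j \<oplus>\<^bsub>M j\<^esub> g j),
       smult = (\<lambda>r f. \<lambda>j \<in> J. r \<odot>\<^bsub>M j\<^esub> f j),
       hcomp = (\<lambda>k. {f \<in> D. \<forall>j \<in> J. f j \<in> hcomp (M j) k})\<rparr>)"

definition fact_sum :: "'i set \<Rightarrow> ('i \<Rightarrow> 'b factorization) \<Rightarrow> ('i \<Rightarrow> 'b) factorization" where
  "fact_sum J M =
     \<lparr>obj = (\<lambda>i. module_sum J (\<lambda>j. obj (M j) i)),
      diff = (\<lambda>i f. \<lambda>j \<in> J. diff (M j) i (f j))\<rparr>"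


section \<open>Factorizations of finite rank and Koszul factorizations\<close>

text \<open>
  A finite rank factorization is given on a homogeneous basis \<open>b :: 'b\<close> by the parity and the
  degree of the basis elements and by the matrix of $d$: \<open>entry D b b'\<close> is the coefficient
  of \<open>b'\<close> in \<open>d b\<close>.
\<close>

record 'b fact_matrix =
  par :: "'b \<Rightarrow> bit"
  bdeg :: "'b \<Rightarrow> int"
  entry :: "'b \<Rightarrow> 'b \<Rightarrow> qpoly"

instance bit :: finite
proof
  have "(UNIV :: bit set) \<subseteq> {0, 1}"
    using bit_not_zero_iff by blast
  then show "finite (UNIV :: bit set)"
    using finite_subset by blast
qed

definition free_fact :: "nat set \<Rightarrow> 'b::finite fact_matrix \<Rightarrow> ('b \<Rightarrow> qpoly) factorization" where
  "free_fact V D =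
     (let F = (\<lambda>i. {f. \<forall>b. f b \<in> carrier (poly_ring V) \<and> (par D b \<noteq> i \<longrightarrow> f b = 0)}) in
      \<lparr>obj = (\<lambda>i.
         \<lparr>carrier = F i, mult = undefined, one = undefined,
          zero = (\<lambda>b. 0), add = (\<lambda>f g b. f b + g b), smult = (\<lambda>r f b. r * f b),
          hcomp = (\<lambda>k. {f \<in> F i. \<forall>b. f b \<in> hom_poly V (k - bdeg D b)})\<rparr>),
       diff = (\<lambda>i f b'. \<Sum>b \<in> UNIV. f b * entry D b b')\<rparr>)"

text \<open>
  The tensor product of the free modules on bases \<open>b\<close> and \<open>c\<close> is free on the elements
  $b \otimes c$, and $d(b \otimes c) = d b \otimes c + (-1)^{|b|}\, b \otimes d c$.
\<close>

definition tensor :: "'b fact_matrix \<Rightarrow> 'c fact_matrix \<Rightarrow> ('b \<times> 'c) fact_matrix" where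
  "tensor D E =
     \<lparr>par = (\<lambda>(b, c). par D b + par E c),
      bdeg = (\<lambda>(b, c). bdeg D b + bdeg E c),
      entry = (\<lambda>(b, c) (b', c').
        (if c = c' then entry D b b' else 0) +
        (if b = b' then (if par D b = 0 then 1 else - 1) * entry E c c' else 0))\<rparr>"

text \<open>
  $\{a, b\}$ is $R \to R\{n + 1 - \deg a\} \to R$; its basis element of parity \<open>i\<close> is \<open>i\<close>.
\<close>

definition koszul :: "nat \<Rightarrow> qpoly \<Rightarrow> qpoly \<Rightarrow> bit fact_matrix" where
  "koszul n a b =
     \<lparr>par = (\<lambda>i. i),
      bdeg = (\<lambda>i. if i = 0 then 0 else int n + 1 - pdeg a),
      entry = (\<lambda>i j. if i = 0 \<and> j = 1 then a else if i = 1 \<and> j = 0 then b else 0)\<rparr>"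


section \<open>Arcs and wide edges\<close>

definition arc :: "nat \<Rightarrow> nat \<Rightarrow> nat \<Rightarrow> (bit \<Rightarrow> qpoly) factorization" where
  "arc n i j =
     free_fact {i, j}
       (koszul n (pquot (var i ^ (n + 1) - var j ^ (n + 1)) (var i - var j)) (var i - var j))"

definition power_sum_poly :: "nat \<Rightarrow> qpoly" where
  "power_sum_poly n =
     (THE p. p \<in> carrier (poly_ring {1, 2}) \<and>
        psubst (\<lambda>i. if i = 1 then var 1 + var 2 else var 1 * var 2) p
          = var 1 ^ (n + 1) + var 2 ^ (n + 1))"

definition gsub :: "nat \<Rightarrow> qpoly \<Rightarrow> qpoly \<Rightarrow> qpoly" where
  "gsub n s p = psubst (\<lambda>i. if i = 1 then s else p) (power_sum_poly n)"

text \<open>\<open>wide_edge n o1 o2 i1 i2\<close> has outgoing marks \<open>o1, o2\<close> and incoming marks \<open>i1, i2\<close>.\<close>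

definition wide_edge ::
  "nat \<Rightarrow> nat \<Rightarrow> nat \<Rightarrow> nat \<Rightarrow> nat \<Rightarrow> (bit \<times> bit \<Rightarrow> qpoly) factorization" where
  "wide_edge n o1 o2 i1 i2 =
     (let s = var o1 + var o2; p = var o1 * var o2; s' = var i1 + var i2; p' = var i1 * var i2;
          u1 = pquot (gsub n s p - gsub n s' p) (s - s');
          u2 = pquot (gsub n s' p - gsub n s' p') (p - p')
      in fact_shift (- 1)
           (free_fact {o1, o2, i1, i2} (tensor (koszul n u1 (s - s')) (koszul n u2 (p - p')))))"

end

theory Submission
  imports Defs "HOL-Computational_Algebra.Polynomial" "HOL-Library.Product_Plus"
begin

text \<open>
  Write $R' = \mathbb{Q}[x_2, x_3]$, $t = x_2 - x_3$, $v = (x_2^{n+1} - x_3^{n+1})/t$, and let $u$ be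
  $u_2$ with $x_4$ replaced by $X = x_1$. Once $x_4 = x_1$, the second linear entry of the wide edge is
  $X$ times the first one, so after the change of basis $f = e_{01} - X e_{10}$ the closed wide edge is
  the mapping cone of multiplication by $u$ on the Koszul factorization $\{v, t\}$ over $R'[X]$. As a
  polynomial in $X$, $u$ has degree $n - 1$ and leading coefficient $-(n + 1)$, so division with
  remainder by $u$ is possible over $R'$: the quotient is a contracting homotopy and the remainder a
  homotopy equivalence onto $\{v, t\} \otimes R'[X]/(u)$, which has the $R'$-basis
  $1, X, \dots, X^{n-2}$.
\<close>

text \<open>The cancellation behind the cone is forced by the potential: in the basis f, e_10 the
  entry v arises as u_1 + X u, which is free of X although neither summand need be. Degree reasons
  govern the division: \<open>u\<close> is homogeneous of degree 2(n - 1), the degree of X^(n - 1),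
  so its coefficient there is a rational number and may be computed at x_2 = x_3 = 0. As u_1 and u_2
  are given as exact quotients, which cannot be specialised where the divisor vanishes, they are
  replaced by recursions that can. In the shifted wide edge f has degree 2 - n and X^j adds 2 j:
  these are the shifts of the arcs. For n = 1 the divisor is a nonzero constant and both sides are
  zero objects. The finiteness condition is a separate obstacle, because the closed wide edge has
  infinite rank over R' and its reduction modulo the maximal ideal is infinite dimensional;
  finiteness is carried over from the finite rank side along the homotopy equivalence. Cosets and
  families are awkward to compute with, so all identities are checked on polynomials in X and
  transported along bijections.\<close>

abbreviation pconst :: "rat \<Rightarrow> qpoly" where
  "pconst \<equiv> Poly_Mapping.single 0"

abbreviation pcarrier :: "nat set \<Rightarrow> qpoly set" where
  "pcarrier V \<equiv> carrier (poly_ring V)"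

section \<open>Monomials, degrees and induction on polynomials\<close>

lemma poly_ring_simps [simp]:
  "monoid.mult (poly_ring V) = (*)" "monoid.one (poly_ring V) = 1" "ring.zero (poly_ring V) = 0" "ring.add (poly_ring V) = (+)"
  by (simp_all add: poly_ring_def)

lemma pcarrier_iff: "p \<in> pcarrier V \<longleftrightarrow> (\<forall>m \<in> Poly_Mapping.keys p. Poly_Mapping.keys m \<subseteq> V)"
  by (simp add: poly_ring_def)

lemma keys_monomial_add:
  "Poly_Mapping.keys (a + b) = Poly_Mapping.keys a \<union> Poly_Mapping.keys (b :: nat \<Rightarrow>\<^sub>0 nat)"
  by (auto simp: in_keys_iff lookup_add)

lemma monomial_split:
  obtains "m = (0 :: nat \<Rightarrow>\<^sub>0 nat)"
  | i m' where "m = Poly_Mapping.single i 1 + m'"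
proof (cases "m = 0")
  case False
  then obtain i where "Poly_Mapping.lookup m i \<noteq> 0"
    by (metis lookup_zero poly_mapping_eqI)
  then have "m = Poly_Mapping.single i 1 + (m - Poly_Mapping.single i 1)"
    by (intro poly_mapping_eqI) (auto simp: lookup_add lookup_minus lookup_single when_def)
  then show ?thesis using that by blast
qed (use that in blast)

lemma mdeg_sum:
  assumes "finite A" "Poly_Mapping.keys m \<subseteq> A"
  shows "mdeg m = 2 * int (\<Sum>i \<in> A. Poly_Mapping.lookup m i)"
  unfolding mdeg_def using assms
  by (intro arg_cong[where f = "\<lambda>x. 2 * int x"] sum.mono_neutral_left) (auto simp: in_keys_iff)

lemma mdeg_add: "mdeg (a + b) = mdeg a + mdeg b"
proof -
  let ?A = "Poly_Mapping.keys a \<union> Poly_Mapping.keys b"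
  show ?thesis
    by (simp add: mdeg_sum[of ?A] keys_monomial_add lookup_add sum.distrib)
qed

lemma mdeg_0 [simp]: "mdeg 0 = 0" by (simp add: mdeg_def)
lemma mdeg_single [simp]: "mdeg (Poly_Mapping.single i k) = 2 * int k"
  by (simp add: mdeg_def)

lemma mdeg_nonneg: "mdeg m \<ge> 0" by (simp add: mdeg_def sum_nonneg)

text \<open>Peels off one variable at a time, so that later arguments never handle exponent vectors.
  The second argument of \<open>P\<close> tracks the degree, which every variable raises by
  2.\<close>

lemma monomial_induct [consumes 1, case_names const var]:
  assumes "Poly_Mapping.keys m \<subseteq> V"
    and "\<And>c. P (pconst c) 0"
    and "\<And>i p k. i \<in> V \<Longrightarrow> P p k \<Longrightarrow> P (var i * p) (k + 2)"
  shows "P (Poly_Mapping.single m c) (mdeg m)"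
  using assms(1)
proof (induction "nat (mdeg m)" arbitrary: m rule: less_induct)
  case less
  show ?case
  proof (cases m rule: monomial_split)
    case 1
    then show ?thesis using assms(2) by simp
  next
    case (2 i m')
    have "Poly_Mapping.single m c = var i * Poly_Mapping.single m' c"
      by (simp add: var_def mult_single 2)
    moreover have "P (Poly_Mapping.single m' c) (mdeg m')"
      using less.prems mdeg_nonneg[of m'] by (intro less.hyps) (auto simp: 2 mdeg_add keys_monomial_add)
    ultimately show ?thesis
      using assms(3)[of i] less.prems by (auto simp: 2 mdeg_add keys_monomial_add add.commute)
  qed
qed

lemma poly_mapping_sum_single:
  fixes p :: "'a \<Rightarrow>\<^sub>0 'b::comm_monoid_add"
  shows "p = (\<Sum>m \<in> Poly_Mapping.keys p. Poly_Mapping.single m (Poly_Mapping.lookup p m))"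
  by (intro poly_mapping_eqI)
    (auto simp: lookup_sum lookup_single when_def in_keys_iff sum.delta)

lemma pcarrier_induct [consumes 1, case_names const var add]:
  assumes "p \<in> pcarrier V"
    and const: "\<And>c. P (pconst c)"
    and var: "\<And>i p. i \<in> V \<Longrightarrow> P p \<Longrightarrow> P (var i * p)"
    and add: "\<And>p q. P p \<Longrightarrow> P q \<Longrightarrow> P (p + q)"
  shows "P p"
proof -
  have z: "P 0" using const[of 0] by simp
  have "P (Poly_Mapping.single m c)" if "Poly_Mapping.keys m \<subseteq> V" for m c
    using that by (rule monomial_induct[where P = "\<lambda>p k. P p"]) (auto intro: const var)
  then have "P (\<Sum>m \<in> A. Poly_Mapping.single m (Poly_Mapping.lookup p m))"
    if "A \<subseteq> Poly_Mapping.keys p" for A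
  proof -
    have "finite A" using that finite_keys finite_subset by blast
    then show ?thesis using that
      by (induction A rule: finite_induct) (use assms(1) \<open>\<And>m c. _ \<Longrightarrow> P (Poly_Mapping.single m c)\<close> in \<open>auto simp: z pcarrier_iff intro!: add\<close>)
  qed
  then show ?thesis by (metis order_refl poly_mapping_sum_single)
qed

text \<open>The zero case ranges over every degree because 0 lies in each
  \<open>hom_poly V k\<close>, whereas the constant case fixes degree 0; the sum over the terms of
  degree k starts from 0.\<close>

lemma hom_poly_induct [consumes 1, case_names zero const var add]:
  assumes "p \<in> hom_poly V k"
    and zero: "\<And>k. P 0 k"
    and const: "\<And>c. P (pconst c) 0"
    and var: "\<And>i p k. i \<in> V \<Longrightarrow> P p k \<Longrightarrow> P (var i * p) (k + 2)"
    and add: "\<And>p q k. P p k \<Longrightarrow> P q k \<Longrightarrow> P (p + q) k"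
  shows "P p k"
proof -
  have "P (Poly_Mapping.single m c) (mdeg m)" if "Poly_Mapping.keys m \<subseteq> V" for m c
    using that by (rule monomial_induct) (auto intro: const var)
  then have "P (\<Sum>m \<in> A. Poly_Mapping.single m (Poly_Mapping.lookup p m)) k"
    if "A \<subseteq> Poly_Mapping.keys p" for A
  proof -
    have "finite A" using that finite_keys finite_subset by blast
    then show ?thesis using that
      by (induction A rule: finite_induct) (use assms(1) \<open>\<And>m c. _ \<Longrightarrow> P (Poly_Mapping.single m c) _\<close> in \<open>auto simp: zero pcarrier_iff hom_poly_def intro!: add\<close>)
  qed
  then show ?thesis by (metis order_refl poly_mapping_sum_single)
qed

lemma pcarrier_const [simp]: "pconst c \<in> pcarrier V"
  by (auto simp: pcarrier_iff)
lemma pcarrier_0 [simp]: "0 \<in> pcarrier V" and pcarrier_1 [simp]: "1 \<in> pcarrier V"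
  by (auto simp: pcarrier_iff)
lemma pcarrier_var: "i \<in> V \<Longrightarrow> var i \<in> pcarrier V"
  unfolding pcarrier_iff var_def by simp
lemma pcarrier_add: "p \<in> pcarrier V \<Longrightarrow> q \<in> pcarrier V \<Longrightarrow> p + q \<in> pcarrier V"
  using keys_add[of p q] by (auto simp: pcarrier_iff)
lemma pcarrier_uminus: "p \<in> pcarrier V \<Longrightarrow> - p \<in> pcarrier V"
  by (auto simp: pcarrier_iff in_keys_iff)
lemma pcarrier_diff: "p \<in> pcarrier V \<Longrightarrow> q \<in> pcarrier V \<Longrightarrow> p - q \<in> pcarrier V"
  using pcarrier_add[of p V "- q"] pcarrier_uminus by simp
lemma pcarrier_mult: "p \<in> pcarrier V \<Longrightarrow> q \<in> pcarrier V \<Longrightarrow> p * q \<in> pcarrier V"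
  using keys_mult[of p q] by (fastforce simp: pcarrier_iff keys_monomial_add)
lemma pcarrier_power: "p \<in> pcarrier V \<Longrightarrow> p ^ k \<in> pcarrier V"
  by (induction k) (auto intro: pcarrier_mult)
lemma pcarrier_sum: "(\<And>i. i \<in> A \<Longrightarrow> f i \<in> pcarrier V) \<Longrightarrow> sum f A \<in> pcarrier V"
  by (induction A rule: infinite_finite_induct) (auto intro: pcarrier_add)
lemma pcarrier_mono: "V \<subseteq> W \<Longrightarrow> p \<in> pcarrier V \<Longrightarrow> p \<in> pcarrier W"
  by (auto simp: pcarrier_iff)

lemmas pcarrier_intros = pcarrier_var pcarrier_add pcarrier_uminus pcarrier_diff pcarrier_mult
  pcarrier_power pcarrier_sum pcarrier_0 pcarrier_1 pcarrier_const

lemma hom_poly_imp_carrier: "p \<in> hom_poly V k \<Longrightarrow> p \<in> pcarrier V"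
  by (simp add: hom_poly_def)
lemma hom_poly_0 [simp]: "0 \<in> hom_poly V k"
  by (auto simp: hom_poly_def)
lemma hom_poly_const: "pconst c \<in> hom_poly V 0"
  by (auto simp: hom_poly_def)
lemma hom_poly_1: "1 \<in> hom_poly V 0"
  by (auto simp: hom_poly_def)
lemma hom_poly_var: "i \<in> V \<Longrightarrow> var i \<in> hom_poly V 2"
  unfolding hom_poly_def using pcarrier_var[of i V] by (simp add: var_def)
lemma hom_poly_add: "p \<in> hom_poly V k \<Longrightarrow> q \<in> hom_poly V k \<Longrightarrow> p + q \<in> hom_poly V k"
  using keys_add[of p q] by (auto simp: hom_poly_def pcarrier_add)
lemma hom_poly_uminus: "p \<in> hom_poly V k \<Longrightarrow> - p \<in> hom_poly V k"
  by (auto simp: hom_poly_def pcarrier_uminus in_keys_iff)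
lemma hom_poly_diff: "p \<in> hom_poly V k \<Longrightarrow> q \<in> hom_poly V k \<Longrightarrow> p - q \<in> hom_poly V k"
  using hom_poly_add[of p V k "- q"] hom_poly_uminus by simp
lemma hom_poly_mult: "p \<in> hom_poly V j \<Longrightarrow> q \<in> hom_poly V k \<Longrightarrow> p * q \<in> hom_poly V (j + k)"
  using keys_mult[of p q] by (fastforce simp: hom_poly_def pcarrier_mult mdeg_add)
lemma hom_poly_power: "p \<in> hom_poly V j \<Longrightarrow> p ^ k \<in> hom_poly V (int k * j)"
proof (induction k)
  case (Suc k)
  then show ?case using hom_poly_mult[of p V j "p ^ k" "int k * j"] by (simp add: algebra_simps)
qed (auto simp: hom_poly_1)
lemma hom_poly_sum: "(\<And>i. i \<in> A \<Longrightarrow> f i \<in> hom_poly V k) \<Longrightarrow> sum f A \<in> hom_poly V k"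
  by (induction A rule: infinite_finite_induct) (auto intro: hom_poly_add)
lemma hom_poly_mono: "V \<subseteq> W \<Longrightarrow> p \<in> hom_poly V k \<Longrightarrow> p \<in> hom_poly W k"
  by (auto simp: hom_poly_def pcarrier_iff)

text \<open>Nonvanishing matters, since \<open>pdeg 0\<close> is 0 whatever degree k is claimed. The
  degrees of the basis elements of \<open>koszul\<close> depend on \<open>pdeg\<close> of its first
  entry, so each such entry has to be shown nonzero.\<close>

lemma pdeg_hom:
  assumes "p \<in> hom_poly V k" "p \<noteq> 0"
  shows "pdeg p = k"
proof -
  have ne: "Poly_Mapping.keys p \<noteq> {}" using assms(2) by simp
  then have "mdeg ` Poly_Mapping.keys p = {k}" using assms(1) by (fastforce simp: hom_poly_def)
  moreover have "k \<ge> 0" using ne assms(1) mdeg_nonneg by (fastforce simp: hom_poly_def)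
  ultimately show ?thesis by (simp add: pdeg_def)
qed



section \<open>Homogeneous components and the polynomial ring as a ring record\<close>

definition hom_part :: "int \<Rightarrow> qpoly \<Rightarrow> qpoly" where
  "hom_part k p = (\<Sum>m \<in> {m \<in> Poly_Mapping.keys p. mdeg m = k}.
     Poly_Mapping.single m (Poly_Mapping.lookup p m))"

lemma lookup_hom_part:
  "Poly_Mapping.lookup (hom_part k p) m = (if mdeg m = k then Poly_Mapping.lookup p m else 0)"
  by (auto simp: hom_part_def lookup_sum lookup_single when_def sum.delta in_keys_iff)

lemma hom_part_in: "p \<in> pcarrier V \<Longrightarrow> hom_part k p \<in> hom_poly V k"
  by (auto simp: hom_poly_def pcarrier_iff in_keys_iff lookup_hom_part split: if_splits)

lemma hom_part_hom: "p \<in> hom_poly V j \<Longrightarrow> hom_part k p = (if k = j then p else 0)"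
  by (intro poly_mapping_eqI) (auto simp: lookup_hom_part hom_poly_def in_keys_iff)

lemma finite_hom_part: "finite {k. hom_part k p \<noteq> 0}"
proof (rule finite_subset)
  show "{k. hom_part k p \<noteq> 0} \<subseteq> mdeg ` Poly_Mapping.keys p"
    by (force simp: poly_mapping_eq_iff fun_eq_iff lookup_hom_part in_keys_iff split: if_splits)
qed simp

lemma hom_part_zero [simp]: "hom_part k 0 = 0"
  by (simp add: hom_part_def)
lemma hom_part_add: "hom_part k (p + q) = hom_part k p + hom_part k q"
  by (intro poly_mapping_eqI) (auto simp: lookup_hom_part lookup_add)

lemma hom_part_sum: "hom_part k (sum f A) = (\<Sum>a \<in> A. hom_part k (f a))"
  by (induction A rule: infinite_finite_induct) (auto simp: hom_part_add)

lemma sum_hom_part: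
  assumes "finite A" "{k. hom_part k p \<noteq> 0} \<subseteq> A"
  shows "(\<Sum>k \<in> A. hom_part k p) = p"
proof (rule poly_mapping_eqI)
  fix m
  have "mdeg m \<notin> A \<Longrightarrow> Poly_Mapping.lookup p m = 0"
    using assms(2) by (force simp: poly_mapping_eq_iff fun_eq_iff lookup_hom_part in_keys_iff split: if_splits)
  then show "Poly_Mapping.lookup (\<Sum>k \<in> A. hom_part k p) m = Poly_Mapping.lookup p m"
    using assms(1) by (auto simp: lookup_sum lookup_hom_part sum.delta)
qed

lemma poly_ring_cring: "cring (poly_ring V)"
proof (rule cringI)
  show "abelian_group (poly_ring V)"
  proof (rule abelian_groupI)
    fix x assume "x \<in> pcarrier V"
    then show "\<exists>y\<in>pcarrier V. y \<oplus>\<^bsub>poly_ring V\<^esub> x = \<zero>\<^bsub>poly_ring V\<^esub>"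
      by (intro bexI[of _ "- x"]) (auto intro: pcarrier_intros)
  qed (auto intro: pcarrier_intros simp: algebra_simps)
  show "comm_monoid (poly_ring V)"
    by (rule comm_monoidI) (auto intro: pcarrier_intros simp: algebra_simps)
qed (auto simp: algebra_simps)

lemma poly_ring_a_minus: "x \<in> pcarrier V \<Longrightarrow> \<ominus>\<^bsub>poly_ring V\<^esub> x = - x"
proof -
  interpret cring "poly_ring V" by (rule poly_ring_cring)
  assume "x \<in> pcarrier V"
  then show ?thesis by (intro minus_equality) (auto intro: pcarrier_intros)
qed

section \<open>Evaluation homomorphisms\<close>

text \<open>Coefficients go through \<open>c\<close> and variables through \<open>s\<close>. This
  covers substitution into \<open>qpoly\<close>, elimination into univariate polynomials and the
  constant term, which thus share one proof that they are ring homomorphisms.\<close>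

definition peval :: "(rat \<Rightarrow> 'c::comm_ring_1) \<Rightarrow> (nat \<Rightarrow> 'c) \<Rightarrow> qpoly \<Rightarrow> 'c" where
  "peval c s p = (\<Sum>m \<in> Poly_Mapping.keys p. c (Poly_Mapping.lookup p m) *
     (\<Prod>i \<in> Poly_Mapping.keys m. s i ^ Poly_Mapping.lookup m i))"

lemma psubst_peval: "psubst = peval pconst"
  by (intro ext) (simp add: psubst_def peval_def)

locale rat_algebra =
  fixes c :: "rat \<Rightarrow> 'c::comm_ring_1"
  assumes c_add: "c (x + y) = c x + c y" and c_mult: "c (x * y) = c x * c y" and c_1: "c 1 = 1"
begin

lemma c_0: "c 0 = 0" using c_add[of 0 0] by simp

lemma peval_superset:
  assumes "finite A" "Poly_Mapping.keys p \<subseteq> A"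
  shows "peval c s p = (\<Sum>m \<in> A. c (Poly_Mapping.lookup p m) *
     (\<Prod>i \<in> Poly_Mapping.keys m. s i ^ Poly_Mapping.lookup m i))"
  unfolding peval_def using assms
  by (intro sum.mono_neutral_left) (auto simp: in_keys_iff c_0)

lemma peval_add: "peval c s (p + q) = peval c s p + peval c s q"
proof -
  let ?A = "Poly_Mapping.keys p \<union> Poly_Mapping.keys q"
  have "Poly_Mapping.keys (p + q) \<subseteq> ?A" by (rule keys_add)
  then show ?thesis
    by (simp add: peval_superset[of ?A] lookup_add c_add distrib_right sum.distrib)
qed

lemma peval_0 [simp]: "peval c s 0 = 0" by (simp add: peval_def)

lemma peval_single: "peval c s (Poly_Mapping.single m x) =
    c x * (\<Prod>i \<in> Poly_Mapping.keys m. s i ^ Poly_Mapping.lookup m i)"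
  by (simp add: peval_superset[of "{m}"])

lemma peval_const [simp]: "peval c s (pconst x) = c x"
  by (simp add: peval_single)

lemma peval_1 [simp]: "peval c s 1 = 1"
  using peval_const[of s 1] by (simp add: c_1)

lemma peval_var [simp]: "peval c s (var i) = s i"
  by (simp add: peval_single var_def c_1)

lemma prod_monomial:
  assumes "finite A" "Poly_Mapping.keys m \<subseteq> A"
  shows "(\<Prod>i \<in> Poly_Mapping.keys m. s i ^ Poly_Mapping.lookup m i) = (\<Prod>i \<in> A. (s i :: 'c) ^ Poly_Mapping.lookup m i)"
  using assms by (intro prod.mono_neutral_left) (auto simp: in_keys_iff)


lemma peval_single_mult: "peval c s (Poly_Mapping.single a x * Poly_Mapping.single b y) =
   peval c s (Poly_Mapping.single a x) * peval c s (Poly_Mapping.single b y)"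
proof -
  let ?A = "Poly_Mapping.keys a \<union> Poly_Mapping.keys b"
  show ?thesis
    by (simp add: mult_single peval_single prod_monomial[of ?A] keys_monomial_add lookup_add
        power_add prod.distrib c_mult mult_ac)
qed

lemma peval_sum: "peval c s (sum f A) = (\<Sum>i \<in> A. peval c s (f i))"
  by (induction A rule: infinite_finite_induct) (auto simp: peval_add)

lemma peval_mult: "peval c s (p * q) = peval c s p * peval c s q"
proof -
  have "peval c s (p * q) =
    peval c s ((\<Sum>m \<in> Poly_Mapping.keys p. Poly_Mapping.single m (Poly_Mapping.lookup p m)) *
      (\<Sum>m \<in> Poly_Mapping.keys q. Poly_Mapping.single m (Poly_Mapping.lookup q m)))"
    by (simp flip: poly_mapping_sum_single)
  also have "\<dots> = peval c s (\<Sum>m \<in> Poly_Mapping.keys p. Poly_Mapping.single m (Poly_Mapping.lookup p m)) *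
      peval c s (\<Sum>m \<in> Poly_Mapping.keys q. Poly_Mapping.single m (Poly_Mapping.lookup q m))"
    by (simp add: sum_product peval_sum peval_single_mult)
  finally show ?thesis by (simp flip: poly_mapping_sum_single)
qed

lemma peval_uminus: "peval c s (- p) = - peval c s p"
  using peval_add[of s p "- p"] by (simp add: eq_neg_iff_add_eq_0 add.commute)

lemma peval_diff: "peval c s (p - q) = peval c s p - peval c s q"
  using peval_add[of s p "- q"] by (simp add: peval_uminus)

lemma peval_power: "peval c s (p ^ k) = peval c s p ^ k"
  by (induction k) (auto simp: peval_mult)

lemmas peval_hom = peval_add peval_mult peval_uminus peval_diff peval_power

end

interpretation psubst: rat_algebra pconst
  rewrites "peval pconst = psubst"
  by unfold_locales (auto simp: single_add mult_single psubst_peval)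

lemma psubst_id:
  assumes "p \<in> pcarrier V" "\<And>i. i \<in> V \<Longrightarrow> s i = var i"
  shows "psubst s p = p"
  using assms(1) by (induction p rule: pcarrier_induct) (auto simp: psubst.peval_hom assms(2))

lemma psubst_psubst:
  "psubst s (psubst s' p) = psubst (\<lambda>i. psubst s (s' i)) p"
proof -
  have "p \<in> pcarrier UNIV" by (simp add: pcarrier_iff)
  then show ?thesis
    by (induction p rule: pcarrier_induct) (auto simp: psubst.peval_hom)
qed

section \<open>Power sums in terms of elementary symmetric polynomials\<close>

text \<open>Newton's recursion for x^k + y^k in terms of s = x + y and p = x y;
  \<open>psum (n + 1)\<close> is the polynomial g of the wide edge. Being defined over any
  commutative ring, it commutes with all evaluation homomorphisms.\<close>

fun psum :: "nat \<Rightarrow> 'a::comm_ring_1 \<Rightarrow> 'a \<Rightarrow> 'a" where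
  "psum 0 s p = 2"
| "psum (Suc 0) s p = s"
| "psum (Suc (Suc k)) s p = s * psum (Suc k) s p - p * psum k s p"

text \<open>The difference quotient of \<open>psum\<close> in its first argument. It comes from s
  A(s) - s' A(s') = (s - s') A(s) + s' (A(s) - A(s')) applied to the recursion of
  \<open>psum\<close>. No division takes place, so the arguments may coincide.\<close>

fun dquot1 :: "nat \<Rightarrow> 'a::comm_ring_1 \<Rightarrow> 'a \<Rightarrow> 'a \<Rightarrow> 'a" where
  "dquot1 0 s s' p = 0"
| "dquot1 (Suc 0) s s' p = 1"
| "dquot1 (Suc (Suc k)) s s' p = psum (Suc k) s p + s' * dquot1 (Suc k) s s' p - p * dquot1 k s s' p"

text \<open>The difference quotient in the second argument. Here p A(p) - p' A(p') = (p - p') A(p) +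
  p' (A(p) - A(p')) enters with a minus sign, and both initial values vanish because the power sums
  of index 0 and 1 do not involve p.\<close>

fun dquot2 :: "nat \<Rightarrow> 'a::comm_ring_1 \<Rightarrow> 'a \<Rightarrow> 'a \<Rightarrow> 'a" where
  "dquot2 0 s p p' = 0"
| "dquot2 (Suc 0) s p p' = 0"
| "dquot2 (Suc (Suc k)) s p p' = s * dquot2 (Suc k) s p p' - psum k s p - p' * dquot2 k s p p'"

lemma psum_add_mult: "psum k (x + y) (x * y) = x ^ k + y ^ k"
  by (induction k "x + y" "x * y" rule: psum.induct) (auto simp: algebra_simps)

lemma dquot1_eq: "psum k s p - psum k s' p = dquot1 k s s' p * (s - s')"
proof (induction k s s' p rule: dquot1.induct)
  case (3 k s s' p)
  have "psum (Suc (Suc k)) s p - psum (Suc (Suc k)) s' p =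
      (s - s') * psum (Suc k) s p + s' * (psum (Suc k) s p - psum (Suc k) s' p) - p * (psum k s p - psum k s' p)"
    by (simp add: algebra_simps)
  then show ?case unfolding 3 by (simp add: algebra_simps)
qed auto

lemma dquot2_eq: "psum k s p - psum k s p' = dquot2 k s p p' * (p - p')"
proof (induction k s p p' rule: dquot2.induct)
  case (3 k s p p')
  have "psum (Suc (Suc k)) s p - psum (Suc (Suc k)) s p' =
      s * (psum (Suc k) s p - psum (Suc k) s p') - (p - p') * psum k s p - p' * (psum k s p - psum k s p')"
    by (simp add: algebra_simps)
  then show ?case unfolding 3 by (simp add: algebra_simps)
qed auto

lemma psum_p_0: "psum (Suc k) s 0 = s ^ Suc k"
  by (induction k s "0 :: 'a" rule: psum.induct) auto

text \<open>At equal arguments the quotient is a derivative, here that of s^(k + 1), to which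
  \<open>psum (Suc k)\<close> reduces at p = 0.\<close>

lemma dquot1_at_0: "dquot1 (Suc k) s s 0 = of_nat (k + 1) * s ^ k"
proof (induction k)
  case (Suc k)
  have "dquot1 (Suc (Suc k)) s s 0 = psum (Suc k) s 0 + s * dquot1 (Suc k) s s 0"
    by simp
  then show ?case unfolding Suc psum_p_0 by (simp add: algebra_simps)
qed simp

text \<open>The derivative in p at p = 0 of x^(k + 2) + y^(k + 2) = s^(k + 2) - (k + 2) p s^k + ...
  . With k = n - 1 it yields the leading coefficient -(n + 1) of \<open>u\<close>.\<close>

lemma dquot2_at_0: "dquot2 (Suc (Suc k)) s 0 0 = - of_nat (k + 2) * s ^ k"
proof (induction k)
  case (Suc k)
  have "dquot2 (Suc (Suc (Suc k))) s 0 0 = s * dquot2 (Suc (Suc k)) s 0 0 - psum (Suc k) s 0"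
    by simp
  then show ?case unfolding Suc psum_p_0 by (simp add: algebra_simps)
qed simp

context rat_algebra
begin

lemma peval_2 [simp]: "peval c s 2 = 2"
  using peval_add[of s 1 1] by simp

lemma peval_psum: "peval c s (psum k a b) = psum k (peval c s a) (peval c s b)"
  by (induction k a b rule: psum.induct) (auto simp: peval_hom)

lemma peval_dquot1: "peval c s (dquot1 k a b d) = dquot1 k (peval c s a) (peval c s b) (peval c s d)"
  by (induction k a b d rule: dquot1.induct) (auto simp: peval_hom peval_psum)

lemma peval_dquot2: "peval c s (dquot2 k a b d) = dquot2 k (peval c s a) (peval c s b) (peval c s d)"
  by (induction k a b d rule: dquot2.induct) (auto simp: peval_hom peval_psum)

end

lemma psum_carrier: "a \<in> pcarrier V \<Longrightarrow> b \<in> pcarrier V \<Longrightarrow> psum k a b \<in> pcarrier V"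
proof (induction k a b rule: psum.induct)
  case (1 s p)
  have "1 + 1 \<in> pcarrier V" by (intro pcarrier_intros)
  then show ?case by simp
qed (auto intro!: pcarrier_intros)

lemma hom_poly_psum:
  "a \<in> hom_poly V 2 \<Longrightarrow> b \<in> hom_poly V 4 \<Longrightarrow> psum k a b \<in> hom_poly V (2 * int k)"
proof (induction k a b rule: psum.induct)
  case (1 s p)
  have "1 + 1 \<in> hom_poly V 0" by (intro hom_poly_add hom_poly_1)
  then show ?case by simp
next
  case (3 k s p)
  then show ?case
    using hom_poly_mult[of s V 2 "psum (Suc k) s p" "2 * int (Suc k)"]
      hom_poly_mult[of p V 4 "psum k s p" "2 * int k"]
    by (auto intro!: hom_poly_diff simp: algebra_simps)
qed auto

lemma hom_poly_dquot1:
  "a \<in> hom_poly V 2 \<Longrightarrow> b \<in> hom_poly V 2 \<Longrightarrow> d \<in> hom_poly V 4 \<Longrightarrow>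
    dquot1 k a b d \<in> hom_poly V (2 * int k - 2)"
proof (induction k a b d rule: dquot1.induct)
  case (3 k s s' p)
  then show ?case
    using hom_poly_psum[of s V p "Suc k"]
      hom_poly_mult[of s' V 2 "dquot1 (Suc k) s s' p" "2 * int (Suc k) - 2"]
      hom_poly_mult[of p V 4 "dquot1 k s s' p" "2 * int k - 2"]
    by (auto intro!: hom_poly_diff hom_poly_add simp: algebra_simps)
qed (auto simp: hom_poly_1)

lemma hom_poly_dquot2:
  "a \<in> hom_poly V 2 \<Longrightarrow> b \<in> hom_poly V 4 \<Longrightarrow> d \<in> hom_poly V 4 \<Longrightarrow>
    dquot2 k a b d \<in> hom_poly V (2 * int k - 4)"
proof (induction k a b d rule: dquot2.induct)
  case (3 k s p p')
  then show ?case
    using hom_poly_psum[of s V p k]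
      hom_poly_mult[of s V 2 "dquot2 (Suc k) s p p'" "2 * int (Suc k) - 4"]
      hom_poly_mult[of p' V 4 "dquot2 k s p p'" "2 * int k - 4"]
    by (auto intro!: hom_poly_diff hom_poly_add simp: algebra_simps)
qed auto

lemma pquot_mult_cancel: "q \<noteq> 0 \<Longrightarrow> pquot (p * q) q = p"
  unfolding pquot_def by (rule the_equality) auto

text \<open>Reads a polynomial as univariate in x_j with coefficients in the variables of
  \<open>V\<close>, which opens it to induction on the coefficient list.\<close>

lemma pcarrier_insert_poly:
  assumes "p \<in> pcarrier (insert j V)"
  obtains a where "\<And>k. poly.coeff a k \<in> pcarrier V" "p = poly a (var j)"
proof -
  have "\<exists>a. (\<forall>k. poly.coeff a k \<in> pcarrier V) \<and> p = poly a (var j)"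
    using assms
  proof (induction p rule: pcarrier_induct)
    case (const c)
    then show ?case by (intro exI[of _ "[:pconst c:]"]) (auto simp: coeff_pCons split: nat.splits)
  next
    case (var i p)
    then obtain a where a: "\<And>k. poly.coeff a k \<in> pcarrier V" "p = poly a (var j)" by blast
    show ?case
    proof (cases "i = j")
      case True
      then show ?thesis using a
        by (intro exI[of _ "pCons 0 a"]) (auto simp: coeff_pCons split: nat.splits)
    next
      case False
      then have "i \<in> V" using var by simp
      then show ?thesis using a
        by (intro exI[of _ "smult (var i) a"]) (auto intro: pcarrier_intros)
    qed
  next
    case (add p q)
    then obtain a b where "\<And>k. poly.coeff a k \<in> pcarrier V" "p = poly a (var j)"
       "\<And>k. poly.coeff b k \<in> pcarrier V" "q = poly b (var j)" by metis
    then show ?case by (intro exI[of _ "a + b"]) (auto intro: pcarrier_intros)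
  qed
  then show ?thesis using that by blast
qed

lemma var_neq_0 [simp]: "var i \<noteq> 0"
  by (simp add: var_def flip: keys_eq_empty)

text \<open>Gives the uniqueness in \<open>power_sum_poly\<close>. The second variable stands for
  x_1 x_2, and the induction runs over its powers: once the part free of it is zero, the factor x_1
  x_2 cancels because \<open>qpoly\<close> is a domain.\<close>

lemma elementary_symmetric_independent:
  fixes \<sigma> :: "nat \<Rightarrow> qpoly"
  defines "\<sigma> \<equiv> \<lambda>i. if i = 1 then var 1 + var 2 else var 1 * var 2"
  assumes "p \<in> pcarrier {1, 2}" "psubst \<sigma> p = 0"
  shows "p = 0"
proof -
  have "p \<in> pcarrier (insert 2 {1})" using assms(2) by (simp add: insert_commute)
  then obtain a where a: "\<And>k. poly.coeff a k \<in> pcarrier {1}" "p = poly a (var 2)"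
    using pcarrier_insert_poly by blast
  have "psubst \<sigma> (poly a (var 2)) = 0 \<Longrightarrow> a = 0" using a(1)
  proof (induction a)
    case (pCons c a)
    have c: "c \<in> pcarrier {1}" using pCons.prems(2)[of 0] by simp
    have eq: "psubst \<sigma> c + var 1 * var 2 * psubst \<sigma> (poly a (var 2)) = 0"
      using pCons.prems(1) by (simp add: psubst.peval_hom \<sigma>_def)
    \<comment> \<open>Setting $x_2 = 0$ isolates the part of \<open>p\<close> not divisible by $x_2$.\<close>
    define \<tau> :: "nat \<Rightarrow> qpoly" where "\<tau> = (\<lambda>i. if i = 2 then 0 else var i)"
    have "psubst \<tau> (psubst \<sigma> c) = 0"
      using arg_cong[OF eq, of "psubst \<tau>"] by (simp add: psubst.peval_hom \<tau>_def)
    moreover have "psubst \<tau> (psubst \<sigma> c) = c"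
      unfolding psubst_psubst by (rule psubst_id[OF c]) (simp add: psubst.peval_hom \<sigma>_def \<tau>_def)
    ultimately have "c = 0" by simp
    then have "psubst \<sigma> (poly a (var 2)) = 0" using eq by simp
    moreover have "poly.coeff a k \<in> pcarrier {1}" for k using pCons.prems(2)[of "Suc k"] by simp
    ultimately have "a = 0" using pCons.IH by blast
    then show ?case using \<open>c = 0\<close> by simp
  qed simp
  then show ?thesis using a(2) assms(3) by simp
qed

lemma power_sum_poly_eq: "power_sum_poly n = psum (n + 1) (var 1) (var 2)"
  unfolding power_sum_poly_def
proof (rule the_equality, goal_cases)
  case 1
  have "psum (n + 1) (var 1) (var 2) \<in> pcarrier {1, 2}"
    by (intro psum_carrier pcarrier_var) auto
  then show ?case by (simp add: psubst.peval_psum psum_add_mult del: psum.simps)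
next
  case (2 p)
  let ?q = "psum (n + 1) (var 1) (var 2)"
  have "?q \<in> pcarrier {1, 2}"
    by (intro psum_carrier pcarrier_var) auto
  then have "p - ?q \<in> pcarrier {1, 2}" using 2 by (intro pcarrier_diff) auto
  moreover have "psubst (\<lambda>i. if i = 1 then var 1 + var 2 else var 1 * var 2) (p - ?q) = 0"
    using 2 by (simp add: psubst.peval_diff psubst.peval_psum psum_add_mult del: psum.simps)
  ultimately have "p - ?q = 0" by (rule elementary_symmetric_independent)
  then show ?case by simp
qed

lemma gsub_eq: "gsub n s p = psum (n + 1) s p"
  unfolding gsub_def power_sum_poly_eq by (simp add: psubst.peval_psum del: psum.simps)

text \<open>Replaces the exact quotient in the definition of the wide edge by a recursion whose
  degree and specialisations are accessible by induction.\<close>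

lemma pquot_gsub1:
  "s \<noteq> s' \<Longrightarrow> pquot (gsub n s p - gsub n s' p) (s - s') = dquot1 (n + 1) s s' p"
  unfolding gsub_eq dquot1_eq by (rule pquot_mult_cancel) simp

lemma pquot_gsub2:
  "p \<noteq> p' \<Longrightarrow> pquot (gsub n s p - gsub n s p') (p - p') = dquot2 (n + 1) s p p'"
  unfolding gsub_eq dquot2_eq by (rule pquot_mult_cancel) simp

lemma var_eq_iff [simp]: "var i = var j \<longleftrightarrow> i = j"
proof
  assume "var i = var j"
  from arg_cong[OF this, of "psubst (\<lambda>k. if k = i then 1 else 0)"]
  show "i = j" by (auto split: if_splits)
qed simp

lemma arc_quotient:
  assumes "i \<noteq> j"
  shows "pquot (var i ^ (n + 1) - var j ^ (n + 1)) (var i - var j) * (var i - var j)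
      = var i ^ (n + 1) - var j ^ (n + 1)" (is ?eq)
    and "pquot (var i ^ (n + 1) - var j ^ (n + 1)) (var i - var j) \<in> hom_poly {i, j} (2 * int n)" (is ?hom)
    and "pdeg (pquot (var i ^ (n + 1) - var j ^ (n + 1)) (var i - var j)) = 2 * int n" (is ?deg)
proof -
  \<comment> \<open>The geometric sum, whose terms are visibly homogeneous of one degree.\<close>
  define q :: qpoly where "q = (\<Sum>k<n + 1. var j ^ (n + 1 - Suc k) * var i ^ k)"
  have eq: "var i ^ (n + 1) - var j ^ (n + 1) = q * (var i - var j)"
    unfolding q_def by (subst power_diff_sumr2) (rule mult.commute)
  then have q: "pquot (var i ^ (n + 1) - var j ^ (n + 1)) (var i - var j) = q"
    using assms by (simp add: pquot_mult_cancel)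
  then show ?eq using eq by simp
  have "q \<in> hom_poly {i, j} (2 * int n)"
    unfolding q_def
  proof (rule hom_poly_sum)
    fix k assume "k \<in> {..<n + 1}"
    then have "2 * int n = int (n + 1 - Suc k) * 2 + int k * 2" by auto
    then show "var j ^ (n + 1 - Suc k) * var i ^ k \<in> hom_poly {i, j} (2 * int n)"
      by (simp only:) (intro hom_poly_mult hom_poly_power hom_poly_var; simp)
  qed
  then show ?hom using q by simp
  have "q \<noteq> 0"
  proof
    assume "q = 0"
    then have "var i ^ (n + 1) - var j ^ (n + 1) = (0 :: qpoly)" using eq by simp
    \<comment> \<open>At x_i = 1 and x_j = 0 the left side becomes 1.\<close>
    from arg_cong[OF this, of "psubst (\<lambda>k. if k = i then 1 else 0)"] assms
    show False by (auto simp: psubst.peval_hom)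
  qed
  then show ?deg using \<open>q \<in> _\<close> q by (simp add: pdeg_hom)
qed

section \<open>Eliminating the internal variable\<close>

text \<open>Sending both $x_1$ and $x_4$ to the polynomial variable identifies
  $\mathbb{Q}[x_1, \dots, x_4]/(x_4 - x_1)$ with $\mathbb{Q}[x_2, x_3][X]$; the inverse is evaluation
  at $x_1$.\<close>

definition elim_var :: "qpoly \<Rightarrow> qpoly poly" where
  "elim_var = peval (\<lambda>c. [:pconst c:]) (\<lambda>i. if i = 1 \<or> i = 4 then [:0, 1:] else [:var i:])"

interpretation elim: rat_algebra "\<lambda>c. [:pconst c:]"
  by unfold_locales (auto simp: single_add mult_single mult.commute)

lemma elim_var_simps [simp]:
  "elim_var (p + q) = elim_var p + elim_var q"
  "elim_var (p * q) = elim_var p * elim_var q"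
  "elim_var (p - q) = elim_var p - elim_var q"
  "elim_var (- p) = - elim_var p"
  "elim_var (p ^ k) = elim_var p ^ k"
  "elim_var 0 = 0" "elim_var 1 = 1"
  "elim_var (pconst c) = [:pconst c:]"
  "elim_var (var i) = (if i = 1 \<or> i = 4 then [:0, 1:] else [:var i:])"
  by (simp_all add: elim_var_def elim.peval_hom)

text \<open>R'[X] as a subring of the univariate polynomials over all of \<open>qpoly\<close>: the
  coefficient type admits every variable, so the restriction to x_2 and x_3 has to be
  stated.\<close>

definition rpoly :: "qpoly poly set" where
  "rpoly = {a. \<forall>k. poly.coeff a k \<in> pcarrier {2, 3}}"

text \<open>X takes over the degree 2 of x_1, hence the offset by 2 k. Coefficients with 2 k > d are
  forced to be 0, as no nonzero polynomial has negative degree.\<close>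

definition rpoly_hom :: "int \<Rightarrow> qpoly poly set" where
  "rpoly_hom d = {a. \<forall>k. poly.coeff a k \<in> hom_poly {2, 3} (d - 2 * int k)}"

lemma rpoly_0 [simp]: "0 \<in> rpoly" and rpoly_hom_0 [simp]: "0 \<in> rpoly_hom d"
  by (auto simp: rpoly_def rpoly_hom_def)

lemma rpoly_hom_subset: "a \<in> rpoly_hom d \<Longrightarrow> a \<in> rpoly"
  by (auto simp: rpoly_def rpoly_hom_def intro: hom_poly_imp_carrier)

lemma rpoly_closed:
  "a \<in> rpoly \<Longrightarrow> b \<in> rpoly \<Longrightarrow> a + b \<in> rpoly"
  "a \<in> rpoly \<Longrightarrow> b \<in> rpoly \<Longrightarrow> a - b \<in> rpoly"
  "a \<in> rpoly \<Longrightarrow> b \<in> rpoly \<Longrightarrow> a * b \<in> rpoly"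
  "a \<in> rpoly \<Longrightarrow> - a \<in> rpoly"
  "r \<in> pcarrier {2, 3} \<Longrightarrow> a \<in> rpoly \<Longrightarrow> smult r a \<in> rpoly"
  "r \<in> pcarrier {2, 3} \<Longrightarrow> a \<in> rpoly \<Longrightarrow> pCons r a \<in> rpoly"
  by (auto simp: rpoly_def coeff_mult coeff_pCons intro!: pcarrier_intros split: nat.splits)

lemma rpoly_hom_closed:
  "a \<in> rpoly_hom d \<Longrightarrow> b \<in> rpoly_hom d \<Longrightarrow> a + b \<in> rpoly_hom d"
  "a \<in> rpoly_hom d \<Longrightarrow> b \<in> rpoly_hom d \<Longrightarrow> a - b \<in> rpoly_hom d"
  "a \<in> rpoly_hom d \<Longrightarrow> - a \<in> rpoly_hom d"
  by (auto simp: rpoly_hom_def intro!: hom_poly_add hom_poly_diff hom_poly_uminus)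

lemma rpoly_hom_smult:
  "r \<in> hom_poly {2, 3} j \<Longrightarrow> a \<in> rpoly_hom d \<Longrightarrow> smult r a \<in> rpoly_hom (j + d)"
  by (auto simp: rpoly_hom_def add_diff_eq[symmetric] intro!: hom_poly_mult)

lemma rpoly_hom_mult:
  assumes "a \<in> rpoly_hom j" "b \<in> rpoly_hom d"
  shows "a * b \<in> rpoly_hom (j + d)"
proof -
  have "poly.coeff a i * poly.coeff b (k - i) \<in> hom_poly {2, 3} (j + d - 2 * int k)" if "i \<le> k" for i k
  proof -
    have "j + d - 2 * int k = (j - 2 * int i) + (d - 2 * int (k - i))" using that by simp
    then show ?thesis using assms
      by (simp only:) (auto intro!: hom_poly_mult simp: rpoly_hom_def simp del: of_nat_diff)
  qed
  then show ?thesis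
    by (auto simp: rpoly_hom_def coeff_mult intro!: hom_poly_sum)
qed

lemma elim_var_carrier: "p \<in> pcarrier {1, 2, 3, 4} \<Longrightarrow> elim_var p \<in> rpoly"
proof (induction p rule: pcarrier_induct)
  case (var i p)
  then show ?case by (auto intro!: rpoly_closed pcarrier_intros)
qed (auto intro!: rpoly_closed)

lemma elim_var_hom: "p \<in> hom_poly {1, 2, 3, 4} d \<Longrightarrow> elim_var p \<in> rpoly_hom d"
proof (induction p d rule: hom_poly_induct)
  case (const c)
  then show ?case by (auto simp: rpoly_hom_def coeff_pCons hom_poly_const split: nat.splits)
next
  case (var i p k)
  have "[:0, 1:] \<in> rpoly_hom 2"
    by (auto simp: rpoly_hom_def coeff_pCons hom_poly_1 split: nat.splits)
  then have "pCons 0 (elim_var p) \<in> rpoly_hom (k + 2)"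
    using rpoly_hom_mult[of "[:0, 1:]" 2 "elim_var p" k] var by (simp add: add.commute)
  moreover have "i \<in> {2, 3} \<Longrightarrow> smult (var i) (elim_var p) \<in> rpoly_hom (k + 2)"
    using rpoly_hom_smult[of "var i" 2 "elim_var p" k] var hom_poly_var[of i "{2, 3}"]
    by (simp add: add.commute)
  ultimately show ?case using var by auto
qed (auto intro!: rpoly_hom_closed)

lemma elim_var_const: "p \<in> pcarrier {2, 3} \<Longrightarrow> elim_var p = [:p:]"
  by (induction p rule: pcarrier_induct) auto

lemma elim_var_poly: "a \<in> rpoly \<Longrightarrow> elim_var (poly a (var 1)) = a"
proof (induction a)
  case (pCons c a)
  have "c \<in> pcarrier {2, 3}" using pCons.prems by (auto simp: rpoly_def dest: spec[of _ 0])
  moreover have "a \<in> rpoly" using pCons.prems by (auto simp: rpoly_def dest: spec[of _ "Suc _"])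
  ultimately show ?case using pCons.IH by (simp add: elim_var_const)
qed simp

lemma poly_var_carrier: "a \<in> rpoly \<Longrightarrow> poly a (var 1) \<in> pcarrier {1, 2, 3, 4}"
  unfolding poly_altdef
  by (intro pcarrier_intros) (auto simp: rpoly_def intro: pcarrier_mono[of "{2, 3}"])

lemma poly_var_hom:
  assumes "a \<in> rpoly_hom d"
  shows "poly a (var 1) \<in> hom_poly {1, 2, 3, 4} d"
  unfolding poly_altdef
proof (rule hom_poly_sum)
  fix k
  have "poly.coeff a k \<in> hom_poly {1, 2, 3, 4} (d - 2 * int k)"
    using assms hom_poly_mono[of "{2, 3}" "{1, 2, 3, 4}"] by (auto simp: rpoly_hom_def)
  moreover have "var 1 ^ k \<in> hom_poly {1, 2, 3, 4} (int k * 2)"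
    by (intro hom_poly_power hom_poly_var) auto
  ultimately show "poly.coeff a k * var 1 ^ k \<in> hom_poly {1, 2, 3, 4} d"
    using hom_poly_mult[of _ _ "d - 2 * int k" _ "int k * 2"] by simp
qed

text \<open>The polynomial \<open>poly (elim_var p) (var 1)\<close> is the normal form of p modulo
  x_4 - x_1, obtained by replacing x_4 by x_1. It follows that the kernel of \<open>elim_var\<close>
  on \<open>pcarrier {1, 2, 3, 4}\<close> consists of the multiples of x_4 - x_1.\<close>

lemma elim_var_kernel:
  assumes "p \<in> pcarrier {1, 2, 3, 4}"
  obtains r where "r \<in> pcarrier {1, 2, 3, 4}" "p - poly (elim_var p) (var 1) = r * (var 4 - var 1)"
proof -
  \<comment> \<open>Membership of p is carried along because the induction rule does not provide it
    in the case of a product.\<close>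
  have "p \<in> pcarrier {1, 2, 3, 4} \<and>
    (\<exists>r \<in> pcarrier {1, 2, 3, 4}. p - poly (elim_var p) (var 1) = r * (var 4 - var 1))"
    using assms
  proof (induction p rule: pcarrier_induct)
    case (const c)
    then show ?case by (auto intro!: bexI[of _ 0])
  next
    case (var i p)
    then obtain r where r: "r \<in> pcarrier {1, 2, 3, 4}" "p - poly (elim_var p) (var 1) = r * (var 4 - var 1)"
      by blast
    then have p: "p = r * (var 4 - var 1) + poly (elim_var p) (var 1)" by (simp add: algebra_simps)
    show ?case
    proof (cases "i = 4")
      case True
      \<comment> \<open>Writes x_4 p as x_4 (p - q) + (x_4 - x_1) q + x_1 q, where q is the normal
        form of p.\<close>
      have "var 4 * p - var 1 * poly (elim_var p) (var 1)
          = (var 4 * r + poly (elim_var p) (var 1)) * (var 4 - var 1)"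
        by (subst p) (simp add: algebra_simps)
      moreover have "poly (elim_var p) (var 1) \<in> pcarrier {1, 2, 3, 4}"
        using var by (intro poly_var_carrier elim_var_carrier) auto
      ultimately show ?thesis using True r(1) var
        by (intro conjI bexI[of _ "var 4 * r + poly (elim_var p) (var 1)"]) (auto intro!: pcarrier_intros)
    next
      case False
      then have "var i * p - poly (elim_var (var i * p)) (var 1) = var i * (p - poly (elim_var p) (var 1))"
        by (auto simp: algebra_simps)
      then have "var i * p - poly (elim_var (var i * p)) (var 1) = (var i * r) * (var 4 - var 1)"
        unfolding r(2) by (simp add: mult.assoc)
      then show ?thesis using r(1) var by (intro conjI bexI[of _ "var i * r"]) (auto intro!: pcarrier_intros)
    qed
  next
    case (add p q)
    then obtain r r' where "r \<in> pcarrier {1, 2, 3, 4}" "p - poly (elim_var p) (var 1) = r * (var 4 - var 1)"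
      "r' \<in> pcarrier {1, 2, 3, 4}" "q - poly (elim_var q) (var 1) = r' * (var 4 - var 1)" by blast
    moreover have "p + q - poly (elim_var (p + q)) (var 1)
        = (p - poly (elim_var p) (var 1)) + (q - poly (elim_var q) (var 1))" by simp
    ultimately have "p + q - poly (elim_var (p + q)) (var 1) = (r + r') * (var 4 - var 1)"
      by (simp only: distrib_right)
    then show ?case using add \<open>r \<in> _\<close> \<open>r' \<in> _\<close>
      by (intro conjI bexI[of _ "r + r'"]) (auto intro!: pcarrier_intros)
  qed
  then show ?thesis using that by blast
qed

section \<open>Division by a polynomial with constant leading coefficient\<close>

text \<open>Degree below N, stated through coefficients so that N = 0 leaves only the zero
  polynomial; this is the case n = 1 of the theorem.\<close>

definition small_poly :: "nat \<Rightarrow> 'a::zero poly set" where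
  "small_poly N = {r. \<forall>k\<ge>N. poly.coeff r k = 0}"

text \<open>Euclidean quotient by \<open>u\<close> over a ring that need not be a field. For a
  \<open>graded_divisor\<close> the remainder condition determines it, since the leading coefficient
  is a nonzero rational.\<close>

definition pdiv :: "nat \<Rightarrow> 'a::comm_ring_1 poly \<Rightarrow> 'a poly \<Rightarrow> 'a poly" where
  "pdiv N u a = (THE q. a - q * u \<in> small_poly N)"

locale graded_divisor =
  fixes N :: nat and u :: "qpoly poly" and c :: rat
  assumes u_hom: "u \<in> rpoly_hom (2 * int N)"
    and u_lead: "poly.coeff u N = pconst c"
    and c_nz: "c \<noteq> 0"
    and u_small: "u \<in> small_poly (Suc N)"
begin

lemma degree_u: "degree u = N"
proof (rule antisym)
  show "degree u \<le> N" using u_small by (intro degree_le) (auto simp: small_poly_def)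
  show "N \<le> degree u" using c_nz u_lead by (intro le_degree) (auto simp flip: keys_eq_empty)
qed

lemma u_nz: "u \<noteq> 0"
  using u_lead c_nz by (auto simp flip: keys_eq_empty)

text \<open>A nonzero multiple of \<open>u\<close> has degree at least N, degrees being additive
  over a domain. This is the uniqueness of division.\<close>

lemma mult_small_imp_0:
  assumes "q * u \<in> small_poly N"
  shows "q = 0"
proof (rule ccontr)
  assume "q \<noteq> 0"
  then have "degree (q * u) = degree q + N" using u_nz by (simp add: degree_mult_eq degree_u)
  moreover have "poly.coeff (q * u) (degree (q * u)) \<noteq> 0"
    using \<open>q \<noteq> 0\<close> u_nz by simp
  ultimately show False using assms by (auto simp: small_poly_def)
qed

text \<open>Long division uses only that \<open>A\<close> is closed under differences and under
  products with homogeneous elements of R'. Three choices of \<open>A\<close> serve: everything, for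
  existence; R', for \<open>pdiv_carrier\<close>; the homogeneous parts, for
  \<open>pdiv_hom\<close>. By uniqueness all three produce the same quotient.\<close>

lemma division_exists:
  fixes A :: "int \<Rightarrow> qpoly set"
  assumes diff: "\<And>d p q. p \<in> A d \<Longrightarrow> q \<in> A d \<Longrightarrow> p - q \<in> A d" and zero: "\<And>d. 0 \<in> A d"
    and mult: "\<And>d j p q. p \<in> A d \<Longrightarrow> q \<in> hom_poly {2, 3} j \<Longrightarrow> p * q \<in> A (d + j)"
    and a: "\<And>k. poly.coeff a k \<in> A (d - 2 * int k)"
  obtains q where "a - q * u \<in> small_poly N" "\<And>k. poly.coeff q k \<in> A (d - 2 * int N - 2 * int k)"
proof -
  have "a \<in> small_poly m \<Longrightarrow> \<exists>q. a - q * u \<in> small_poly N \<and> (\<forall>k. poly.coeff q k \<in> A (d - 2 * int N - 2 * int k))" for m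
    using a
  proof (induction m arbitrary: a)
    case 0
    then show ?case by (intro exI[of _ 0]) (auto simp: small_poly_def zero)
  next
    case (Suc m)
    show ?case
    proof (cases "m < N")
      case True
      then show ?thesis using Suc.prems(1) by (intro exI[of _ 0]) (auto simp: small_poly_def zero)
    next
      case False
      \<comment> \<open>The top coefficient of a divided by that of \<open>u\<close>. The factor 1 /
        c is homogeneous of degree 0, so the degree bookkeeping is undisturbed.\<close>
      define b where "b = poly.coeff a m * pconst (1 / c)"
      define q0 where "q0 = monom b (m - N)"
      have b: "b \<in> A (d - 2 * int m)"
        using mult[OF Suc.prems(2)[of m] hom_poly_const] by (simp add: b_def)
      have bc: "b * pconst c = poly.coeff a m"
        using c_nz by (simp add: b_def mult.assoc mult_single)
      have coeff: "poly.coeff (q0 * u) k = (if k < m - N then 0 else b * poly.coeff u (k - (m - N)))" for k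
        by (simp add: q0_def coeff_monom_mult)
      have "a - q0 * u \<in> small_poly m"
        unfolding small_poly_def
      proof safe
        fix k assume "m \<le> k"
        then consider "k = m" | "k > m" by linarith
        then show "poly.coeff (a - q0 * u) k = 0"
        proof cases
          case 1
          then show ?thesis using False bc by (auto simp: coeff u_lead)
        next
          case 2
          then have "k - (m - N) \<ge> Suc N" using False by simp
          then show ?thesis using 2 Suc.prems(1) u_small by (auto simp: coeff small_poly_def)
        qed
      qed
      moreover have "poly.coeff (a - q0 * u) k \<in> A (d - 2 * int k)" for k
      proof -
        have "b * poly.coeff u (k - (m - N)) \<in> A (d - 2 * int k)" if "k \<ge> m - N"
        proof -
          \<comment> \<open>The degrees of b and of this coefficient of \<open>u\<close> add up to
            the one prescribed at X^k.\<close>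
          have "d - 2 * int k = (d - 2 * int m) + (2 * int N - 2 * int (k - (m - N)))"
            using False that by simp
          moreover have "poly.coeff u (k - (m - N)) \<in> hom_poly {2, 3} (2 * int N - 2 * int (k - (m - N)))"
            using u_hom by (simp add: rpoly_hom_def del: of_nat_diff)
          ultimately show ?thesis using mult[OF b] by metis
        qed
        then show ?thesis using Suc.prems(2)[of k] by (auto simp: coeff intro: diff)
      qed
      ultimately obtain q where q: "a - q0 * u - q * u \<in> small_poly N"
        "\<And>k. poly.coeff q k \<in> A (d - 2 * int N - 2 * int k)"
        using Suc.IH by blast
      have neg: "x \<in> A d' \<Longrightarrow> - x \<in> A d'" for x d' using diff[OF zero, of x] by simp
      have add: "x \<in> A d' \<Longrightarrow> y \<in> A d' \<Longrightarrow> x + y \<in> A d'" for x y d' using diff[of x d' "- y"] neg by simp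
      have "poly.coeff q0 k \<in> A (d - 2 * int N - 2 * int k)" for k
        using b False zero by (auto simp: q0_def coeff_monom algebra_simps)
      then show ?thesis using q by (intro exI[of _ "q0 + q"]) (auto simp: algebra_simps intro: add)
    qed
  qed
  moreover have "a \<in> small_poly (Suc (degree a))" by (auto simp: small_poly_def coeff_eq_0)
  ultimately show ?thesis using that by blast
qed

text \<open>With uniqueness available, each law of \<open>pdiv\<close> reduces to exhibiting a
  quotient whose remainder is small.\<close>

lemma pdiv_eq:
  assumes "a - q * u \<in> small_poly N"
  shows "pdiv N u a = q"
  unfolding pdiv_def
proof (rule the_equality)
  fix q' assume "a - q' * u \<in> small_poly N"
  then have "(q' - q) * u \<in> small_poly N" using assms by (auto simp: small_poly_def algebra_simps)
  then show "q' = q" using mult_small_imp_0 by fastforce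
qed fact

lemma pdiv_rem: "a - pdiv N u a * u \<in> small_poly N"
proof -
  obtain q where "a - q * u \<in> small_poly N"
    by (rule division_exists[of "\<lambda>_. UNIV"]) auto
  then show ?thesis using pdiv_eq by simp
qed

lemma pdiv_add: "pdiv N u (a + b) = pdiv N u a + pdiv N u b"
  using pdiv_rem[of a] pdiv_rem[of b] by (intro pdiv_eq) (auto simp: small_poly_def algebra_simps)

lemma pdiv_diff: "pdiv N u (a - b) = pdiv N u a - pdiv N u b"
  using pdiv_rem[of a] pdiv_rem[of b] by (intro pdiv_eq) (auto simp: small_poly_def algebra_simps)

lemma pdiv_smult: "pdiv N u (smult r a) = smult r (pdiv N u a)"
proof (rule pdiv_eq)
  have "smult r (a - pdiv N u a * u) \<in> small_poly N"
    using pdiv_rem[of a] by (auto simp: small_poly_def simp del: coeff_diff)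
  then show "smult r a - smult r (pdiv N u a) * u \<in> small_poly N" by (simp add: smult_diff_right)
qed

lemma pdiv_mult: "pdiv N u (q * u) = q"
  by (rule pdiv_eq) (simp add: small_poly_def)

lemma pdiv_small: "a \<in> small_poly N \<Longrightarrow> pdiv N u a = 0"
  by (rule pdiv_eq) simp

lemma pdiv_carrier: "a \<in> rpoly \<Longrightarrow> pdiv N u a \<in> rpoly"
  by (rule division_exists[of "\<lambda>_. pcarrier {2, 3}" a 0])
    (auto simp: rpoly_def pdiv_eq dest: hom_poly_imp_carrier intro!: pcarrier_intros)

lemma pdiv_hom: "a \<in> rpoly_hom d \<Longrightarrow> pdiv N u a \<in> rpoly_hom (d - 2 * int N)"
  by (rule division_exists[of "hom_poly {2, 3}" a d])
    (auto simp: rpoly_hom_def pdiv_eq intro: hom_poly_diff hom_poly_mult)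

end

section \<open>The divisor attached to the wide edge\<close>

definition const_term :: "qpoly \<Rightarrow> rat" where
  "const_term = peval id (\<lambda>_. 0)"

interpretation const_term: rat_algebra "id :: rat \<Rightarrow> rat"
  by unfold_locales auto

text \<open>Applied to the coefficients of \<open>u\<close>: those beyond X^(n - 1) have negative
  degree and disappear, and that of X^(n - 1) has degree 0 and equals its own constant term.\<close>

lemma hom_poly_le_0:
  assumes "p \<in> hom_poly V k"
  shows "(k < 0 \<longrightarrow> p = 0) \<and> (k = 0 \<longrightarrow> p = pconst (const_term p))"
  using assms
  by (induction p k rule: hom_poly_induct)
    (auto simp: const_term_def const_term.peval_hom single_add)

text \<open>\<open>elim_var\<close> followed by x_2 = x_3 = 0, with values in Q[X]: it remembers the
  constant term of each coefficient, which is enough to see leading coefficients and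
  nonvanishing.\<close>

definition elim_top :: "qpoly \<Rightarrow> rat poly" where
  "elim_top = peval (\<lambda>c. [:c:]) (\<lambda>i. if i = 1 \<or> i = 4 then [:0, 1:] else 0)"

interpretation elim_top: rat_algebra "\<lambda>c::rat. [:c:]"
  by unfold_locales auto

lemma const_term_elim_var: "const_term (poly.coeff (elim_var p) k) = poly.coeff (elim_top p) k"
proof -
  have "p \<in> pcarrier UNIV" by (simp add: pcarrier_iff)
  then show ?thesis
    by (induction p arbitrary: k rule: pcarrier_induct)
      (auto simp: elim_top_def elim_top.peval_hom const_term_def const_term.peval_hom coeff_pCons split: nat.splits)
qed

locale wide_loop =
  fixes n :: nat
  assumes n_pos: "n \<ge> 1"
begin

abbreviation "V4 \<equiv> {1, 2, 3, 4 :: nat}"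
abbreviation "s \<equiv> var 1 + var 2"
abbreviation "s' \<equiv> var 3 + var 4"
abbreviation "p \<equiv> var 1 * var 2"
abbreviation "p' \<equiv> var 3 * var 4"

definition "u1 = pquot (gsub n s p - gsub n s' p) (s - s')"
definition "u2 = pquot (gsub n s' p - gsub n s' p') (p - p')"
definition "v = pquot (var 2 ^ (n + 1) - var 3 ^ (n + 1)) (var 2 - var 3)"
definition "t = var 2 - var 3"
definition "u = elim_var u2"

lemma s_neq: "s \<noteq> s'"
proof
  assume "s = s'"
  from arg_cong[OF this, of "psubst (\<lambda>i. if i = 1 then 1 else 0)"]
  show False by (simp add: psubst.peval_hom)
qed

lemma p_neq: "p \<noteq> p'"
proof
  assume "p = p'"
  from arg_cong[OF this, of "psubst (\<lambda>i. if i = 1 \<or> i = 2 then 1 else 0)"]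
  show False by (simp add: psubst.peval_hom)
qed

lemma u1_eq: "u1 = dquot1 (n + 1) s s' p"
  unfolding u1_def using s_neq by (rule pquot_gsub1)

lemma u2_eq: "u2 = dquot2 (n + 1) s' p p'"
  unfolding u2_def using p_neq by (rule pquot_gsub2)

lemma hom_poly_p: "i \<in> V \<Longrightarrow> j \<in> V \<Longrightarrow> var i * var j \<in> hom_poly V 4"
  using hom_poly_mult[OF hom_poly_var hom_poly_var, of i V j] by simp

lemma u1_hom: "u1 \<in> hom_poly V4 (2 * int n)"
proof -
  have "u1 \<in> hom_poly V4 (2 * int (n + 1) - 2)"
    unfolding u1_eq by (intro hom_poly_dquot1 hom_poly_add hom_poly_var hom_poly_p) auto
  then show ?thesis by simp
qed

lemma u2_hom: "u2 \<in> hom_poly V4 (2 * int n - 2)"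
proof -
  have "u2 \<in> hom_poly V4 (2 * int (n + 1) - 4)"
    unfolding u2_eq by (intro hom_poly_dquot2 hom_poly_add hom_poly_var hom_poly_p) auto
  then show ?thesis by simp
qed

text \<open>At x_2 = x_3 = 0 both s and s' turn into X, so the defining fraction of
  \<open>u1\<close> has the form 0 / 0 there; only the recursion can be specialised.\<close>

lemma elim_top_u1: "elim_top u1 = of_nat (n + 1) * [:0, 1:] ^ n"
  by (simp add: u1_eq elim_top_def elim_top.peval_dquot1 elim_top.peval_hom dquot1_at_0 del: dquot1.simps)

lemma elim_top_u2: "elim_top u2 = - of_nat (n + 1) * [:0, 1:] ^ (n - 1)"
proof -
  have "dquot2 (n + 1) [:0, 1:] 0 0 = - of_nat (n + 1) * [:0, 1 :: rat:] ^ (n - 1)"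
    using dquot2_at_0[of "n - 1" "[:0, 1 :: rat:]"] n_pos by (simp del: dquot2.simps)
  then show ?thesis
    by (simp add: u2_eq elim_top_def elim_top.peval_dquot2 elim_top.peval_hom del: dquot2.simps)
qed

lemma coeff_elim_top_u2: "poly.coeff (elim_top u2) k = (if k = n - 1 then - of_nat (n + 1) else 0)"
proof -
  have "elim_top u2 = monom (- of_nat (n + 1)) (n - 1)"
    unfolding elim_top_u2 by (simp add: monom_altdef of_nat_poly flip: smult_minus_left)
  then show ?thesis by (simp add: coeff_monom)
qed

lemma pdeg_u1: "pdeg u1 = 2 * int n"
proof (rule pdeg_hom[OF u1_hom])
  have "of_nat (n + 1) * [:0, 1 :: rat:] ^ n \<noteq> 0" by (simp add: of_nat_poly)
  then show "u1 \<noteq> 0" using elim_top_u1 by (auto simp: elim_top_def)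
qed

lemma pdeg_u2: "pdeg u2 = 2 * int n - 2"
proof (rule pdeg_hom[OF u2_hom])
  show "u2 \<noteq> 0" using coeff_elim_top_u2[of "n - 1"] by (auto simp: elim_top_def)
qed

lemma u_coeff: "poly.coeff u k \<in> hom_poly {2, 3} (2 * int n - 2 - 2 * int k)"
  using elim_var_hom[OF u2_hom] by (simp add: u_def rpoly_hom_def)

text \<open>Homogeneity leaves a rational number as coefficient of X^(n - 1), and
  \<open>elim_top\<close> computes it. The hypothesis n >= 1 keeps n - 1 from being
  truncated.\<close>

sublocale graded_divisor "n - 1" u "- of_nat (n + 1)"
proof
  show "u \<in> rpoly_hom (2 * int (n - 1))"
    using elim_var_hom[OF u2_hom] n_pos by (simp add: u_def of_nat_diff algebra_simps)
  show "poly.coeff u (n - 1) = pconst (- of_nat (n + 1))"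
    using hom_poly_le_0[OF u_coeff[of "n - 1"]] n_pos const_term_elim_var[of u2 "n - 1"]
    by (simp add: u_def of_nat_diff coeff_elim_top_u2)
  show "u \<in> small_poly (Suc (n - 1))"
    using hom_poly_le_0[OF u_coeff] n_pos by (auto simp: small_poly_def)
qed simp

lemma v_t: "v * t = var 2 ^ (n + 1) - var 3 ^ (n + 1)"
  unfolding v_def t_def by (rule arc_quotient) simp

lemma v_hom: "v \<in> hom_poly {2, 3} (2 * int n)"
  unfolding v_def by (rule arc_quotient) simp

lemma pdeg_v: "pdeg v = 2 * int n"
  unfolding v_def by (rule arc_quotient) simp

lemma t_hom: "t \<in> hom_poly {2, 3} 2"
  unfolding t_def by (intro hom_poly_diff hom_poly_var) auto

lemma t_nz: "t \<noteq> 0"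
  by (simp add: t_def)

lemma elim_var_s: "elim_var (s - s') = [:t:]"
  by (simp add: t_def)

lemma elim_var_p: "elim_var (p - p') = pCons 0 [:t:]"
  by (simp add: t_def)

text \<open>The two quotients telescope: g(s, p) - g(s', p) and g(s', p) - g(s', p') add up to the
  potential of the wide edge, in which the powers of x_1 and x_4 cancel after elimination. What
  remains is v t, and t cancels.\<close>

lemma elim_var_u1: "elim_var u1 + [:0, 1:] * u = [:v:]"
proof -
  have "psum (n + 1) s p - psum (n + 1) s' p' = u1 * (s - s') + u2 * (p - p')"
    unfolding u1_eq u2_eq dquot1_eq[symmetric] dquot2_eq[symmetric] by simp
  then have "u1 * (s - s') + u2 * (p - p') = var 1 ^ (n + 1) + var 2 ^ (n + 1) - (var 3 ^ (n + 1) + var 4 ^ (n + 1))"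
    by (simp only: psum_add_mult)
  from arg_cong[OF this, of elim_var]
  have "elim_var u1 * [:t:] + u * pCons 0 [:t:] = [:var 2:] ^ (n + 1) - [:var 3:] ^ (n + 1)"
    by (simp add: t_def flip: u_def)
  also have "\<dots> = [:v:] * [:t:]"
    using v_t by (simp add: poly_const_pow mult.commute)
  finally have "(elim_var u1 + [:0, 1:] * u) * [:t:] = [:v:] * [:t:]"
    by (simp add: algebra_simps)
  then show ?thesis using t_nz by (simp del: mult_pCons_right mult_pCons_left)
qed

end

section \<open>Modules over the polynomial ring\<close>

lemma module_cong:
  fixes M M' :: "'b qmodule"
  assumes "Module.module R M" "carrier M' = carrier M" "ring.add M' = ring.add M" "ring.zero M' = ring.zero M" "module.smult M' = module.smult M"
  shows "Module.module R M'"
  using assms by (simp add: module_def module_axioms_def abelian_group_def abelian_monoid_def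
      abelian_group_axioms_def)

lemma finsum_hom:
  assumes "abelian_monoid M" "abelian_monoid M'"
    and "\<phi> \<in> carrier M \<rightarrow> carrier M'"
    and "\<And>x y. x \<in> carrier M \<Longrightarrow> y \<in> carrier M \<Longrightarrow> \<phi> (x \<oplus>\<^bsub>M\<^esub> y) = \<phi> x \<oplus>\<^bsub>M'\<^esub> \<phi> y"
    and "\<phi> \<zero>\<^bsub>M\<^esub> = \<zero>\<^bsub>M'\<^esub>" "finite A" "f \<in> A \<rightarrow> carrier M"
  shows "\<phi> (\<Oplus>\<^bsub>M\<^esub>a\<in>A. f a) = (\<Oplus>\<^bsub>M'\<^esub>a\<in>A. \<phi> (f a))"
proof -
  interpret M: abelian_monoid M by fact
  interpret M': abelian_monoid M' by fact
  show ?thesis using assms(6,7)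
  proof (induction A rule: finite_induct)
    case (insert a A)
    have "(\<lambda>a. \<phi> (f a)) \<in> A \<rightarrow> carrier M'" "\<phi> (f a) \<in> carrier M'"
      using insert.prems assms(3) by auto
    moreover have "f \<in> A \<rightarrow> carrier M" using insert.prems by auto
    ultimately show ?case using insert assms(4) by (simp add: M.finsum_insert M'.finsum_insert M.finsum_closed)
  qed (simp add: assms)
qed

lemma submodule_zero: "submodule H R M \<Longrightarrow> \<zero>\<^bsub>M\<^esub> \<in> H"
  using subgroup.one_closed[of H "add_monoid M"] by (simp add: submodule_def)

locale quotient_module =
  fixes V :: "nat set" and M :: "'b qmodule" and N :: "'b set"
  assumes module: "Module.module (poly_ring V) M" and submodule: "submodule N (poly_ring V) M"
begin

sublocale M: Module.module "poly_ring V" M by (rule module)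

sublocale N: abelian_subgroup N M
proof (rule abelian_subgroupI3)
  show "additive_subgroup N M" using submodule by (auto intro: additive_subgroup.intro simp: submodule_def)
qed (rule M.abelian_group_axioms)

abbreviation "Q \<equiv> quot_module M N"

lemma carrier_Q: "carrier Q = (\<lambda>x. N +>\<^bsub>M\<^esub> x) ` carrier M"
  by (auto simp: quot_module_def A_RCOSETS_def')

lemma coset_carrier [intro]: "x \<in> carrier M \<Longrightarrow> N +>\<^bsub>M\<^esub> x \<in> carrier Q"
  by (simp add: carrier_Q)

lemma zero_Q: "\<zero>\<^bsub>Q\<^esub> = N"
  by (simp add: quot_module_def)

lemma coset_zero: "N +>\<^bsub>M\<^esub> \<zero>\<^bsub>M\<^esub> = N"
  by (rule N.a_rcos_const) (rule N.zero_closed)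

lemma coset_add: "x \<in> carrier M \<Longrightarrow> y \<in> carrier M \<Longrightarrow>
    (N +>\<^bsub>M\<^esub> x) \<oplus>\<^bsub>Q\<^esub> (N +>\<^bsub>M\<^esub> y) = N +>\<^bsub>M\<^esub> (x \<oplus>\<^bsub>M\<^esub> y)"
  by (simp add: quot_module_def N.a_rcos_sum)

lemma coset_eq_iff: "x \<in> carrier M \<Longrightarrow> y \<in> carrier M \<Longrightarrow>
    N +>\<^bsub>M\<^esub> x = N +>\<^bsub>M\<^esub> y \<longleftrightarrow> x \<ominus>\<^bsub>M\<^esub> y \<in> N"
proof -
  assume xy: "x \<in> carrier M" "y \<in> carrier M"
  have "N +>\<^bsub>M\<^esub> x = N +>\<^bsub>M\<^esub> y \<longleftrightarrow> x \<in> N +>\<^bsub>M\<^esub> y"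
    using xy N.a_repr_independence' N.a_rcos_self by metis
  also have "\<dots> \<longleftrightarrow> x \<ominus>\<^bsub>M\<^esub> y \<in> N"
    using xy by (simp add: N.a_rcos_module a_minus_def)
  finally show ?thesis .
qed

text \<open>Operations on a quotient are unions over representatives. A coset is nonempty, so once
  the value is independent of the representative the union collapses to that value.\<close>

lemma coset_lift:
  assumes "x \<in> carrier M" "\<And>y. y \<in> carrier M \<Longrightarrow> y \<ominus>\<^bsub>M\<^esub> x \<in> N \<Longrightarrow> \<phi> y = \<phi> x"
  shows "(\<Union>y \<in> N +>\<^bsub>M\<^esub> x. \<phi> y) = \<phi> x"
proof -
  have "y \<in> carrier M \<and> y \<ominus>\<^bsub>M\<^esub> x \<in> N" if "y \<in> N +>\<^bsub>M\<^esub> x" for y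
    using that assms(1) N.a_elemrcos_carrier coset_eq_iff N.a_repr_independence' by metis
  moreover have "x \<in> N +>\<^bsub>M\<^esub> x" using assms(1) N.a_rcos_self by blast
  ultimately have "x \<in> N +>\<^bsub>M\<^esub> x" "\<forall>y \<in> N +>\<^bsub>M\<^esub> x. \<phi> y = \<phi> x" using assms(2) by blast+
  then show ?thesis by fast
qed

lemma smult_N: "r \<in> pcarrier V \<Longrightarrow> x \<in> N \<Longrightarrow> r \<odot>\<^bsub>M\<^esub> x \<in> N"
  using submodule by (rule submodule.smult_closed)

lemma smult_diff: "r \<in> pcarrier V \<Longrightarrow> x \<in> carrier M \<Longrightarrow> y \<in> carrier M \<Longrightarrow>
    r \<odot>\<^bsub>M\<^esub> (x \<ominus>\<^bsub>M\<^esub> y) = r \<odot>\<^bsub>M\<^esub> x \<ominus>\<^bsub>M\<^esub> r \<odot>\<^bsub>M\<^esub> y"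
  by (simp add: a_minus_def M.smult_r_distr M.smult_r_minus)

lemma coset_smult:
  assumes "r \<in> pcarrier V" "x \<in> carrier M"
  shows "r \<odot>\<^bsub>Q\<^esub> (N +>\<^bsub>M\<^esub> x) = N +>\<^bsub>M\<^esub> (r \<odot>\<^bsub>M\<^esub> x)"
proof -
  have "(\<Union>y \<in> N +>\<^bsub>M\<^esub> x. N +>\<^bsub>M\<^esub> (r \<odot>\<^bsub>M\<^esub> y)) = N +>\<^bsub>M\<^esub> (r \<odot>\<^bsub>M\<^esub> x)"
    using assms by (intro coset_lift) (auto simp: coset_eq_iff smult_diff[symmetric] intro: smult_N)
  then show ?thesis by (simp add: quot_module_def)
qed

lemma module_Q: "Module.module (poly_ring V) Q"
proof (rule moduleI)
  show "abelian_group Q"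
  proof (rule abelian_groupI)
    show "\<zero>\<^bsub>Q\<^esub> \<in> carrier Q" using coset_carrier[of "\<zero>\<^bsub>M\<^esub>"] by (simp add: coset_zero zero_Q)
  next
    fix X Y Z assume "X \<in> carrier Q" "Y \<in> carrier Q" "Z \<in> carrier Q"
    then show "X \<oplus>\<^bsub>Q\<^esub> Y \<oplus>\<^bsub>Q\<^esub> Z = X \<oplus>\<^bsub>Q\<^esub> (Y \<oplus>\<^bsub>Q\<^esub> Z)"
      by (auto simp: carrier_Q coset_add M.a_assoc)
  next
    fix X assume "X \<in> carrier Q"
    then obtain x where x: "x \<in> carrier M" "X = N +>\<^bsub>M\<^esub> x" by (auto simp: carrier_Q)
    have "(N +>\<^bsub>M\<^esub> \<zero>\<^bsub>M\<^esub>) \<oplus>\<^bsub>Q\<^esub> X = X" using x by (simp add: coset_add)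
    then show "\<zero>\<^bsub>Q\<^esub> \<oplus>\<^bsub>Q\<^esub> X = X" by (simp add: coset_zero zero_Q)
    have "(N +>\<^bsub>M\<^esub> \<ominus>\<^bsub>M\<^esub> x) \<oplus>\<^bsub>Q\<^esub> X = \<zero>\<^bsub>Q\<^esub>"
      using x by (simp add: coset_add M.l_neg coset_zero zero_Q)
    then show "\<exists>Y\<in>carrier Q. Y \<oplus>\<^bsub>Q\<^esub> X = \<zero>\<^bsub>Q\<^esub>" using x(1) by blast
  qed (auto simp: carrier_Q coset_add M.a_comm)
qed (auto simp: poly_ring_cring carrier_Q coset_smult coset_add M.smult_l_distr[simplified]
    M.smult_r_distr M.smult_assoc1[simplified] M.smult_one[simplified] pcarrier_intros)

sublocale Q: Module.module "poly_ring V" Q by (rule module_Q)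

lemma coset_neg: "x \<in> carrier M \<Longrightarrow> \<ominus>\<^bsub>Q\<^esub> (N +>\<^bsub>M\<^esub> x) = N +>\<^bsub>M\<^esub> (\<ominus>\<^bsub>M\<^esub> x)"
  by (rule Q.minus_equality) (auto simp: coset_add M.l_neg coset_zero zero_Q)

end

lemma graded_homD:
  assumes "f \<in> graded_hom V k M M'"
  shows "x \<in> carrier M \<Longrightarrow> f x \<in> carrier M'"
    "x \<in> carrier M \<Longrightarrow> y \<in> carrier M \<Longrightarrow> f (x \<oplus>\<^bsub>M\<^esub> y) = f x \<oplus>\<^bsub>M'\<^esub> f y"
    "r \<in> pcarrier V \<Longrightarrow> x \<in> carrier M \<Longrightarrow> f (r \<odot>\<^bsub>M\<^esub> x) = r \<odot>\<^bsub>M'\<^esub> f x"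
    "x \<in> hcomp M j \<Longrightarrow> f x \<in> hcomp M' (j + k)"
  using assms by (auto simp: graded_hom_def Pi_iff image_subset_iff)

locale linear_map = M: Module.module "poly_ring V" M + M': Module.module "poly_ring V" M'
  for V :: "nat set" and M :: "'b qmodule" and M' :: "'c qmodule" +
  fixes f :: "'b \<Rightarrow> 'c"
  assumes closed [simp]: "x \<in> carrier M \<Longrightarrow> f x \<in> carrier M'"
    and add [simp]: "x \<in> carrier M \<Longrightarrow> y \<in> carrier M \<Longrightarrow> f (x \<oplus>\<^bsub>M\<^esub> y) = f x \<oplus>\<^bsub>M'\<^esub> f y"
    and scale [simp]: "r \<in> pcarrier V \<Longrightarrow> x \<in> carrier M \<Longrightarrow> f (r \<odot>\<^bsub>M\<^esub> x) = r \<odot>\<^bsub>M'\<^esub> f x"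
begin

lemma zero [simp]: "f \<zero>\<^bsub>M\<^esub> = \<zero>\<^bsub>M'\<^esub>"
  using scale[of 0 "\<zero>\<^bsub>M\<^esub>"] M.smult_l_null[of "\<zero>\<^bsub>M\<^esub>"] M'.smult_l_null[of "f \<zero>\<^bsub>M\<^esub>"] by simp

lemma neg [simp]: "x \<in> carrier M \<Longrightarrow> f (\<ominus>\<^bsub>M\<^esub> x) = \<ominus>\<^bsub>M'\<^esub> f x"
  using add[of "\<ominus>\<^bsub>M\<^esub> x" x] by (intro M'.minus_equality[symmetric]) (auto simp: M.l_neg)

lemma minus [simp]: "x \<in> carrier M \<Longrightarrow> y \<in> carrier M \<Longrightarrow> f (x \<ominus>\<^bsub>M\<^esub> y) = f x \<ominus>\<^bsub>M'\<^esub> f y"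
  by (simp add: a_minus_def)

lemma finsum: "finite A \<Longrightarrow> g \<in> A \<rightarrow> carrier M \<Longrightarrow> f (\<Oplus>\<^bsub>M\<^esub>a\<in>A. g a) = (\<Oplus>\<^bsub>M'\<^esub>a\<in>A. f (g a))"
  by (rule finsum_hom) (auto intro: M.abelian_monoid_axioms M'.abelian_monoid_axioms)

lemma vimage_submodule:
  assumes "submodule H (poly_ring V) M'"
  shows "submodule {x \<in> carrier M. f x \<in> H} (poly_ring V) M"
proof -
  show ?thesis
    by (intro M.submoduleI) (auto intro: M'.submoduleE[OF assms] submodule_zero[OF assms])
qed

lemma image_submodule: "submodule (f ` carrier M) (poly_ring V) M'"
proof (rule M'.submoduleI)
  show "\<zero>\<^bsub>M'\<^esub> \<in> f ` carrier M" by (rule image_eqI[of _ _ "\<zero>\<^bsub>M\<^esub>"]) auto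
  fix a assume "a \<in> f ` carrier M"
  then show "\<ominus>\<^bsub>M'\<^esub> a \<in> f ` carrier M" by (auto simp flip: neg)
  fix r assume "r \<in> pcarrier V"
  then show "r \<odot>\<^bsub>M'\<^esub> a \<in> f ` carrier M" using \<open>a \<in> _\<close> by (auto simp flip: scale)
next
  fix a b assume "a \<in> f ` carrier M" "b \<in> f ` carrier M"
  then show "a \<oplus>\<^bsub>M'\<^esub> b \<in> f ` carrier M" by (auto simp flip: add)
qed auto

end

lemma linear_mapI:
  assumes "Module.module (poly_ring V) M" "Module.module (poly_ring V) M'" "f \<in> graded_hom V k M M'"
  shows "linear_map V M M' f"
  using assms by (auto simp: linear_map_def linear_map_axioms_def dest: graded_homD)



lemma submodule_ideal_smult:
  assumes "Module.module (poly_ring V) M" "I \<subseteq> pcarrier V"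
  shows "submodule (ideal_smult V I M) (poly_ring V) M"
proof -
  interpret Module.module "poly_ring V" M by fact
  let ?S = "{H. submodule H (poly_ring V) M \<and> (\<forall>r \<in> I. \<forall>x \<in> carrier M. r \<odot>\<^bsub>M\<^esub> x \<in> H)}"
  \<comment> \<open>The family being intersected is nonempty, so the intersection stays inside
    M.\<close>
  have "carrier M \<in> ?S" using assms(2) carrier_is_submodule by auto
  then show ?thesis unfolding ideal_smult_def
    by (intro submoduleI) (auto intro: submoduleE submodule_zero)
qed

lemma smult_in_ideal_smult:
  "r \<in> I \<Longrightarrow> x \<in> carrier M \<Longrightarrow> r \<odot>\<^bsub>M\<^esub> x \<in> ideal_smult V I M"
  by (auto simp: ideal_smult_def)

lemma ideal_smult_least:
  "submodule H (poly_ring V) M \<Longrightarrow> (\<And>r x. r \<in> I \<Longrightarrow> x \<in> carrier M \<Longrightarrow> r \<odot>\<^bsub>M\<^esub> x \<in> H) \<Longrightarrow>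
    ideal_smult V I M \<subseteq> H"
  by (auto simp: ideal_smult_def)

text \<open>I M is the least submodule containing the products, so it suffices to look at the
  preimage of I M' under f.\<close>

lemma (in linear_map) ideal_smult_map:
  assumes "I \<subseteq> pcarrier V" "x \<in> ideal_smult V I M"
  shows "f x \<in> ideal_smult V I M'"
proof -
  have "ideal_smult V I M \<subseteq> {x \<in> carrier M. f x \<in> ideal_smult V I M'}"
    using assms(1)
    by (intro ideal_smult_least vimage_submodule submodule_ideal_smult)
      (auto simp: subset_iff intro: smult_in_ideal_smult M'.module_axioms)
  then show ?thesis using assms(2) by blast
qed

lemma quot_map_coset:
  assumes "linear_map V M M' f" "quotient_module V M N" "quotient_module V M' N'"
    and "\<And>x. x \<in> N \<Longrightarrow> f x \<in> N'" "x \<in> carrier M"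
  shows "quot_map M' N' f (N +>\<^bsub>M\<^esub> x) = N' +>\<^bsub>M'\<^esub> f x"
proof -
  interpret f: linear_map V M M' f by fact
  interpret A: quotient_module V M N by fact
  interpret B: quotient_module V M' N' by fact
  show ?thesis unfolding quot_map_def using assms(4,5)
    by (intro A.coset_lift) (auto simp: B.coset_eq_iff simp flip: f.minus)
qed

lemma quot_map_linear:
  assumes "linear_map V M M' f" "quotient_module V M N" "quotient_module V M' N'"
    and "\<And>x. x \<in> N \<Longrightarrow> f x \<in> N'"
  shows "linear_map V (quot_module M N) (quot_module M' N') (quot_map M' N' f)"
proof -
  interpret f: linear_map V M M' f by fact
  interpret A: quotient_module V M N by fact
  interpret B: quotient_module V M' N' by fact
  let ?q = "quot_map M' N' f"
  have q: "?q (N +>\<^bsub>M\<^esub> x) = N' +>\<^bsub>M'\<^esub> f x" if "x \<in> carrier M" for x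
    using assms that by (intro quot_map_coset) auto
  have "linear_map_axioms V A.Q B.Q ?q"
  proof
    fix X assume "X \<in> carrier A.Q"
    then obtain x where x: "x \<in> carrier M" "X = N +>\<^bsub>M\<^esub> x" unfolding A.carrier_Q by blast
    show "?q X \<in> carrier B.Q" unfolding x(2) q[OF x(1)] using x(1) by (intro B.coset_carrier f.closed)
    fix r assume "r \<in> pcarrier V"
    then show "?q (r \<odot>\<^bsub>A.Q\<^esub> X) = r \<odot>\<^bsub>B.Q\<^esub> ?q X"
      using x(1) by (simp add: x(2) q A.coset_smult B.coset_smult)
  next
    fix X Y assume "X \<in> carrier A.Q" "Y \<in> carrier A.Q"
    then obtain x y where "x \<in> carrier M" "X = N +>\<^bsub>M\<^esub> x" "y \<in> carrier M" "Y = N +>\<^bsub>M\<^esub> y"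
      unfolding A.carrier_Q by blast
    then show "?q (X \<oplus>\<^bsub>A.Q\<^esub> Y) = ?q X \<oplus>\<^bsub>B.Q\<^esub> ?q Y"
      by (simp add: q A.coset_add B.coset_add)
  qed
  then show ?thesis by (intro linear_map.intro A.module_Q B.module_Q)
qed

section \<open>Graded free modules from coordinates\<close>

text \<open>A coordinate bijection onto the finitely supported families on J makes M free with basis
  degrees \<open>deg j\<close>. Injectivity of \<kappa> pulls all module axioms back from
  coordinates, so closure is all that is assumed of M itself.\<close>

lemma graded_free_coordinates:
  fixes M :: "'b qmodule" and \<kappa> :: "'b \<Rightarrow> 'j \<Rightarrow> qpoly"
  assumes closed: "\<And>x y. x \<in> carrier M \<Longrightarrow> y \<in> carrier M \<Longrightarrow> x \<oplus>\<^bsub>M\<^esub> y \<in> carrier M"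
      "\<zero>\<^bsub>M\<^esub> \<in> carrier M" "\<And>r x. r \<in> pcarrier V \<Longrightarrow> x \<in> carrier M \<Longrightarrow> r \<odot>\<^bsub>M\<^esub> x \<in> carrier M"
    and \<kappa>_add: "\<And>x y j. x \<in> carrier M \<Longrightarrow> y \<in> carrier M \<Longrightarrow> \<kappa> (x \<oplus>\<^bsub>M\<^esub> y) j = \<kappa> x j + \<kappa> y j"
    and \<kappa>_zero: "\<And>j. \<kappa> \<zero>\<^bsub>M\<^esub> j = 0"
    and \<kappa>_smult: "\<And>r x j. r \<in> pcarrier V \<Longrightarrow> x \<in> carrier M \<Longrightarrow> \<kappa> (r \<odot>\<^bsub>M\<^esub> x) j = r * \<kappa> x j"
    and inj: "inj_on \<kappa> (carrier M)"
    and img: "\<kappa> ` carrier M = {c. (\<forall>j. c j \<in> pcarrier V) \<and> finite {j. c j \<noteq> 0} \<and> (\<forall>j. j \<notin> J \<longrightarrow> c j = 0)}"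
    and hc: "\<And>k. hcomp M k = {x \<in> carrier M. \<forall>j. \<kappa> x j \<in> hom_poly V (k - deg j)}"
  shows "graded_free V M"
proof -
  have eqI: "x = y" if "x \<in> carrier M" "y \<in> carrier M" "\<And>j. \<kappa> x j = \<kappa> y j" for x y
    using inj that by (auto simp: inj_on_def)
  have \<kappa>_in: "\<kappa> x j \<in> pcarrier V" "finite {j. \<kappa> x j \<noteq> 0}" "j \<notin> J \<Longrightarrow> \<kappa> x j = 0" if "x \<in> carrier M" for x j
    using img that by auto
  define \<iota> where "\<iota> = inv_into (carrier M) \<kappa>"
  have \<iota>: "\<iota> c \<in> carrier M \<and> \<kappa> (\<iota> c) = c"
    if "\<And>j. c j \<in> pcarrier V" "finite {j. c j \<noteq> 0}" "\<And>j. j \<notin> J \<Longrightarrow> c j = 0" for c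
  proof -
    have "c \<in> \<kappa> ` carrier M" using that img by auto
    then show ?thesis unfolding \<iota>_def using inv_into_into f_inv_into_f by metis
  qed
  have ag: "abelian_group M"
  proof (rule abelian_groupI)
    fix x assume x: "x \<in> carrier M"
    let ?y = "\<iota> (\<lambda>j. - \<kappa> x j)"
    have "?y \<in> carrier M \<and> \<kappa> ?y = (\<lambda>j. - \<kappa> x j)"
      using x \<kappa>_in by (intro \<iota>) (auto intro!: pcarrier_intros)
    then show "\<exists>y\<in>carrier M. y \<oplus>\<^bsub>M\<^esub> x = \<zero>\<^bsub>M\<^esub>"
      using x by (intro bexI[of _ ?y] eqI) (auto simp: closed \<kappa>_add \<kappa>_zero)
  qed (auto intro!: eqI simp: closed \<kappa>_add \<kappa>_zero add_ac)
  have mod: "Module.module (poly_ring V) M"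
    by (rule moduleI)
      (auto intro!: eqI simp: ag poly_ring_cring closed pcarrier_add pcarrier_mult \<kappa>_add \<kappa>_zero \<kappa>_smult algebra_simps)
  interpret M: Module.module "poly_ring V" M by fact
  have \<kappa>_neg: "\<kappa> (\<ominus>\<^bsub>M\<^esub> x) j = - \<kappa> x j" if "x \<in> carrier M" for x j
    using \<kappa>_add[of "\<ominus>\<^bsub>M\<^esub> x" x j] that by (simp add: M.l_neg \<kappa>_zero eq_neg_iff_add_eq_0)
  have \<kappa>_sum: "\<kappa> (\<Oplus>\<^bsub>M\<^esub>a\<in>A. f a) j = (\<Sum>a\<in>A. \<kappa> (f a) j)" if "finite A" "f \<in> A \<rightarrow> carrier M" for f :: "int \<Rightarrow> 'b" and A j
    using that
    by (induction A rule: finite_induct) (auto simp: \<kappa>_zero \<kappa>_add M.finsum_insert M.finsum_closed Pi_iff)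
  have \<kappa>_sum': "\<kappa> (\<Oplus>\<^bsub>M\<^esub>a\<in>A. f a) j = (\<Sum>a\<in>A. \<kappa> (f a) j)" if "finite A" "f \<in> A \<rightarrow> carrier M" for f :: "'b \<Rightarrow> 'b" and A j
    using that
    by (induction A rule: finite_induct) (auto simp: \<kappa>_zero \<kappa>_add M.finsum_insert M.finsum_closed Pi_iff)
  have "graded_module V M"
    unfolding graded_module_def
  proof (intro conjI mod allI ballI)
    fix k show "subgroup (hcomp M k) (add_monoid M)"
      by (rule M.add.subgroupI)
        (auto simp: hc \<kappa>_add \<kappa>_zero \<kappa>_neg closed a_inv_def[symmetric] intro!: hom_poly_add hom_poly_uminus intro: exI[of _ "\<zero>\<^bsub>M\<^esub>"])
  next
    fix j k r x assume "r \<in> hom_poly V j" "x \<in> hcomp M k"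
    then show "r \<odot>\<^bsub>M\<^esub> x \<in> hcomp M (j + k)"
      by (auto simp: hc \<kappa>_smult hom_poly_imp_carrier closed add_diff_eq[symmetric] intro!: hom_poly_mult)
  next
    fix x assume x: "x \<in> carrier M"
    \<comment> \<open>Component of degree k: the basis element of index j supplies
      \<open>deg j\<close>, and its coefficient the rest.\<close>
    define c where "c k = \<iota> (\<lambda>j. hom_part (k - deg j) (\<kappa> x j))" for k
    have c: "c k \<in> carrier M \<and> \<kappa> (c k) = (\<lambda>j. hom_part (k - deg j) (\<kappa> x j))" for k
      unfolding c_def
    proof (rule \<iota>)
      show "hom_part (k - deg j) (\<kappa> x j) \<in> pcarrier V" for j
        using hom_part_in[OF \<kappa>_in(1)[OF x]] hom_poly_imp_carrier by blast
      show "finite {j. hom_part (k - deg j) (\<kappa> x j) \<noteq> 0}"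
        by (rule finite_subset[OF _ \<kappa>_in(2)[OF x]]) auto
      show "j \<notin> J \<Longrightarrow> hom_part (k - deg j) (\<kappa> x j) = 0" for j using \<kappa>_in(3)[OF x] by simp
    qed
    have c_nz: "c k \<noteq> \<zero>\<^bsub>M\<^esub> \<longleftrightarrow> (\<exists>j. hom_part (k - deg j) (\<kappa> x j) \<noteq> 0)" for k
    proof -
      have "c k = \<zero>\<^bsub>M\<^esub> \<longleftrightarrow> (\<forall>j. \<kappa> (c k) j = \<kappa> \<zero>\<^bsub>M\<^esub> j)"
        using c eqI[of "c k" "\<zero>\<^bsub>M\<^esub>"] closed(2) by metis
      then show ?thesis using c by (simp add: \<kappa>_zero)
    qed
    have fin: "finite {k. c k \<noteq> \<zero>\<^bsub>M\<^esub>}"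
    proof (rule finite_subset)
      show "{k. c k \<noteq> \<zero>\<^bsub>M\<^esub>} \<subseteq>
          (\<Union>j \<in> {j. \<kappa> x j \<noteq> 0}. (\<lambda>k. k + deg j) ` {k. hom_part k (\<kappa> x j) \<noteq> 0})"
      proof
        fix k assume "k \<in> {k. c k \<noteq> \<zero>\<^bsub>M\<^esub>}"
        then obtain j where j: "hom_part (k - deg j) (\<kappa> x j) \<noteq> 0" using c_nz by auto
        then have "\<kappa> x j \<noteq> 0" by auto
        then show "k \<in> (\<Union>j \<in> {j. \<kappa> x j \<noteq> 0}. (\<lambda>k. k + deg j) ` {k. hom_part k (\<kappa> x j) \<noteq> 0})"
          using j by (auto intro!: exI[of _ j] image_eqI[of _ _ "k - deg j"])
      qed
    qed (auto intro: \<kappa>_in(2)[OF x] finite_hom_part)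
    have sum: "x = (\<Oplus>\<^bsub>M\<^esub>k \<in> {k. c k \<noteq> \<zero>\<^bsub>M\<^esub>}. c k)"
    proof (rule eqI[OF x])
      show "(\<Oplus>\<^bsub>M\<^esub>k \<in> {k. c k \<noteq> \<zero>\<^bsub>M\<^esub>}. c k) \<in> carrier M" using c by (intro M.finsum_closed) auto
      fix j
      have "\<kappa> (\<Oplus>\<^bsub>M\<^esub>k \<in> {k. c k \<noteq> \<zero>\<^bsub>M\<^esub>}. c k) j = (\<Sum>k \<in> {k. c k \<noteq> \<zero>\<^bsub>M\<^esub>}. hom_part (k - deg j) (\<kappa> x j))"
        using c fin by (subst \<kappa>_sum) auto
      also have "\<dots> = (\<Sum>k \<in> (\<lambda>k. k - deg j) ` {k. c k \<noteq> \<zero>\<^bsub>M\<^esub>}. hom_part k (\<kappa> x j))"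
        by (subst sum.reindex) (auto simp: inj_on_def)
      also have "\<dots> = \<kappa> x j"
        using fin by (intro sum_hom_part) (auto simp: c_nz intro!: image_eqI[of _ _ "_ + deg j"] exI[of _ j])
      finally show "\<kappa> x j = \<kappa> (\<Oplus>\<^bsub>M\<^esub>k \<in> {k. c k \<noteq> \<zero>\<^bsub>M\<^esub>}. c k) j" ..
    qed
    show "\<exists>!c. (\<forall>k. c k \<in> hcomp M k) \<and> finite {k. c k \<noteq> \<zero>\<^bsub>M\<^esub>} \<and>
        x = (\<Oplus>\<^bsub>M\<^esub>k \<in> {k. c k \<noteq> \<zero>\<^bsub>M\<^esub>}. c k)"
    proof (rule ex1I[of _ c])
      show "(\<forall>k. c k \<in> hcomp M k) \<and> finite {k. c k \<noteq> \<zero>\<^bsub>M\<^esub>} \<and>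
        x = (\<Oplus>\<^bsub>M\<^esub>k \<in> {k. c k \<noteq> \<zero>\<^bsub>M\<^esub>}. c k)"
        using c fin sum \<kappa>_in(1)[OF x] by (auto simp: hc intro!: hom_part_in)
    next
      fix b assume b: "(\<forall>k. b k \<in> hcomp M k) \<and> finite {k. b k \<noteq> \<zero>\<^bsub>M\<^esub>} \<and>
        x = (\<Oplus>\<^bsub>M\<^esub>k \<in> {k. b k \<noteq> \<zero>\<^bsub>M\<^esub>}. b k)"
      then have bc: "b k \<in> carrier M" for k by (auto simp: hc)
      show "b = c"
      proof (rule ext, rule eqI)
        fix k j
        have "\<kappa> x j = (\<Sum>k \<in> {k. b k \<noteq> \<zero>\<^bsub>M\<^esub>}. \<kappa> (b k) j)"
          using b bc by (subst (1) conjunct2[OF conjunct2[OF b]], intro \<kappa>_sum) auto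
        \<comment> \<open>Uniqueness: extracting degree k - deg j from coordinate j isolates the
          summand of index k.\<close>
        then have "hom_part (k - deg j) (\<kappa> x j) = (\<Sum>l \<in> {k. b k \<noteq> \<zero>\<^bsub>M\<^esub>}. hom_part (k - deg j) (\<kappa> (b l) j))"
          by (simp add: hom_part_sum)
        also have "\<dots> = (\<Sum>l \<in> {k. b k \<noteq> \<zero>\<^bsub>M\<^esub>}. if l = k then \<kappa> (b k) j else 0)"
        proof (rule sum.cong)
          fix l
          have "\<kappa> (b l) j \<in> hom_poly V (l - deg j)" using b by (auto simp: hc)
          then show "hom_part (k - deg j) (\<kappa> (b l) j) = (if l = k then \<kappa> (b k) j else 0)"
            by (auto simp: hom_part_hom)
        qed simp
        also have "\<dots> = \<kappa> (b k) j" using b by (auto simp: \<kappa>_zero)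
        finally show "\<kappa> (b k) j = \<kappa> (c k) j" using c by simp
      qed (use c bc in auto)
    qed
  qed
  moreover have "\<exists>B. module_basis V M B \<and> (\<forall>b \<in> B. \<exists>k. b \<in> hcomp M k)"
  proof -
    define e where "e j = \<iota> (\<lambda>i. if i = j then 1 else 0)" for j
    have e: "e j \<in> carrier M \<and> \<kappa> (e j) = (\<lambda>i. if i = j then 1 else 0)" if "j \<in> J" for j
      unfolding e_def using that by (intro \<iota>) auto
    have e_inj: "i = j" if "i \<in> J" "j \<in> J" "e i = e j" for i j
    proof -
      have "\<kappa> (e i) j = \<kappa> (e j) j" using that by simp
      moreover have "\<kappa> (e i) j = (if j = i then 1 else 0)" "\<kappa> (e j) j = 1"
        using e[OF that(1)] e[OF that(2)] by auto
      ultimately show ?thesis by (simp split: if_splits)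
    qed
    have comb: "\<kappa> (\<Oplus>\<^bsub>M\<^esub>b \<in> {b. c b \<noteq> 0}. c b \<odot>\<^bsub>M\<^esub> b) i = (if i \<in> J then c (e i) else 0)"
      if c: "\<forall>b \<in> e ` J. c b \<in> pcarrier V" "\<forall>b. b \<notin> e ` J \<longrightarrow> c b = 0" "finite {b. c b \<noteq> 0}" for c i
    proof -
      have sub: "{b. c b \<noteq> 0} \<subseteq> e ` J" using c by auto
      have "\<kappa> (\<Oplus>\<^bsub>M\<^esub>b \<in> {b. c b \<noteq> 0}. c b \<odot>\<^bsub>M\<^esub> b) i = (\<Sum>b \<in> {b. c b \<noteq> 0}. \<kappa> (c b \<odot>\<^bsub>M\<^esub> b) i)"
        using c sub e by (intro \<kappa>_sum') (auto intro!: closed)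
      also have "\<dots> = (\<Sum>b \<in> {b. c b \<noteq> 0}. if b = e i \<and> i \<in> J then c (e i) else 0)"
      proof (rule sum.cong)
        fix b assume "b \<in> {b. c b \<noteq> 0}"
        then obtain j where "j \<in> J" "b = e j" using sub by auto
        then show "\<kappa> (c b \<odot>\<^bsub>M\<^esub> b) i = (if b = e i \<and> i \<in> J then c (e i) else 0)"
          using c e e_inj by (auto simp: \<kappa>_smult)
      qed simp
      also have "\<dots> = (if i \<in> J then c (e i) else 0)"
        using c(3) by (auto simp: sum.delta)
      finally show ?thesis .
    qed
    have "module_basis V M (e ` J)"
      unfolding module_basis_def
    proof (intro conjI ballI)
      show "e ` J \<subseteq> carrier M" using e by auto
      fix x assume x: "x \<in> carrier M"
      define c where "c b = (if b \<in> e ` J then \<kappa> x (inv_into J e b) else 0)" for b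
      have inve: "inv_into J e (e j) = j" if "j \<in> J" for j
        using that e_inj by (intro inv_into_f_f) (auto simp: inj_on_def)
      have c1: "\<forall>b \<in> e ` J. c b \<in> pcarrier V" "\<forall>b. b \<notin> e ` J \<longrightarrow> c b = 0"
        using \<kappa>_in(1)[OF x] by (auto simp: c_def)
      have c2: "finite {b. c b \<noteq> 0}"
      proof (rule finite_subset)
        show "{b. c b \<noteq> 0} \<subseteq> e ` {j. \<kappa> x j \<noteq> 0}" by (auto simp: c_def inve split: if_splits)
      qed (simp add: \<kappa>_in(2)[OF x])
      have fc: "(\<Oplus>\<^bsub>M\<^esub>b \<in> {b. c b \<noteq> 0}. c b \<odot>\<^bsub>M\<^esub> b) \<in> carrier M"
        if "\<forall>b \<in> e ` J. c b \<in> pcarrier V" "\<forall>b. b \<notin> e ` J \<longrightarrow> c b = 0" for c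
      proof (intro M.finsum_closed, rule funcsetI)
        fix b assume "b \<in> {b. c b \<noteq> 0}"
        then have "b \<in> e ` J" using that(2) by auto
        then show "c b \<odot>\<^bsub>M\<^esub> b \<in> carrier M" using that(1) e by (auto intro!: closed)
      qed
      show "\<exists>!c. (\<forall>b \<in> e ` J. c b \<in> pcarrier V) \<and> (\<forall>b. b \<notin> e ` J \<longrightarrow> c b = 0) \<and>
        finite {b. c b \<noteq> 0} \<and> x = (\<Oplus>\<^bsub>M\<^esub>b \<in> {b. c b \<noteq> 0}. c b \<odot>\<^bsub>M\<^esub> b)"
      proof (rule ex1I[of _ c])
        have "x = (\<Oplus>\<^bsub>M\<^esub>b \<in> {b. c b \<noteq> 0}. c b \<odot>\<^bsub>M\<^esub> b)"
        proof (rule eqI[OF x fc[OF c1]])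
          fix i show "\<kappa> x i = \<kappa> (\<Oplus>\<^bsub>M\<^esub>b \<in> {b. c b \<noteq> 0}. c b \<odot>\<^bsub>M\<^esub> b) i"
            using comb[OF c1 c2] \<kappa>_in(3)[OF x] by (auto simp: c_def inve)
        qed
        then show "(\<forall>b \<in> e ` J. c b \<in> pcarrier V) \<and> (\<forall>b. b \<notin> e ` J \<longrightarrow> c b = 0) \<and>
          finite {b. c b \<noteq> 0} \<and> x = (\<Oplus>\<^bsub>M\<^esub>b \<in> {b. c b \<noteq> 0}. c b \<odot>\<^bsub>M\<^esub> b)"
          using c1 c2 by blast
      next
        fix b assume b: "(\<forall>a \<in> e ` J. b a \<in> pcarrier V) \<and> (\<forall>a. a \<notin> e ` J \<longrightarrow> b a = 0) \<and>
          finite {a. b a \<noteq> 0} \<and> x = (\<Oplus>\<^bsub>M\<^esub>a \<in> {a. b a \<noteq> 0}. b a \<odot>\<^bsub>M\<^esub> a)"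
        show "b = c"
        proof
          fix a show "b a = c a"
          proof (cases "a \<in> e ` J")
            case True
            then obtain j where j: "j \<in> J" "a = e j" by auto
            have "\<kappa> x j = b (e j)" using comb[of b j] b j by metis
            then show ?thesis using j by (auto simp: c_def inve)
          qed (use b c1 in auto)
        qed
      qed
    qed
    moreover have "e j \<in> hcomp M (deg j)" if "j \<in> J" for j
      using e[OF that] by (auto simp: hc hom_poly_1)
    ultimately show ?thesis by (intro exI[of _ "e ` J"]) auto
  qed
  ultimately show ?thesis by (simp add: graded_free_def)
qed

section \<open>The maximal ideal\<close>

lemma max_ideal_ideal: "ideal (max_ideal V) (poly_ring V)"
  unfolding max_ideal_def
  by (intro ring.genideal_ideal cring.axioms(1) poly_ring_cring) (auto intro: pcarrier_var)

lemma max_ideal_carrier: "max_ideal V \<subseteq> pcarrier V"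
  using max_ideal_ideal additive_subgroup.a_subset ideal.axioms(1) by blast

lemma var_max_ideal: "i \<in> V \<Longrightarrow> var i \<in> max_ideal V"
  unfolding max_ideal_def
  using ring.genideal_self[OF cring.axioms(1)[OF poly_ring_cring], of "var ` V" V] pcarrier_var by blast

lemma max_ideal_add: "a \<in> max_ideal V \<Longrightarrow> b \<in> max_ideal V \<Longrightarrow> a + b \<in> max_ideal V"
  using additive_subgroup.a_closed[OF ideal.axioms(1)[OF max_ideal_ideal], of a V b] by simp

lemma max_ideal_mult: "a \<in> max_ideal V \<Longrightarrow> b \<in> pcarrier V \<Longrightarrow> a * b \<in> max_ideal V"
  using ideal.I_r_closed[OF max_ideal_ideal, of a V b] by simp

text \<open>The residue field is Q. It lets coefficients in R' act on the cohomology through their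
  constant terms.\<close>

lemma max_ideal_const_term:
  assumes "p \<in> pcarrier V"
  shows "p - pconst (const_term p) \<in> max_ideal V"
proof -
  have z: "0 \<in> max_ideal V"
    using additive_subgroup.zero_closed[OF ideal.axioms(1)[OF max_ideal_ideal], of V] by simp
  have "p \<in> pcarrier V \<and> p - pconst (const_term p) \<in> max_ideal V"
    using assms
  proof (induction p rule: pcarrier_induct)
    case (var i p)
    have "const_term (var i * p) = 0" by (simp add: const_term_def const_term.peval_hom)
    then show ?case using var by (auto intro: max_ideal_mult var_max_ideal pcarrier_intros)
  next
    case (add p q)
    have "p + q - pconst (const_term (p + q)) = (p - pconst (const_term p)) + (q - pconst (const_term q))"
      by (simp add: const_term_def const_term.peval_hom single_add)
    then show ?case using add max_ideal_add[of _ V] by (metis pcarrier_add)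
  qed (auto simp: z const_term_def)
  then show ?thesis by blast
qed

lemma const_term_hom:
  assumes "p \<in> hom_poly V k"
  shows "k \<noteq> 0 \<Longrightarrow> const_term p = 0"
  using assms
  by (induction p k rule: hom_poly_induct)
    (auto simp: const_term_def const_term.peval_hom)

lemma hom_poly_max_ideal: "p \<in> hom_poly V k \<Longrightarrow> k \<noteq> 0 \<Longrightarrow> p \<in> max_ideal V"
  using max_ideal_const_term[of p V] const_term_hom[of p V k] by (simp add: hom_poly_imp_carrier)

section \<open>Cohomology\<close>

text \<open>The spanning family is indexed by E and \<gamma> may repeat values, whereas
  \<open>finite_dim\<close> attaches coefficients to vectors; coefficients of equal vectors are
  added up.\<close>

lemma finite_dimI:
  fixes C :: "'b qmodule"
  assumes "Module.module (poly_ring V) C" "finite E" "\<gamma> ` E \<subseteq> carrier C"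
    and "\<And>x. x \<in> carrier C \<Longrightarrow> \<exists>q. x = (\<Oplus>\<^bsub>C\<^esub>e \<in> E. pconst (q e) \<odot>\<^bsub>C\<^esub> \<gamma> e)"
  shows "finite_dim C"
proof -
  interpret Module.module "poly_ring V" C by fact
  have "\<exists>q'. (\<Oplus>\<^bsub>C\<^esub>e \<in> E. pconst (q e) \<odot>\<^bsub>C\<^esub> \<gamma> e) = (\<Oplus>\<^bsub>C\<^esub>y \<in> \<gamma> ` E. pconst (q' y) \<odot>\<^bsub>C\<^esub> y)" for q
    using assms(2,3)
  proof (induction E rule: finite_induct)
    case (insert e E)
    then obtain q' where q': "(\<Oplus>\<^bsub>C\<^esub>e \<in> E. pconst (q e) \<odot>\<^bsub>C\<^esub> \<gamma> e) = (\<Oplus>\<^bsub>C\<^esub>y \<in> \<gamma> ` E. pconst (q' y) \<odot>\<^bsub>C\<^esub> y)"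
      by auto
    define q'' where "q'' = q'(\<gamma> e := (if \<gamma> e \<in> \<gamma> ` E then q' (\<gamma> e) + q e else q e))"
    let ?S = "\<gamma> ` E - {\<gamma> e}"
    have c: "\<gamma> e \<in> carrier C" "?S \<subseteq> carrier C" "\<gamma> ` E \<subseteq> carrier C" using insert.prems by auto
    have fin: "finite ?S" using insert.hyps by simp
    have S: "(\<Oplus>\<^bsub>C\<^esub>y \<in> ?S. pconst (q'' y) \<odot>\<^bsub>C\<^esub> y) = (\<Oplus>\<^bsub>C\<^esub>y \<in> ?S. pconst (q' y) \<odot>\<^bsub>C\<^esub> y)"
    proof (rule M.finsum_cong'[OF refl])
      show "(\<lambda>y. pconst (q' y) \<odot>\<^bsub>C\<^esub> y) \<in> ?S \<rightarrow> carrier C"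
        using c(2) by (intro funcsetI smult_closed pcarrier_const) (rule subsetD)
      fix y assume "y \<in> ?S"
      then have "y \<noteq> \<gamma> e" by simp
      then have "q'' y = q' y" unfolding q''_def by (rule fun_upd_other)
      then show "pconst (q'' y) \<odot>\<^bsub>C\<^esub> y = pconst (q' y) \<odot>\<^bsub>C\<^esub> y" by (rule arg_cong)
    qed
    have S_in: "(\<Oplus>\<^bsub>C\<^esub>y \<in> ?S. pconst (q' y) \<odot>\<^bsub>C\<^esub> y) \<in> carrier C"
      using c(2) by (intro M.finsum_closed funcsetI smult_closed) auto
    have split: "(\<Oplus>\<^bsub>C\<^esub>y \<in> insert (\<gamma> e) ?S. pconst (r y) \<odot>\<^bsub>C\<^esub> y)
        = pconst (r (\<gamma> e)) \<odot>\<^bsub>C\<^esub> \<gamma> e \<oplus>\<^bsub>C\<^esub> (\<Oplus>\<^bsub>C\<^esub>y \<in> ?S. pconst (r y) \<odot>\<^bsub>C\<^esub> y)" for r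
      using c fin by (intro M.finsum_insert funcsetI smult_closed) auto
    have "(\<Oplus>\<^bsub>C\<^esub>e \<in> insert e E. pconst (q e) \<odot>\<^bsub>C\<^esub> \<gamma> e)
        = pconst (q e) \<odot>\<^bsub>C\<^esub> \<gamma> e \<oplus>\<^bsub>C\<^esub> (\<Oplus>\<^bsub>C\<^esub>y \<in> \<gamma> ` E. pconst (q' y) \<odot>\<^bsub>C\<^esub> y)"
      unfolding q'[symmetric] using insert.hyps insert.prems
      by (intro M.finsum_insert funcsetI smult_closed) auto
    also have "\<dots> = (\<Oplus>\<^bsub>C\<^esub>y \<in> insert (\<gamma> e) ?S. pconst (q'' y) \<odot>\<^bsub>C\<^esub> y)"
    proof (cases "\<gamma> e \<in> \<gamma> ` E")
      case True
      then have ins: "\<gamma> ` E = insert (\<gamma> e) ?S" by auto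
      have "pconst (q e) \<odot>\<^bsub>C\<^esub> \<gamma> e \<oplus>\<^bsub>C\<^esub> (\<Oplus>\<^bsub>C\<^esub>y \<in> insert (\<gamma> e) ?S. pconst (q' y) \<odot>\<^bsub>C\<^esub> y)
          = (pconst (q e) \<odot>\<^bsub>C\<^esub> \<gamma> e \<oplus>\<^bsub>C\<^esub> pconst (q' (\<gamma> e)) \<odot>\<^bsub>C\<^esub> \<gamma> e) \<oplus>\<^bsub>C\<^esub> (\<Oplus>\<^bsub>C\<^esub>y \<in> ?S. pconst (q' y) \<odot>\<^bsub>C\<^esub> y)"
        unfolding split using c S_in by (simp add: M.a_assoc)
      also have "\<dots> = pconst (q'' (\<gamma> e)) \<odot>\<^bsub>C\<^esub> \<gamma> e \<oplus>\<^bsub>C\<^esub> (\<Oplus>\<^bsub>C\<^esub>y \<in> ?S. pconst (q'' y) \<odot>\<^bsub>C\<^esub> y)"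
        unfolding S using True c smult_l_distr[of "pconst (q e)" "pconst (q' (\<gamma> e))" "\<gamma> e"]
        by (simp add: q''_def single_add add.commute)
      finally have "pconst (q e) \<odot>\<^bsub>C\<^esub> \<gamma> e \<oplus>\<^bsub>C\<^esub> (\<Oplus>\<^bsub>C\<^esub>y \<in> insert (\<gamma> e) ?S. pconst (q' y) \<odot>\<^bsub>C\<^esub> y)
          = (\<Oplus>\<^bsub>C\<^esub>y \<in> insert (\<gamma> e) ?S. pconst (q'' y) \<odot>\<^bsub>C\<^esub> y)"
        unfolding split .
      moreover have "(\<Oplus>\<^bsub>C\<^esub>y \<in> \<gamma> ` E. pconst (q' y) \<odot>\<^bsub>C\<^esub> y) = (\<Oplus>\<^bsub>C\<^esub>y \<in> insert (\<gamma> e) ?S. pconst (q' y) \<odot>\<^bsub>C\<^esub> y)"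
        using ins by (rule arg_cong)
      ultimately show ?thesis by (simp only:)
    next
      case False
      then show ?thesis unfolding split S by (simp add: q''_def)
    qed
    finally show ?case by (intro exI[of _ q'']) simp
  qed simp
  note combine = this
  show ?thesis
    unfolding finite_dim_def
  proof (intro exI[of _ "\<gamma> ` E"] conjI ballI)
    fix x assume "x \<in> carrier C"
    then obtain q where q: "x = (\<Oplus>\<^bsub>C\<^esub>e \<in> E. pconst (q e) \<odot>\<^bsub>C\<^esub> \<gamma> e)" using assms(4) by blast
    obtain q' where "(\<Oplus>\<^bsub>C\<^esub>e \<in> E. pconst (q e) \<odot>\<^bsub>C\<^esub> \<gamma> e) = (\<Oplus>\<^bsub>C\<^esub>y \<in> \<gamma> ` E. pconst (q' y) \<odot>\<^bsub>C\<^esub> y)"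
      using combine by blast
    with q have "x = (\<Oplus>\<^bsub>C\<^esub>y \<in> \<gamma> ` E. pconst (q' y) \<odot>\<^bsub>C\<^esub> y)" by (rule trans)
    then show "\<exists>c. (\<forall>a \<in> \<gamma> ` E. c a \<in> pcarrier {}) \<and> x = (\<Oplus>\<^bsub>C\<^esub>y \<in> \<gamma> ` E. c y \<odot>\<^bsub>C\<^esub> y)"
      by (intro exI[of _ "\<lambda>y. pconst (q' y)"] conjI ballI pcarrier_const)
  qed (use assms(2,3) in auto)
qed

(* otherwise simp turns i + 1 into an exclusive or *)
declare add_bit_eq_xor [simp del]

lemma bit_add_1_1 [simp]: "(i :: bit) + 1 + 1 = i"
  by (cases i; simp)

lemma graded_factorizationD:
  assumes "graded_factorization V n w M"
  shows "Module.module (poly_ring V) (obj M i)"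
    and "linear_map V (obj M i) (obj M (i + 1)) (diff M i)"
    and "x \<in> carrier (obj M i) \<Longrightarrow> diff M (i + 1) (diff M i x) = w \<odot>\<^bsub>obj M i\<^esub> x"
    and "w \<in> hom_poly V (2 * (int n + 1))"
proof -
  show *: "Module.module (poly_ring V) (obj M i)" for i
    using assms by (auto simp: graded_factorization_def graded_free_def graded_module_def)
  show "linear_map V (obj M i) (obj M (i + 1)) (diff M i)"
    using assms by (intro linear_mapI[where k = "int n + 1"] *) (auto simp: graded_factorization_def)
qed (use assms in \<open>auto simp: graded_factorization_def\<close>)

lemma fact_hom_linear:
  assumes "f \<in> fact_hom V M N" "Module.module (poly_ring V) (obj M i)" "Module.module (poly_ring V) (obj N i)"
  shows "linear_map V (obj M i) (obj N i) (f i)"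
  using assms by (intro linear_mapI[where k = 0]) (auto simp: fact_hom_def)

lemma (in abelian_group) eq_add_minus:
  assumes "x \<in> carrier G" "y \<in> carrier G"
  shows "x = y \<oplus> (x \<ominus> y)"
proof -
  have "y \<oplus> (x \<ominus> y) = x \<oplus> (y \<oplus> \<ominus> y)"
    using assms by (simp only: a_minus_def a_lcomm a_inv_closed)
  then show ?thesis using assms by (simp add: r_neg)
qed

text \<open>As \<open>N\<close> is minimal (its differential vanishes modulo the maximal ideal), the images under
  \<open>g\<close> of its generators are cocycles modulo the maximal ideal, and they span the cohomology of \<open>M\<close>.\<close>

lemma finite_dim_cohomology:
  fixes M :: "'b factorization" and N :: "'c factorization" and E :: "bit \<Rightarrow> 'e set"
    and gen :: "bit \<Rightarrow> 'e \<Rightarrow> 'c" and i :: bit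
  assumes M: "graded_factorization V n w M" and N: "graded_factorization V n w N"
    and f: "f \<in> fact_hom V M N" and g: "g \<in> fact_hom V N M"
    and hty: "homotopic V n M M (\<lambda>i. g i \<circ> f i) (\<lambda>i. id)"
    and E: "\<And>i. finite (E i)" "\<And>i e. e \<in> E i \<Longrightarrow> gen i e \<in> carrier (obj N i)"
    and span: "\<And>i x. x \<in> carrier (obj N i) \<Longrightarrow>
      \<exists>c. (\<forall>e \<in> E i. c e \<in> pcarrier V) \<and> x = (\<Oplus>\<^bsub>obj N i\<^esub>e \<in> E i. c e \<odot>\<^bsub>obj N i\<^esub> gen i e)"
    and minimal: "\<And>i x. x \<in> carrier (obj N i) \<Longrightarrow> diff N i x \<in> ideal_smult V (max_ideal V) (obj N (i + 1))"
  shows "finite_dim (cohomology (quot_fact V (max_ideal V) M) i)"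
proof -
  define I where "I i = ideal_smult V (max_ideal V) (obj M i)" for i
  define Q where "Q i = quot_module (obj M i) (I i)" for i
  define dq where "dq i = quot_map (obj M (i + 1)) (I (i + 1)) (diff M i)" for i
  have qm: "quotient_module V (obj M i) (I i)" for i
    unfolding I_def
    by (intro quotient_module.intro graded_factorizationD(1)[OF M] submodule_ideal_smult max_ideal_carrier)
  interpret d: linear_map V "obj M k" "obj M (k + 1)" "diff M k" for k
    by (rule graded_factorizationD(2)[OF M])
  interpret f: linear_map V "obj M k" "obj N k" "f k" for k
    by (intro fact_hom_linear f graded_factorizationD(1)[OF M] graded_factorizationD(1)[OF N])
  interpret g: linear_map V "obj N k" "obj M k" "g k" for k
    by (intro fact_hom_linear g graded_factorizationD(1)[OF M] graded_factorizationD(1)[OF N])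
  interpret qm: quotient_module V "obj M k" "I k" for k by (rule qm)
  have dI: "x \<in> I i \<Longrightarrow> diff M i x \<in> I (i + 1)" for x i
    unfolding I_def by (rule d.ideal_smult_map[OF max_ideal_carrier])
  have dq: "linear_map V (Q i) (Q (i + 1)) (dq i)" for i
    unfolding Q_def dq_def by (intro quot_map_linear qm dI) unfold_locales
  interpret dq: linear_map V "Q k" "Q (k + 1)" "dq k" for k by (rule dq)
  have dq_coset: "dq i (I i +>\<^bsub>obj M i\<^esub> x) = I (i + 1) +>\<^bsub>obj M (i + 1)\<^esub> diff M i x"
    if "x \<in> carrier (obj M i)" for i x
    unfolding dq_def using that by (intro quot_map_coset qm dI) unfold_locales
  define Z where "Z = {X \<in> carrier (Q i). dq i X = \<zero>\<^bsub>Q (i + 1)\<^esub>}"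
  define Zm where "Zm = (Q i)\<lparr>carrier := Z, hcomp := \<lambda>k. hcomp (Q i) k \<inter> Z\<rparr>"
  define B where "B = dq (i + 1) ` carrier (Q (i + 1))"
  have coh: "cohomology (quot_fact V (max_ideal V) M) i = quot_module Zm B"
    by (simp add: cohomology_def quot_fact_def Zm_def Z_def Q_def B_def dq_def I_def Let_def)
  have "submodule {\<zero>\<^bsub>Q (i + 1)\<^esub>} (poly_ring V) (Q (i + 1))"
    by (rule dq.M.submoduleI) auto
  from dq.vimage_submodule[OF this] have Z: "submodule Z (poly_ring V) (Q i)"
    by (simp add: Z_def)
  have modZ: "Module.module (poly_ring V) Zm"
    by (rule module_cong[OF submodule.submodule_is_module[OF Z dq.M.module_axioms]]) (auto simp: Zm_def)
  interpret Zm: Module.module "poly_ring V" Zm by (rule modZ)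
  have B_Z: "B \<subseteq> Z"
  proof
    fix X assume "X \<in> B"
    then obtain x where x: "x \<in> carrier (obj M (i + 1))" "X = dq (i + 1) (I (i + 1) +>\<^bsub>obj M (i + 1)\<^esub> x)"
      by (auto simp: B_def Q_def qm.carrier_Q)
    \<comment> \<open>w has positive degree, so d^2 = w vanishes modulo the maximal ideal and
      boundaries are cocycles.\<close>
    have "w \<odot>\<^bsub>obj M (i + 1)\<^esub> x \<in> I (i + 1)"
      unfolding I_def using x(1) graded_factorizationD(4)[OF M]
      by (intro smult_in_ideal_smult hom_poly_max_ideal) auto
    then have "dq i X = \<zero>\<^bsub>Q (i + 1)\<^esub>"
      using x graded_factorizationD(3)[OF M x(1)] d.closed[of x "i + 1"] dq_coset[of "diff M (i + 1) x" i] dq_coset[of x "i + 1"]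
      by (simp add: Q_def qm.zero_Q qm.N.a_rcos_const)
    moreover have "X \<in> carrier (Q i)" using x dq.closed[of _ "i + 1"] by (auto simp: Q_def)
    ultimately show "X \<in> Z" by (simp add: Z_def)
  qed
  have "submodule B (poly_ring V) (Q i)" using dq.image_submodule[of "i + 1"] by (simp add: B_def)
  then have "Module.module (poly_ring V) ((Q i)\<lparr>carrier := B\<rparr>)"
    using submodule.submodule_is_module dq.M.module_axioms by blast
  then have "Module.module (poly_ring V) (Zm\<lparr>carrier := B\<rparr>)"
    by (rule module_cong) (auto simp: Zm_def)
  then have B: "submodule B (poly_ring V) Zm"
    using B_Z by (intro Zm.module_incl_imp_submodule) (auto simp: Zm_def)
  interpret C: quotient_module V Zm B by (intro quotient_module.intro modZ B)
  define \<gamma> where "\<gamma> y = B +>\<^bsub>Zm\<^esub> (I i +>\<^bsub>obj M i\<^esub> g i y)" for y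
  have ZI: "I i +>\<^bsub>obj M i\<^esub> x \<in> carrier Zm" if "x \<in> carrier (obj M i)" "diff M i x \<in> I (i + 1)" for x
    using that by (auto simp: Zm_def Z_def Q_def dq_coset qm.zero_Q qm.N.a_rcos_const)
  have Zm_add: "(I i +>\<^bsub>obj M i\<^esub> x) \<oplus>\<^bsub>Zm\<^esub> (I i +>\<^bsub>obj M i\<^esub> y) = I i +>\<^bsub>obj M i\<^esub> (x \<oplus>\<^bsub>obj M i\<^esub> y)"
    if "x \<in> carrier (obj M i)" "y \<in> carrier (obj M i)" for x y
    using that by (simp add: Zm_def Q_def qm.coset_add)
  have Zm_smult: "r \<odot>\<^bsub>Zm\<^esub> (I i +>\<^bsub>obj M i\<^esub> x) = I i +>\<^bsub>obj M i\<^esub> (r \<odot>\<^bsub>obj M i\<^esub> x)"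
    if "r \<in> pcarrier V" "x \<in> carrier (obj M i)" for x r
    using that by (simp add: Zm_def Q_def qm.coset_smult)
  have Zm_zero: "\<zero>\<^bsub>Zm\<^esub> = I i" by (simp add: Zm_def Q_def qm.zero_Q)
  have g_diff: "diff M i (g i y) = g (i + 1) (diff N i y)" if "y \<in> carrier (obj N i)" for y
    using g that by (simp add: fact_hom_def)
  have Zg: "I i +>\<^bsub>obj M i\<^esub> g i y \<in> carrier Zm" if "y \<in> carrier (obj N i)" for y
    using that minimal[OF that] unfolding I_def
    by (intro ZI[unfolded I_def]) (auto simp: g_diff intro!: g.ideal_smult_map[OF max_ideal_carrier])
  have \<gamma>: "linear_map V (obj N i) C.Q \<gamma>"
  proof (intro linear_map.intro linear_map_axioms.intro C.module_Q graded_factorizationD(1)[OF N])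
    fix x y assume "x \<in> carrier (obj N i)" "y \<in> carrier (obj N i)"
    then show "\<gamma> (x \<oplus>\<^bsub>obj N i\<^esub> y) = \<gamma> x \<oplus>\<^bsub>C.Q\<^esub> \<gamma> y"
      using Zg by (simp add: \<gamma>_def C.coset_add Zm_add)
  next
    fix r x assume "r \<in> pcarrier V" "x \<in> carrier (obj N i)"
    then show "\<gamma> (r \<odot>\<^bsub>obj N i\<^esub> x) = r \<odot>\<^bsub>C.Q\<^esub> \<gamma> x"
      using Zg by (simp add: \<gamma>_def C.coset_smult Zm_smult)
  qed (auto simp: \<gamma>_def intro: Zg)
  interpret \<gamma>: linear_map V "obj N i" C.Q \<gamma> by (rule \<gamma>)
  \<comment> \<open>The maximal ideal m kills M / m M, hence also the cohomology.\<close>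
  have max0: "r \<odot>\<^bsub>C.Q\<^esub> \<gamma> y = \<zero>\<^bsub>C.Q\<^esub>" if "r \<in> max_ideal V" "y \<in> carrier (obj N i)" for r y
  proof -
    have "r \<in> pcarrier V" using that max_ideal_carrier by auto
    moreover have "r \<odot>\<^bsub>obj M i\<^esub> g i y \<in> I i"
      unfolding I_def using that by (intro smult_in_ideal_smult) auto
    then have "I i +>\<^bsub>obj M i\<^esub> (r \<odot>\<^bsub>obj M i\<^esub> g i y) = \<zero>\<^bsub>Zm\<^esub>"
      by (simp add: Zm_zero qm.N.a_rcos_const)
    ultimately show ?thesis
      using that Zg by (simp add: \<gamma>_def C.coset_smult Zm_smult C.coset_zero C.zero_Q)
  qed
  obtain h where h: "\<And>i. h i \<in> graded_hom V (- int n - 1) (obj M i) (obj M (i + 1))"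
    "\<And>i x. x \<in> carrier (obj M i) \<Longrightarrow> g i (f i x) \<ominus>\<^bsub>obj M i\<^esub> x =
          h (i + 1) (diff M i x) \<oplus>\<^bsub>obj M i\<^esub> diff M (i + 1) (h i x)"
    using hty by (auto simp: homotopic_def)
  have h_lin: "linear_map V (obj M i) (obj M (i + 1)) (h i)" for i
    by (rule linear_mapI[OF graded_factorizationD(1)[OF M] graded_factorizationD(1)[OF M] h(1)])
  note h_closed = linear_map.closed[OF h_lin] and h_ideal = linear_map.ideal_smult_map[OF h_lin max_ideal_carrier]
  \<comment> \<open>For a cocycle x modulo m the homotopy gives g f x - x = h d x + d h x. Since d x
    lies in m M, so does h d x, and d h x is a boundary; thus x and g f x have the same
    class.\<close>
  have surj: "\<exists>y \<in> carrier (obj N i). X = \<gamma> y" if "X \<in> carrier C.Q" for X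
  proof -
    have "X \<in> (\<lambda>X. B +>\<^bsub>Zm\<^esub> X) ` carrier Zm"
      using that by (simp only: C.carrier_Q)
    then obtain X' where X': "X = B +>\<^bsub>Zm\<^esub> X'" "X' \<in> carrier Zm"
      by (rule imageE)
    then have "X' \<in> carrier (Q i)" by (simp add: Zm_def Z_def)
    then have "X' \<in> (\<lambda>x. I i +>\<^bsub>obj M i\<^esub> x) ` carrier (obj M i)"
      by (simp only: Q_def qm.carrier_Q)
    then obtain x where x0: "X' = I i +>\<^bsub>obj M i\<^esub> x" "x \<in> carrier (obj M i)"
      by (rule imageE)
    have x: "x \<in> carrier (obj M i)" "I i +>\<^bsub>obj M i\<^esub> x \<in> carrier Zm"
      "X = B +>\<^bsub>Zm\<^esub> (I i +>\<^bsub>obj M i\<^esub> x)"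
      using X' x0 by (simp_all only:)
    then have "I (i + 1) +>\<^bsub>obj M (i + 1)\<^esub> diff M i x = I (i + 1)"
      by (simp add: Zm_def Z_def dq_coset) (simp add: Q_def qm.zero_Q)
    then have dx: "diff M i x \<in> I (i + 1)"
      using x(1) qm.N.a_rcos_self[of "diff M i x" "i + 1"] by auto
    then have hdx: "h (i + 1) (diff M i x) \<in> I i"
      using h_ideal[of "diff M i x" "i + 1"] by (simp add: I_def)
    have hdx_c: "h (i + 1) (diff M i x) \<in> carrier (obj M i)" using x(1) h_closed[of "diff M i x" "i + 1"] by simp
    have dhx_c: "diff M (i + 1) (h i x) \<in> carrier (obj M i)" using h_closed[OF x(1)] d.closed[of "h i x" "i + 1"] by simp
    have gfx_c: "g i (f i x) \<in> carrier (obj M i)" using x(1) by simp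
    have gfx: "g i (f i x) = x \<oplus>\<^bsub>obj M i\<^esub> (h (i + 1) (diff M i x) \<oplus>\<^bsub>obj M i\<^esub> diff M (i + 1) (h i x))"
      unfolding h(2)[OF x(1), symmetric] by (rule d.M.eq_add_minus[OF gfx_c x(1)])
    have dhx: "I i +>\<^bsub>obj M i\<^esub> diff M (i + 1) (h i x) \<in> B"
    proof -
      have hx: "h i x \<in> carrier (obj M (i + 1))" using h_closed x(1) by blast
      then have "dq (i + 1) (I (i + 1) +>\<^bsub>obj M (i + 1)\<^esub> h i x) = I i +>\<^bsub>obj M i\<^esub> diff M (i + 1) (h i x)"
        using dq_coset[of "h i x" "i + 1"] by simp
      moreover have "I (i + 1) +>\<^bsub>obj M (i + 1)\<^esub> h i x \<in> carrier (Q (i + 1))"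
        unfolding Q_def using hx by (rule qm.coset_carrier)
      ultimately show ?thesis unfolding B_def by (metis imageI)
    qed
    then have dhx_Z: "I i +>\<^bsub>obj M i\<^esub> diff M (i + 1) (h i x) \<in> carrier Zm"
      using B_Z by (auto simp: Zm_def)
    have "I i +>\<^bsub>obj M i\<^esub> g i (f i x) = (I i +>\<^bsub>obj M i\<^esub> x) \<oplus>\<^bsub>Zm\<^esub>
       ((I i +>\<^bsub>obj M i\<^esub> h (i + 1) (diff M i x)) \<oplus>\<^bsub>Zm\<^esub> (I i +>\<^bsub>obj M i\<^esub> diff M (i + 1) (h i x)))"
      unfolding gfx using x(1) hdx_c dhx_c by (simp add: Zm_add)
    also have "I i +>\<^bsub>obj M i\<^esub> h (i + 1) (diff M i x) = \<zero>\<^bsub>Zm\<^esub>"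
      using hdx by (simp add: Zm_zero qm.N.a_rcos_const)
    also have "\<zero>\<^bsub>Zm\<^esub> \<oplus>\<^bsub>Zm\<^esub> (I i +>\<^bsub>obj M i\<^esub> diff M (i + 1) (h i x)) = (I i +>\<^bsub>obj M i\<^esub> diff M (i + 1) (h i x))"
      using dhx_Z by simp
    finally have "\<gamma> (f i x) = X \<oplus>\<^bsub>C.Q\<^esub> (B +>\<^bsub>Zm\<^esub> (I i +>\<^bsub>obj M i\<^esub> diff M (i + 1) (h i x)))"
      using x dhx_Z by (simp add: \<gamma>_def C.coset_add)
    also have "B +>\<^bsub>Zm\<^esub> (I i +>\<^bsub>obj M i\<^esub> diff M (i + 1) (h i x)) = \<zero>\<^bsub>C.Q\<^esub>"
      using dhx by (simp add: C.N.a_rcos_const C.zero_Q)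
    finally have "\<gamma> (f i x) = X" using that by simp
    then show ?thesis using x(1) by (intro bexI[of _ "f i x"]) auto
  qed
  have "finite_dim C.Q"
  proof (rule finite_dimI[OF C.module_Q E(1)[of i]])
    show "(\<lambda>e. \<gamma> (gen i e)) ` E i \<subseteq> carrier C.Q"
      by (intro image_subsetI \<gamma>.closed E)
    fix X assume "X \<in> carrier C.Q"
    then obtain y where y: "y \<in> carrier (obj N i)" "X = \<gamma> y" using surj by auto
    obtain c where c: "\<forall>e \<in> E i. c e \<in> pcarrier V" "y = (\<Oplus>\<^bsub>obj N i\<^esub>e \<in> E i. c e \<odot>\<^bsub>obj N i\<^esub> gen i e)"
      using span[OF y(1)] by auto
    have "X = (\<Oplus>\<^bsub>C.Q\<^esub>e \<in> E i. \<gamma> (c e \<odot>\<^bsub>obj N i\<^esub> gen i e))"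
      unfolding y(2) c(2) using c(1) E(2)
      by (intro \<gamma>.finsum E(1) funcsetI Module.module.smult_closed[OF graded_factorizationD(1)[OF N]]) auto
    \<comment> \<open>Each coefficient splits into its constant term and an element of the maximal
      ideal, which acts as zero.\<close>
    also have "\<dots> = (\<Oplus>\<^bsub>C.Q\<^esub>e \<in> E i. pconst (const_term (c e)) \<odot>\<^bsub>C.Q\<^esub> \<gamma> (gen i e))"
    proof (rule C.Q.M.finsum_cong'[OF refl])
      fix e assume "e \<in> E i"
      then have e: "gen i e \<in> carrier (obj N i)" "c e \<in> pcarrier V" using E c by auto
      let ?q = "pconst (const_term (c e))"
      have "\<gamma> (c e \<odot>\<^bsub>obj N i\<^esub> gen i e) = ((c e - ?q) + ?q) \<odot>\<^bsub>C.Q\<^esub> \<gamma> (gen i e)"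
        using e by simp
      also have "\<dots> = (c e - ?q) \<odot>\<^bsub>C.Q\<^esub> \<gamma> (gen i e) \<oplus>\<^bsub>C.Q\<^esub> ?q \<odot>\<^bsub>C.Q\<^esub> \<gamma> (gen i e)"
        using e C.Q.smult_l_distr[of "c e - ?q" ?q "\<gamma> (gen i e)"]
        by (simp add: pcarrier_diff)
      also have "\<dots> = ?q \<odot>\<^bsub>C.Q\<^esub> \<gamma> (gen i e)"
        using e max0[OF max_ideal_const_term] by simp
      finally show "\<gamma> (c e \<odot>\<^bsub>obj N i\<^esub> gen i e) = ?q \<odot>\<^bsub>C.Q\<^esub> \<gamma> (gen i e)" .
    next
      show "(\<lambda>e. pconst (const_term (c e)) \<odot>\<^bsub>C.Q\<^esub> \<gamma> (gen i e)) \<in> E i \<rightarrow> carrier C.Q"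
        by (intro funcsetI C.Q.smult_closed \<gamma>.closed E) auto
    qed
    finally show "\<exists>q. X = (\<Oplus>\<^bsub>C.Q\<^esub>e \<in> E i. pconst (q e) \<odot>\<^bsub>C.Q\<^esub> \<gamma> (gen i e))"
      by (intro exI[of _ "\<lambda>e. const_term (c e)"])
  qed
  then show ?thesis unfolding coh .
qed

section \<open>Graded modules modelled on subgroups of a type\<close>

text \<open>A model lives on a subset A of a type with its own addition, where identities are
  ordinary algebra rather than statements about record operations. \<open>sm\<close> is scalar
  multiplication, and \<open>A \<inter> H k\<close> models the part of degree k.\<close>

locale model_iso =
  fixes V :: "nat set" and sm :: "qpoly \<Rightarrow> 'a \<Rightarrow> 'a::ab_group_add" and A :: "'a set"
    and H :: "int \<Rightarrow> 'a set" and \<psi> :: "'a \<Rightarrow> 'b" and M :: "'b qmodule"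
  assumes zero_A: "0 \<in> A" and add_A: "a \<in> A \<Longrightarrow> b \<in> A \<Longrightarrow> a + b \<in> A"
    and diff_A: "a \<in> A \<Longrightarrow> b \<in> A \<Longrightarrow> a - b \<in> A"
    and sm_A: "r \<in> pcarrier V \<Longrightarrow> a \<in> A \<Longrightarrow> sm r a \<in> A"
    and bij: "bij_betw \<psi> A (carrier M)"
    and \<psi>_add: "a \<in> A \<Longrightarrow> b \<in> A \<Longrightarrow> \<psi> (a + b) = \<psi> a \<oplus>\<^bsub>M\<^esub> \<psi> b"
    and \<psi>_zero: "\<psi> 0 = \<zero>\<^bsub>M\<^esub>"
    and \<psi>_sm: "r \<in> pcarrier V \<Longrightarrow> a \<in> A \<Longrightarrow> \<psi> (sm r a) = r \<odot>\<^bsub>M\<^esub> \<psi> a"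
    and hcomp: "hcomp M k = \<psi> ` (A \<inter> H k)"
begin

lemma closed [intro]: "a \<in> A \<Longrightarrow> \<psi> a \<in> carrier M"
  using bij by (auto simp: bij_betw_def)

lemma cases:
  assumes "x \<in> carrier M"
  obtains a where "a \<in> A" "x = \<psi> a"
  using assms bij by (auto simp: bij_betw_def)

lemma inv [simp]: "a \<in> A \<Longrightarrow> inv_into A \<psi> (\<psi> a) = a"
  using bij by (auto simp: bij_betw_def)

lemma graded_free:
  fixes \<kappa> :: "'a \<Rightarrow> 'j \<Rightarrow> qpoly"
  assumes \<kappa>_add: "\<And>a b j. a \<in> A \<Longrightarrow> b \<in> A \<Longrightarrow> \<kappa> (a + b) j = \<kappa> a j + \<kappa> b j"
    and \<kappa>_sm: "\<And>r a j. r \<in> pcarrier V \<Longrightarrow> a \<in> A \<Longrightarrow> \<kappa> (sm r a) j = r * \<kappa> a j"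
    and inj: "inj_on \<kappa> A"
    and img: "\<kappa> ` A = {c. (\<forall>j. c j \<in> pcarrier V) \<and> finite {j. c j \<noteq> 0} \<and> (\<forall>j. j \<notin> J \<longrightarrow> c j = 0)}"
    and hc: "\<And>k a. a \<in> A \<Longrightarrow> a \<in> H k \<longleftrightarrow> (\<forall>j. \<kappa> a j \<in> hom_poly V (k - deg j))"
  shows "graded_free V M"
proof (rule graded_free_coordinates[where \<kappa> = "\<kappa> \<circ> inv_into A \<psi>"])
  note [elim!] = cases
  show "inj_on (\<kappa> \<circ> inv_into A \<psi>) (carrier M)"
    using inj by (auto simp: inj_on_def)
  have "(\<kappa> \<circ> inv_into A \<psi>) ` carrier M = \<kappa> ` A"
  proof -
    have "carrier M = \<psi> ` A" using bij by (simp add: bij_betw_def)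
    then show ?thesis by (simp add: image_image)
  qed
  then show "(\<kappa> \<circ> inv_into A \<psi>) ` carrier M
      = {c. (\<forall>j. c j \<in> pcarrier V) \<and> finite {j. c j \<noteq> 0} \<and> (\<forall>j. j \<notin> J \<longrightarrow> c j = 0)}"
    unfolding img .
  show "hcomp M k = {x \<in> carrier M. \<forall>j. (\<kappa> \<circ> inv_into A \<psi>) x j \<in> hom_poly V (k - deg j)}" for k
    unfolding hcomp by (auto simp: hc)
  show "(\<kappa> \<circ> inv_into A \<psi>) \<zero>\<^bsub>M\<^esub> j = 0" for j
    using \<kappa>_add[of 0 0 j] zero_A inv[OF zero_A] by (simp add: \<psi>_zero)
qed (auto elim!: cases intro!: closed simp: \<psi>_add[symmetric] \<psi>_sm[symmetric] add_A sm_A \<kappa>_add \<kappa>_sm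
      \<psi>_zero[symmetric] zero_A)

end

definition model_hom :: "nat set \<Rightarrow> (qpoly \<Rightarrow> 'a \<Rightarrow> 'a::ab_group_add) \<Rightarrow> 'a set \<Rightarrow> (int \<Rightarrow> 'a set) \<Rightarrow>
    (qpoly \<Rightarrow> 'b \<Rightarrow> 'b::ab_group_add) \<Rightarrow> 'b set \<Rightarrow> (int \<Rightarrow> 'b set) \<Rightarrow> int \<Rightarrow> ('a \<Rightarrow> 'b) \<Rightarrow> bool" where
  "model_hom V sm A H sm' A' H' k F \<longleftrightarrow>
     (\<forall>a \<in> A. F a \<in> A') \<and> (\<forall>a \<in> A. \<forall>b \<in> A. F (a + b) = F a + F b) \<and>
     (\<forall>r \<in> pcarrier V. \<forall>a \<in> A. F (sm r a) = sm' r (F a)) \<and>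
     (\<forall>j. \<forall>a \<in> A \<inter> H j. F a \<in> H' (j + k))"

lemma model_hom_graded_hom:
  assumes "model_iso V sm A H \<psi> M" "model_iso V sm' A' H' \<psi>' M'"
    and F: "model_hom V sm A H sm' A' H' k F"
    and f: "\<And>a. a \<in> A \<Longrightarrow> f (\<psi> a) = \<psi>' (F a)"
  shows "f \<in> graded_hom V k M M'"
proof -
  interpret M: model_iso V sm A H \<psi> M by fact
  interpret M': model_iso V sm' A' H' \<psi>' M' by fact
  have F_A: "F a \<in> A'" if "a \<in> A" for a using F that by (auto simp: model_hom_def)
  show ?thesis
    unfolding graded_hom_def
  proof (intro CollectI conjI ballI funcsetI allI)
    fix x assume "x \<in> carrier M"
    then obtain a where a: "a \<in> A" "x = \<psi> a" by (rule M.cases)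
    then show "f x \<in> carrier M'" using F_A by (auto simp: f)
    {
      fix y assume "y \<in> carrier M"
      then obtain b where b: "b \<in> A" "y = \<psi> b" by (rule M.cases)
      have "f (x \<oplus>\<^bsub>M\<^esub> y) = \<psi>' (F (a + b))" using a b by (simp add: M.add_A f flip: M.\<psi>_add)
      also have "\<dots> = \<psi>' (F a + F b)" using F a b by (simp add: model_hom_def)
      also have "\<dots> = f x \<oplus>\<^bsub>M'\<^esub> f y" using a b F_A by (simp add: M'.\<psi>_add f)
      finally show "f (x \<oplus>\<^bsub>M\<^esub> y) = f x \<oplus>\<^bsub>M'\<^esub> f y" .
    }
    fix r assume r: "r \<in> pcarrier V"
    have "f (r \<odot>\<^bsub>M\<^esub> x) = \<psi>' (F (sm r a))" using a r by (simp add: M.sm_A f flip: M.\<psi>_sm)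
    also have "\<dots> = \<psi>' (sm' r (F a))" using F a r by (simp add: model_hom_def)
    finally show "f (r \<odot>\<^bsub>M\<^esub> x) = r \<odot>\<^bsub>M'\<^esub> f x" using a r F_A by (simp add: M'.\<psi>_sm f)
  next
    fix j show "f ` hcomp M j \<subseteq> hcomp M' (j + k)"
      unfolding M.hcomp M'.hcomp using F by (auto simp: f model_hom_def)
  qed
qed

section \<open>From models to isomorphisms in the homotopy category\<close>

lemma graded_free_module: "graded_free V M \<Longrightarrow> Module.module (poly_ring V) M"
  by (simp add: graded_free_def graded_module_def)

text \<open>The zero map is the homotopy. The maps are compared on carriers only, since their values
  elsewhere are arbitrary.\<close>

lemma homotopic_refl:
  assumes "\<And>i. graded_free V (obj M i)" "\<And>i. graded_free V (obj N i)"
    and "\<And>i. linear_map V (obj N i) (obj N (i + 1)) (diff N i)"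
    and "\<And>i x. x \<in> carrier (obj M i) \<Longrightarrow> f i x = g i x" "\<And>i x. x \<in> carrier (obj M i) \<Longrightarrow> g i x \<in> carrier (obj N i)"
  shows "homotopic V n M N f g"
  unfolding homotopic_def
proof (intro exI[of _ "\<lambda>i x. \<zero>\<^bsub>obj N (i + 1)\<^esub>"] allI conjI ballI)
  fix i
  interpret M: Module.module "poly_ring V" "obj M i" using assms(1) by (rule graded_free_module)
  interpret N: Module.module "poly_ring V" "obj N i" using assms(2) by (rule graded_free_module)
  interpret N1: Module.module "poly_ring V" "obj N (i + 1)" using assms(2) by (rule graded_free_module)
  have "\<zero>\<^bsub>obj N (i + 1)\<^esub> \<in> hcomp (obj N (i + 1)) k" for k
    using assms(2)[of "i + 1"] subgroup.one_closed[of "hcomp (obj N (i + 1)) k" "add_monoid (obj N (i + 1))"]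
    by (auto simp: graded_free_def graded_module_def)
  then show "(\<lambda>x. \<zero>\<^bsub>obj N (i + 1)\<^esub>) \<in> graded_hom V (- int n - 1) (obj M i) (obj N (i - 1))"
    by (auto simp: graded_hom_def)
  fix x assume "x \<in> carrier (obj M i)"
  then show "f i x \<ominus>\<^bsub>obj N i\<^esub> g i x = \<zero>\<^bsub>obj N (i + 1 + 1)\<^esub> \<oplus>\<^bsub>obj N i\<^esub> diff N (i - 1) \<zero>\<^bsub>obj N (i + 1)\<^esub>"
    using assms(4,5)[of x i] linear_map.zero[OF assms(3)[of "i + 1"]] by (simp add: a_minus_def N.r_neg)
qed

text \<open>The data form a retraction: F G is the identity on the nose and h contracts the
  difference between G F and the identity. On N the differential multiplies by elements
  \<open>y i\<close> of the maximal ideal, so N is minimal; with finitely many generators, both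
  cohomologies are finite dimensional. Parity enters only through the gradings, the differentials
  and the bijections: F, G and h are the same in both parities.\<close>

lemma hmf_iso_models:
  fixes M :: "'b factorization" and N :: "'c factorization"
    and \<psi>M :: "bit \<Rightarrow> 'x::ab_group_add \<Rightarrow> 'b" and \<psi>N :: "bit \<Rightarrow> 'y::ab_group_add \<Rightarrow> 'c"
  assumes V: "finite V" "w \<in> hom_poly V (2 * (int n + 1))"
    and free: "\<And>i. graded_free V (obj M i)" "\<And>i. graded_free V (obj N i)"
    and MI: "\<And>i. model_iso V smM AM (HM i) (\<psi>M i) (obj M i)"
    and NI: "\<And>i. model_iso V smN AN (HN i) (\<psi>N i) (obj N i)"
    and dM: "\<And>i a. a \<in> AM \<Longrightarrow> diff M i (\<psi>M i a) = \<psi>M (i + 1) (DM i a)"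
    and dN: "\<And>i a. a \<in> AN \<Longrightarrow> diff N i (\<psi>N i a) = \<psi>N (i + 1) (smN (y i) a)"
    and DM: "\<And>i. model_hom V smM AM (HM i) smM AM (HM (i + 1)) (int n + 1) (DM i)"
    and DN: "\<And>i. model_hom V smN AN (HN i) smN AN (HN (i + 1)) (int n + 1) (smN (y i))"
    and w: "\<And>i a. a \<in> AM \<Longrightarrow> DM (i + 1) (DM i a) = smM w a"
      "\<And>i a. a \<in> AN \<Longrightarrow> smN (y (i + 1)) (smN (y i) a) = smN w a"
    and y: "\<And>i. y i \<in> max_ideal V"
    and F: "\<And>i. model_hom V smM AM (HM i) smN AN (HN i) 0 F"
      "\<And>i a. a \<in> AM \<Longrightarrow> F (DM i a) = smN (y i) (F a)"
    and G: "\<And>i. model_hom V smN AN (HN i) smM AM (HM i) 0 G"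
      "\<And>i a. a \<in> AN \<Longrightarrow> G (smN (y i) a) = DM i (G a)"
    and FG: "\<And>a. a \<in> AN \<Longrightarrow> F (G a) = a"
    and h: "\<And>i. model_hom V smM AM (HM i) smM AM (HM (i + 1)) (- int n - 1) h"
      "\<And>i a. a \<in> AM \<Longrightarrow> G (F a) - a = h (DM i a) + DM (i + 1) (h a)"
    and E: "finite E" "\<And>e. e \<in> E \<Longrightarrow> gen e \<in> AN"
      "\<And>a. a \<in> AN \<Longrightarrow> \<exists>c. (\<forall>e \<in> E. c e \<in> pcarrier V) \<and> a = (\<Sum>e \<in> E. smN (c e) (gen e))"
  shows "hmf_iso V n w M N"
proof -
  interpret M: model_iso V smM AM "HM k" "\<psi>M k" "obj M k" for k by (rule MI)
  interpret N: model_iso V smN AN "HN k" "\<psi>N k" "obj N k" for k by (rule NI)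
  have modM: "Module.module (poly_ring V) (obj M i)" and modN: "Module.module (poly_ring V) (obj N i)" for i
    by (rule graded_free_module, rule free)+
  interpret MM: Module.module "poly_ring V" "obj M k" for k by (rule modM)
  interpret NN: Module.module "poly_ring V" "obj N k" for k by (rule modN)
  define f where "f i x = \<psi>N i (F (inv_into AM (\<psi>M i) x))" for i x
  define g where "g i x = \<psi>M i (G (inv_into AN (\<psi>N i) x))" for i x
  define H where "H i x = \<psi>M (i + 1) (h (inv_into AM (\<psi>M i) x))" for i x
  have f: "f i (\<psi>M i a) = \<psi>N i (F a)" if "a \<in> AM" for i a using that by (simp add: f_def)
  have g: "g i (\<psi>N i a) = \<psi>M i (G a)" if "a \<in> AN" for i a using that by (simp add: g_def)
  have H: "H i (\<psi>M i a) = \<psi>M (i + 1) (h a)" if "a \<in> AM" for i a using that by (simp add: H_def)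
  have in_A: "a \<in> AM \<Longrightarrow> F a \<in> AN" "b \<in> AN \<Longrightarrow> G b \<in> AM" "a \<in> AM \<Longrightarrow> h a \<in> AM" "a \<in> AM \<Longrightarrow> DM i a \<in> AM"
    "b \<in> AN \<Longrightarrow> smN (y i) b \<in> AN" for a b i
    using F(1) G(1) h(1) DM DN by (auto simp: model_hom_def)
  have f_hom: "f i \<in> graded_hom V 0 (obj M i) (obj N i)" for i
    by (rule model_hom_graded_hom[OF MI NI F(1) f])
  have g_hom: "g i \<in> graded_hom V 0 (obj N i) (obj M i)" for i
    by (rule model_hom_graded_hom[OF NI MI G(1) g])
  have H_hom: "H i \<in> graded_hom V (- int n - 1) (obj M i) (obj M (i + 1))" for i
    by (rule model_hom_graded_hom[OF MI MI h(1) H])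
  have dM_hom: "diff M i \<in> graded_hom V (int n + 1) (obj M i) (obj M (i + 1))" for i
    by (rule model_hom_graded_hom[OF MI MI DM dM])
  have dN_hom: "diff N i \<in> graded_hom V (int n + 1) (obj N i) (obj N (i + 1))" for i
    by (rule model_hom_graded_hom[OF NI NI DN dN])
  have wV: "w \<in> pcarrier V" using V(2) by (rule hom_poly_imp_carrier)
  have gfM: "graded_factorization V n w M"
    unfolding graded_factorization_def
  proof (intro conjI allI ballI V free dM_hom)
    fix i x assume "x \<in> carrier (obj M i)"
    then obtain a where "a \<in> AM" "x = \<psi>M i a" by (rule M.cases)
    then show "diff M (i + 1) (diff M i x) = w \<odot>\<^bsub>obj M i\<^esub> x"
      using wV by (simp add: dM in_A w flip: M.\<psi>_sm)
  qed
  have gfN: "graded_factorization V n w N"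
    unfolding graded_factorization_def
  proof (intro conjI allI ballI V free dN_hom)
    fix i x assume "x \<in> carrier (obj N i)"
    then obtain a where "a \<in> AN" "x = \<psi>N i a" by (rule N.cases)
    then show "diff N (i + 1) (diff N i x) = w \<odot>\<^bsub>obj N i\<^esub> x"
      using wV by (simp add: dN in_A w flip: N.\<psi>_sm)
  qed
  have fM: "f \<in> fact_hom V M N"
    unfolding fact_hom_def
  proof (intro CollectI allI conjI f_hom ballI)
    fix i x assume "x \<in> carrier (obj M i)"
    then obtain a where "a \<in> AM" "x = \<psi>M i a" by (rule M.cases)
    then show "f (i + 1) (diff M i x) = diff N i (f i x)" by (simp add: dM dN f in_A F)
  qed
  have gM: "g \<in> fact_hom V N M"
    unfolding fact_hom_def
  proof (intro CollectI allI conjI g_hom ballI)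
    fix i x assume "x \<in> carrier (obj N i)"
    then obtain a where "a \<in> AN" "x = \<psi>N i a" by (rule N.cases)
    then show "g (i + 1) (diff N i x) = diff M i (g i x)" by (simp add: dM dN g in_A G)
  qed
  have hM: "homotopic V n M M (\<lambda>i. g i \<circ> f i) (\<lambda>i. id)"
    unfolding homotopic_def
  proof (intro exI[of _ H] allI conjI ballI)
    fix i show "H i \<in> graded_hom V (- int n - 1) (obj M i) (obj M (i - 1))" using H_hom by simp
    fix x assume "x \<in> carrier (obj M i)"
    then obtain a where a: "a \<in> AM" "x = \<psi>M i a" by (rule M.cases)
    \<comment> \<open>Compatibility of the bijection with subtraction is derived from its
      additivity.\<close>
    have "\<psi>M i (G (F a) - a) \<oplus>\<^bsub>obj M i\<^esub> \<psi>M i a = \<psi>M i (G (F a))"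
      using a by (simp add: in_A M.diff_A flip: M.\<psi>_add)
    then have "\<psi>M i (G (F a)) \<ominus>\<^bsub>obj M i\<^esub> \<psi>M i a = \<psi>M i (G (F a) - a)"
      using a M.closed[of a i] M.closed[of "G (F a) - a" i]
      by (metis MM.M.a_assoc MM.M.a_inv_closed MM.M.r_neg MM.M.r_zero M.diff_A a_minus_def in_A(1,2))
    also have "\<dots> = \<psi>M i (h (DM i a)) \<oplus>\<^bsub>obj M i\<^esub> \<psi>M i (DM (i + 1) (h a))"
      using a h(2)[of a i] by (simp add: in_A M.\<psi>_add)
    also have "\<psi>M i (h (DM i a)) = H (i + 1) (diff M i x)"
      using a H[of "DM i a" "i + 1"] by (simp add: dM in_A)
    also have "\<psi>M i (DM (i + 1) (h a)) = diff M (i - 1) (H i x)"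
      using a dM[of "h a" "i + 1"] by (simp add: H in_A)
    finally show "(g i \<circ> f i) x \<ominus>\<^bsub>obj M i\<^esub> id x = H (i + 1) (diff M i x) \<oplus>\<^bsub>obj M i\<^esub> diff M (i - 1) (H i x)"
      using a by (simp add: f g in_A)
  qed
  have hN: "homotopic V n N N (\<lambda>i. f i \<circ> g i) (\<lambda>i. id)"
  proof (rule homotopic_refl)
    fix i x assume "x \<in> carrier (obj N i)"
    then obtain a where "a \<in> AN" "x = \<psi>N i a" by (rule N.cases)
    then show "(f i \<circ> g i) x = id x" by (simp add: f g in_A FG)
  qed (auto intro: free graded_factorizationD(2)[OF gfN])
  \<comment> \<open>N is compared with itself through the identity, so that the finiteness criterion
    applied to M also covers N.\<close>
  have hN': "homotopic V n N N (\<lambda>i. id \<circ> id) (\<lambda>i. id)"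
    by (rule homotopic_refl) (auto intro: free graded_factorizationD(2)[OF gfN])
  have idN: "(\<lambda>i. id) \<in> fact_hom V N N"
    by (auto simp: fact_hom_def graded_hom_def)
  have gens: "\<exists>c. (\<forall>e \<in> E. c e \<in> pcarrier V) \<and> x = (\<Oplus>\<^bsub>obj N i\<^esub>e \<in> E. c e \<odot>\<^bsub>obj N i\<^esub> \<psi>N i (gen e))"
    if x: "x \<in> carrier (obj N i)" for i x
  proof -
    obtain a where a: "a \<in> AN" "x = \<psi>N i a" using x by (rule N.cases)
    obtain c where c: "\<forall>e \<in> E. c e \<in> pcarrier V" "a = (\<Sum>e \<in> E. smN (c e) (gen e))"
      using E(3)[OF a(1)] by auto
    \<comment> \<open>Membership of the partial sums in \<open>AN\<close> is proved alongside, since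
      additivity of the bijection holds only there.\<close>
    have "(\<Sum>e \<in> K. smN (c e) (gen e)) \<in> AN \<and>
      \<psi>N i (\<Sum>e \<in> K. smN (c e) (gen e)) = (\<Oplus>\<^bsub>obj N i\<^esub>e \<in> K. c e \<odot>\<^bsub>obj N i\<^esub> \<psi>N i (gen e))" if "K \<subseteq> E" for K
      using finite_subset[OF that E(1)] that
    proof (induction K rule: finite_induct)
      case (insert e K)
      have "smN (c e) (gen e) \<in> AN" using insert.prems c(1) E(2) by (auto intro: N.sm_A)
      moreover have "(\<Oplus>\<^bsub>obj N i\<^esub>e \<in> insert e K. c e \<odot>\<^bsub>obj N i\<^esub> \<psi>N i (gen e))
        = c e \<odot>\<^bsub>obj N i\<^esub> \<psi>N i (gen e) \<oplus>\<^bsub>obj N i\<^esub> (\<Oplus>\<^bsub>obj N i\<^esub>e \<in> K. c e \<odot>\<^bsub>obj N i\<^esub> \<psi>N i (gen e))"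
        using insert.prems insert.hyps c(1) E(2)
        by (intro NN.M.finsum_insert funcsetI NN.smult_closed N.closed) auto
      moreover have "\<psi>N i (smN (c e) (gen e)) = c e \<odot>\<^bsub>obj N i\<^esub> \<psi>N i (gen e)"
        using insert.prems c(1) E(2) by (intro N.\<psi>_sm) auto
      ultimately show ?case using insert by (simp add: N.\<psi>_add N.add_A)
    qed (simp add: N.\<psi>_zero N.zero_A)
    then show ?thesis using a c by blast
  qed
  have minimal: "diff N i x \<in> ideal_smult V (max_ideal V) (obj N (i + 1))" if x: "x \<in> carrier (obj N i)" for i x
  proof -
    obtain a where a: "a \<in> AN" "x = \<psi>N i a" using x by (rule N.cases)
    then have "diff N i x = y i \<odot>\<^bsub>obj N (i + 1)\<^esub> \<psi>N (i + 1) a"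
      using y max_ideal_carrier[of V] by (simp add: dN N.\<psi>_sm subset_iff)
    then show ?thesis using a y by (auto intro!: smult_in_ideal_smult)
  qed
  have gen_in: "e \<in> E \<Longrightarrow> \<psi>N i (gen e) \<in> carrier (obj N i)" for i e
    using E(2) by blast
  have "finite_dim (cohomology (quot_fact V (max_ideal V) M) i)" for i
    by (rule finite_dim_cohomology[OF gfM gfN fM gM hM E(1) gen_in gens minimal])
  moreover have "finite_dim (cohomology (quot_fact V (max_ideal V) N) i)" for i
    by (rule finite_dim_cohomology[OF gfN gfN idN idN hN' E(1) gen_in gens minimal])
  ultimately show ?thesis
    unfolding hmf_iso_def hmf_obj_def using gfM gfN fM gM hM hN by blast
qed

section \<open>Components of free and shifted factorizations\<close>

lemma free_fact_simps:
  "carrier (obj (free_fact V D) i) = {f. \<forall>b. f b \<in> pcarrier V \<and> (par D b \<noteq> i \<longrightarrow> f b = 0)}"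
  "\<zero>\<^bsub>obj (free_fact V D) i\<^esub> = (\<lambda>b. 0)"
  "ring.add (obj (free_fact V D) i) = (\<lambda>f g b. f b + g b)"
  "module.smult (obj (free_fact V D) i) = (\<lambda>r f b. r * f b)"
  "hcomp (obj (free_fact V D) i) k = {f. (\<forall>b. f b \<in> pcarrier V \<and> (par D b \<noteq> i \<longrightarrow> f b = 0)) \<and>
     (\<forall>b. f b \<in> hom_poly V (k - bdeg D b))}"
  "diff (free_fact V D) i = (\<lambda>f b'. \<Sum>b \<in> UNIV. f b * entry D b b')"
  by (auto simp: free_fact_def Let_def)

lemma fact_shift_simps:
  "carrier (obj (fact_shift m M) i) = carrier (obj M i)"
  "\<zero>\<^bsub>obj (fact_shift m M) i\<^esub> = \<zero>\<^bsub>obj M i\<^esub>"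
  "ring.add (obj (fact_shift m M) i) = ring.add (obj M i)"
  "module.smult (obj (fact_shift m M) i) = module.smult (obj M i)"
  "hcomp (obj (fact_shift m M) i) k = hcomp (obj M i) (k - m)"
  "diff (fact_shift m M) = diff M"
  by (auto simp: fact_shift_def module_shift_def)

lemma free_fact_module: "Module.module (poly_ring V) (obj (free_fact V D) i)"
proof (rule moduleI)
  show "abelian_group (obj (free_fact V D) i)"
  proof (rule abelian_groupI)
    fix f assume "f \<in> carrier (obj (free_fact V D) i)"
    then show "\<exists>g \<in> carrier (obj (free_fact V D) i). g \<oplus>\<^bsub>obj (free_fact V D) i\<^esub> f = \<zero>\<^bsub>obj (free_fact V D) i\<^esub>"
      by (intro bexI[of _ "\<lambda>b. - f b"]) (auto simp: free_fact_simps pcarrier_uminus)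
  qed (auto simp: free_fact_simps pcarrier_add add_ac)
qed (auto simp: free_fact_simps poly_ring_cring pcarrier_mult algebra_simps)

lemma finite_support_coeff:
  fixes c :: "nat \<Rightarrow> 'a::zero"
  assumes "finite {k. c k \<noteq> 0}"
  obtains p where "poly.coeff p = c"
proof
  show "poly.coeff (Abs_poly c) = c"
    using assms by (intro Abs_poly_inverse) (simp add: MOST_iff_cofinite)
qed

declare One_nat_def [simp del]

section \<open>The mapping cone over R'[X] and its retraction by division\<close>

context wide_loop
begin

definition y :: "bit \<Rightarrow> qpoly" where "y i = (if i = 0 then v else t)"
definition ydeg :: "bit \<Rightarrow> int" where "ydeg i = (if i = 0 then 2 * int n else 2)"
text \<open>Degrees of the basis in the wide edge shifted by -1: \<open>dega\<close> belongs to f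
  and e_11, \<open>degc\<close> to e_10 and e_00, in parity 0 and 1 respectively.\<close>

definition dega :: "bit \<Rightarrow> int" where "dega i = (if i = 0 then 2 - int n else 3 - 2 * int n)"
definition degc :: "bit \<Rightarrow> int" where "degc i = (if i = 0 then - int n else - 1)"

lemma y_hom: "y i \<in> hom_poly {2, 3} (ydeg i)"
  using v_hom t_hom by (simp add: y_def ydeg_def)

lemma y_carrier: "y i \<in> pcarrier {2, 3}"
  using y_hom by (rule hom_poly_imp_carrier)

lemma y_max: "y i \<in> max_ideal {2, 3}"
  using n_pos by (intro hom_poly_max_ideal[OF y_hom]) (auto simp: ydeg_def)

lemma y_y: "y (i + 1) * y i = var 2 ^ (n + 1) - var 3 ^ (n + 1)"
  using v_t by (cases i) (auto simp: y_def mult.commute)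

lemma w_hom: "var 2 ^ (n + 1) - var 3 ^ (n + 1) \<in> hom_poly {2, 3} (2 * (int n + 1))"
  using hom_poly_mult[OF v_hom t_hom] unfolding v_t by (simp only: distrib_left mult_1_right)

abbreviation "R2 \<equiv> rpoly \<times> rpoly"

definition sm2 :: "qpoly \<Rightarrow> qpoly poly \<times> qpoly poly \<Rightarrow> qpoly poly \<times> qpoly poly" where
  "sm2 r x = (Polynomial.smult r (fst x), Polynomial.smult r (snd x))"

definition hom2 :: "bit \<Rightarrow> int \<Rightarrow> (qpoly poly \<times> qpoly poly) set" where
  "hom2 i k = rpoly_hom (k - dega i) \<times> rpoly_hom (k - degc i)"

text \<open>The mapping cone of multiplication by \<open>u\<close>: the first component a carries
  {v, t}, the second component c carries {v, t} with parity and sign reversed, and -c u connects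
  them.\<close>

definition cone_diff :: "bit \<Rightarrow> qpoly poly \<times> qpoly poly \<Rightarrow> qpoly poly \<times> qpoly poly" where
  "cone_diff i x = (Polynomial.smult (y i) (fst x) - snd x * u, - Polynomial.smult (y (i + 1)) (snd x))"

abbreviation "S1 \<equiv> rpoly \<inter> small_poly (n - 1)"

definition hom1 :: "bit \<Rightarrow> int \<Rightarrow> qpoly poly set" where
  "hom1 i k = rpoly_hom (k - dega i)"

definition rem_map :: "qpoly poly \<times> qpoly poly \<Rightarrow> qpoly poly" where
  "rem_map x = fst x - pdiv (n - 1) u (fst x) * u"

definition incl_map :: "qpoly poly \<Rightarrow> qpoly poly \<times> qpoly poly" where
  "incl_map a = (a, 0)"

text \<open>The quotient q of the first component returns to the second, where
  \<open>cone_diff\<close> turns it into -q u, the difference between the remainder and the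
  dividend.\<close>

definition div_homotopy :: "qpoly poly \<times> qpoly poly \<Rightarrow> qpoly poly \<times> qpoly poly" where
  "div_homotopy x = (0, pdiv (n - 1) u (fst x))"

lemma u_carrier: "u \<in> rpoly"
  using u_hom by (rule rpoly_hom_subset)

lemma rpoly_hom_shift: "a \<in> rpoly_hom j \<Longrightarrow> j = k \<Longrightarrow> a \<in> rpoly_hom k"
  by simp

lemma int_n1: "2 * int (n - 1) = 2 * int n - 2"
  using n_pos by (simp add: of_nat_diff)

lemma cone_diff_hom: "model_hom {2, 3} sm2 R2 (hom2 i) sm2 R2 (hom2 (i + 1)) (int n + 1) (cone_diff i)"
  unfolding model_hom_def
proof (intro conjI ballI allI)
  fix x assume "x \<in> R2"
  then show "cone_diff i x \<in> R2"
    by (auto simp: cone_diff_def intro!: rpoly_closed y_carrier u_carrier)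
next
  fix k x assume x: "x \<in> R2 \<inter> hom2 i k"
  then have a: "fst x \<in> rpoly_hom (k - dega i)" and c: "snd x \<in> rpoly_hom (k - degc i)"
    by (auto simp: hom2_def)
  have "Polynomial.smult (y i) (fst x) \<in> rpoly_hom (k + (int n + 1) - dega (i + 1))"
    using rpoly_hom_smult[OF y_hom a] by (rule rpoly_hom_shift) (cases i; simp add: dega_def ydeg_def)
  moreover have "snd x * u \<in> rpoly_hom (k + (int n + 1) - dega (i + 1))"
    using rpoly_hom_mult[OF c u_hom] by (rule rpoly_hom_shift) (cases i; simp add: dega_def degc_def int_n1)
  moreover have "Polynomial.smult (y (i + 1)) (snd x) \<in> rpoly_hom (k + (int n + 1) - degc (i + 1))"
    using rpoly_hom_smult[OF y_hom c] by (rule rpoly_hom_shift) (cases i; simp add: degc_def ydeg_def)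
  ultimately show "cone_diff i x \<in> hom2 (i + 1) (k + (int n + 1))"
    by (auto simp: cone_diff_def hom2_def intro: rpoly_hom_closed)
qed (auto simp: cone_diff_def sm2_def smult_add_right smult_diff_right algebra_simps)

lemma smult_y_hom: "model_hom {2, 3} Polynomial.smult S1 (hom1 i) Polynomial.smult S1 (hom1 (i + 1)) (int n + 1)
    (Polynomial.smult (y i))"
  unfolding model_hom_def
proof (intro conjI ballI allI)
  fix k x assume x: "x \<in> S1 \<inter> hom1 i k"
  then have a: "x \<in> rpoly_hom (k - dega i)" by (auto simp: hom1_def)
  have "Polynomial.smult (y i) x \<in> rpoly_hom (k + (int n + 1) - dega (i + 1))"
    using rpoly_hom_smult[OF y_hom a] by (rule rpoly_hom_shift) (cases i; simp add: dega_def ydeg_def)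
  then show "Polynomial.smult (y i) x \<in> hom1 (i + 1) (k + (int n + 1))"
    by (simp add: hom1_def)
qed (auto simp: smult_add_right small_poly_def mult.commute intro!: rpoly_closed y_carrier)

lemma rem_map_hom: "model_hom {2, 3} sm2 R2 (hom2 i) Polynomial.smult S1 (hom1 i) 0 rem_map"
  unfolding model_hom_def
proof (intro conjI ballI allI)
  fix x assume "x \<in> R2"
  then show "rem_map x \<in> S1"
    using pdiv_rem by (auto simp: rem_map_def intro!: rpoly_closed pdiv_carrier u_carrier)
next
  fix k x assume "x \<in> R2 \<inter> hom2 i k"
  then have a: "fst x \<in> rpoly_hom (k - dega i)" by (auto simp: hom2_def)
  then have "rem_map x \<in> rpoly_hom (k - dega i)"
    using rpoly_hom_mult[OF pdiv_hom[OF a] u_hom] by (auto simp: rem_map_def intro!: rpoly_hom_closed)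
  then show "rem_map x \<in> hom1 i (k + 0)" by (simp add: hom1_def)
qed (auto simp: rem_map_def sm2_def pdiv_add pdiv_smult smult_diff_right algebra_simps)

lemma incl_map_hom: "model_hom {2, 3} Polynomial.smult S1 (hom1 i) sm2 R2 (hom2 i) 0 incl_map"
  by (auto simp: model_hom_def incl_map_def sm2_def hom1_def hom2_def)

lemma div_homotopy_hom: "model_hom {2, 3} sm2 R2 (hom2 i) sm2 R2 (hom2 (i + 1)) (- int n - 1) div_homotopy"
  unfolding model_hom_def
proof (intro conjI ballI allI)
  fix x assume "x \<in> R2"
  then show "div_homotopy x \<in> R2"
    by (auto simp: div_homotopy_def intro!: pdiv_carrier)
next
  fix k x assume "x \<in> R2 \<inter> hom2 i k"
  then have a: "fst x \<in> rpoly_hom (k - dega i)" by (auto simp: hom2_def)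
  \<comment> \<open>Division by \<open>u\<close> lowers degrees by 2 n - 2, which matches a homotopy
    of degree -n - 1 because degc (i + 1) = dega i + n - 3.\<close>
  have "pdiv (n - 1) u (fst x) \<in> rpoly_hom (k + (- int n - 1) - degc (i + 1))"
    using pdiv_hom[OF a] by (rule rpoly_hom_shift) (cases i; simp add: dega_def degc_def int_n1)
  then show "div_homotopy x \<in> hom2 (i + 1) (k + (- int n - 1))" by (simp add: div_homotopy_def hom2_def)
qed (auto simp: div_homotopy_def sm2_def pdiv_add pdiv_smult)

text \<open>The connecting term is a multiple of \<open>u\<close> and leaves no remainder; scalars
  from R' commute with taking remainders.\<close>

lemma rem_map_cone_diff: "rem_map (cone_diff i x) = Polynomial.smult (y i) (rem_map x)"
  by (simp add: rem_map_def cone_diff_def pdiv_diff pdiv_smult pdiv_mult smult_diff_right left_diff_distrib)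

lemma incl_map_smult: "incl_map (Polynomial.smult (y i) a) = cone_diff i (incl_map a)"
  by (simp add: incl_map_def cone_diff_def)

lemma rem_map_incl_map: "a \<in> S1 \<Longrightarrow> rem_map (incl_map a) = a"
  by (simp add: rem_map_def incl_map_def pdiv_small)

text \<open>Let q be the quotient of a by \<open>u\<close>, and write y for \<open>y i\<close>. On
  (a, c) the term h d gives (0, y q - c), because c u has quotient c, and d h gives (-q u, -y q).
  They sum to (-q u, -c), which is (a - q u, 0) - (a, c).\<close>

lemma div_homotopy_eq: "incl_map (rem_map x) - x = div_homotopy (cone_diff i x) + cone_diff (i + 1) (div_homotopy x)"
  by (cases x) (simp add: rem_map_def incl_map_def div_homotopy_def cone_diff_def pdiv_diff pdiv_smult pdiv_mult algebra_simps
      del: One_nat_def)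

lemma cone_diff_cone_diff: "cone_diff (i + 1) (cone_diff i x) = sm2 (var 2 ^ (n + 1) - var 3 ^ (n + 1)) x"
proof -
  have "y i * y (i + 1) = var 2 ^ (n + 1) - var 3 ^ (n + 1)" using y_y[of i] by (simp only: mult.commute)
  then show ?thesis using y_y[of i] by (simp add: cone_diff_def sm2_def smult_diff_right del: power_Suc)
qed

section \<open>The model of the direct sum of arcs\<close>

definition "arc_sum = fact_sum {0..int n - 2} (\<lambda>i. fact_shift (2 - int n + 2 * i) (arc n 2 3))"

text \<open>A polynomial of degree below n - 1 has coefficients at X^0, ..., X^(n - 2), one for each
  arc; that of X^j becomes the coordinate of the j-th arc at its basis element of parity i.\<close>

definition \<psi>N :: "bit \<Rightarrow> qpoly poly \<Rightarrow> int \<Rightarrow> bit \<Rightarrow> qpoly" where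
  "\<psi>N i a = (\<lambda>j \<in> {0..int n - 2}. \<lambda>b. if b = i then poly.coeff a (nat j) else 0)"

lemma arc_eq: "arc n 2 3 = free_fact {2, 3} (koszul n v t)"
  by (simp add: arc_def v_def t_def)

lemma finite_int_Collect: "finite {j. 0 \<le> j \<and> j \<le> (m :: int) \<and> P j}"
  by (rule finite_subset[of _ "{0..m}"]) auto

lemma arc_sum_simps:
  "carrier (obj arc_sum i) = (\<Pi>\<^sub>E j \<in> {0..int n - 2}. {f. \<forall>b. f b \<in> pcarrier {2, 3} \<and> (b \<noteq> i \<longrightarrow> f b = 0)})"
  "\<zero>\<^bsub>obj arc_sum i\<^esub> = (\<lambda>j \<in> {0..int n - 2}. \<lambda>b. 0)"
  "f \<oplus>\<^bsub>obj arc_sum i\<^esub> g = (\<lambda>j \<in> {0..int n - 2}. \<lambda>b. f j b + g j b)"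
  "r \<odot>\<^bsub>obj arc_sum i\<^esub> f = (\<lambda>j \<in> {0..int n - 2}. \<lambda>b. r * f j b)"
  "diff arc_sum i f = (\<lambda>j \<in> {0..int n - 2}. \<lambda>b'. \<Sum>b \<in> UNIV. f j b * entry (koszul n v t) b b')"
  by (simp_all add: arc_sum_def fact_sum_def module_sum_def Let_def fact_shift_simps arc_eq
      free_fact_simps koszul_def finite_int_Collect)

lemma arc_sum_hcomp:
  "hcomp (obj arc_sum i) k = {f \<in> carrier (obj arc_sum i). \<forall>j \<in> {0..int n - 2}.
      f j i \<in> hom_poly {2, 3} (k - dega i - 2 * j)}"
proof -
  have H1: "hcomp (obj arc_sum i) k = {f \<in> carrier (obj arc_sum i). \<forall>j \<in> {0..int n - 2}. \<forall>b.
      f j b \<in> hom_poly {2, 3} (k - (2 - int n + 2 * j) - bdeg (koszul n v t) b)}"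
    unfolding arc_sum_simps(1)
    by (auto simp: arc_sum_def fact_sum_def module_sum_def Let_def fact_shift_simps arc_eq
      free_fact_simps koszul_def finite_int_Collect)
  have H2: "(\<forall>b. f j b \<in> hom_poly {2, 3} (k - (2 - int n + 2 * j) - bdeg (koszul n v t) b)) \<longleftrightarrow>
      f j i \<in> hom_poly {2, 3} (k - dega i - 2 * j)"
    if "f \<in> carrier (obj arc_sum i)" "j \<in> {0..int n - 2}" for f j
  proof -
    have "f j b = 0" if "b \<noteq> i" for b
      using \<open>f \<in> _\<close> \<open>j \<in> _\<close> that by (auto simp: arc_sum_simps PiE_iff)
    then have "(\<forall>b. f j b \<in> hom_poly {2, 3} (k - (2 - int n + 2 * j) - bdeg (koszul n v t) b)) \<longleftrightarrow>
      f j i \<in> hom_poly {2, 3} (k - (2 - int n + 2 * j) - bdeg (koszul n v t) i)"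
      by (metis hom_poly_0)
    \<comment> \<open>The basis element of parity i of an arc has degree 0 or 1 - n; adding the
      shift 2 - n gives the degree of f or of e_11.\<close>
    also have "k - (2 - int n + 2 * j) - bdeg (koszul n v t) i = k - dega i - 2 * j"
      by (cases i) (auto simp: koszul_def pdeg_v dega_def)
    finally show ?thesis .
  qed
  show ?thesis unfolding H1 by (intro Collect_cong conj_cong refl ball_cong H2)
qed

lemma model_N: "model_iso {2, 3} Polynomial.smult S1 (hom1 i) (\<psi>N i) (obj arc_sum i)"
proof -
  let ?J = "{0..int n - 2}"
  have \<psi>_in: "\<psi>N i a \<in> carrier (obj arc_sum i)" if "a \<in> S1" for a
    using that by (auto simp: arc_sum_simps \<psi>N_def rpoly_def)
  have inj: "a = b" if "a \<in> S1" "b \<in> S1" "\<psi>N i a = \<psi>N i b" for a b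
  proof (rule poly_eqI)
    fix k
    show "poly.coeff a k = poly.coeff b k"
    proof (cases "k < n - 1")
      case True
      then have "int k \<in> ?J" by auto
      then show ?thesis using fun_cong[OF fun_cong[OF that(3)], of "int k" i] by (simp add: \<psi>N_def)
    qed (use that in \<open>auto simp: small_poly_def\<close>)
  qed
  have surj: "\<exists>a \<in> S1. f = \<psi>N i a \<and> (\<forall>k<n - 1. poly.coeff a k = f (int k) i)"
    if f: "f \<in> carrier (obj arc_sum i)" for f
  proof -
    define a where "a = (\<Sum>k<n - 1. monom (f (int k) i) k)"
    have coeff: "poly.coeff a k = (if k < n - 1 then f (int k) i else 0)" for k
      by (simp add: a_def coeff_sum)
    have "a \<in> S1"
      using f by (auto simp: rpoly_def small_poly_def coeff arc_sum_simps PiE_iff)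
    moreover have "f = \<psi>N i a"
    proof (rule extensionalityI[of _ ?J])
      fix j assume j: "j \<in> ?J"
      then have "nat j < n - 1" "int (nat j) = j" by auto
      then show "f j = \<psi>N i a j"
        using f j by (auto simp: \<psi>N_def coeff arc_sum_simps PiE_iff fun_eq_iff)
    qed (use f in \<open>auto simp: arc_sum_simps PiE_iff \<psi>N_def\<close>)
    ultimately show ?thesis using coeff by auto
  qed
  show ?thesis
  proof
    show "bij_betw (\<psi>N i) S1 (carrier (obj arc_sum i))"
      unfolding bij_betw_def
    proof
      show "inj_on (\<psi>N i) S1" using inj by (rule inj_onI)
      show "\<psi>N i ` S1 = carrier (obj arc_sum i)" using surj \<psi>_in by blast
    qed
    show "\<psi>N i 0 = \<zero>\<^bsub>obj arc_sum i\<^esub>" by (auto simp: \<psi>N_def arc_sum_simps fun_eq_iff)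
    show "\<psi>N i (a + b) = \<psi>N i a \<oplus>\<^bsub>obj arc_sum i\<^esub> \<psi>N i b" for a b
      by (auto simp: \<psi>N_def arc_sum_simps fun_eq_iff)
    show "\<psi>N i (Polynomial.smult r a) = r \<odot>\<^bsub>obj arc_sum i\<^esub> \<psi>N i a" for r a
      by (auto simp: \<psi>N_def arc_sum_simps fun_eq_iff)
    show "hcomp (obj arc_sum i) k = \<psi>N i ` (S1 \<inter> hom1 i k)" for k
    proof
      show "hcomp (obj arc_sum i) k \<subseteq> \<psi>N i ` (S1 \<inter> hom1 i k)"
      proof
        fix f assume f: "f \<in> hcomp (obj arc_sum i) k"
        then obtain a where a: "a \<in> S1" "f = \<psi>N i a" "\<forall>k<n - 1. poly.coeff a k = f (int k) i"
          using surj[of f] unfolding arc_sum_hcomp by blast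
        have "poly.coeff a l \<in> hom_poly {2, 3} (k - dega i - 2 * int l)" for l
        proof (cases "l < n - 1")
          case True
          then have "int l \<in> ?J" by auto
          then show ?thesis using True f a(3) by (auto simp: arc_sum_hcomp)
        qed (use a(1) in \<open>auto simp: small_poly_def\<close>)
        then show "f \<in> \<psi>N i ` (S1 \<inter> hom1 i k)"
          using a by (auto simp: hom1_def rpoly_hom_def)
      qed
      show "\<psi>N i ` (S1 \<inter> hom1 i k) \<subseteq> hcomp (obj arc_sum i) k"
      proof safe
        fix a assume a: "a \<in> rpoly" "a \<in> small_poly (n - 1)" "a \<in> hom1 i k"
        have "\<psi>N i a j i \<in> hom_poly {2, 3} (k - dega i - 2 * j)" if j: "j \<in> ?J" for j
        proof -
          have "poly.coeff a (nat j) \<in> hom_poly {2, 3} (k - dega i - 2 * int (nat j))"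
            using a(3) unfolding hom1_def rpoly_hom_def by blast
          then show ?thesis using j by (simp add: \<psi>N_def)
        qed
        then show "\<psi>N i a \<in> hcomp (obj arc_sum i) k" using a \<psi>_in by (auto simp: arc_sum_hcomp)
      qed
    qed
  qed (auto simp: small_poly_def intro: rpoly_closed)
qed

lemma UNIV_bit: "(UNIV :: bit set) = {0, 1}"
  using bit_not_zero_iff by blast

lemma diff_N: "diff arc_sum i (\<psi>N i a) = \<psi>N (i + 1) (Polynomial.smult (y i) a)"
  by (cases i) (auto simp: arc_sum_simps \<psi>N_def UNIV_bit koszul_def y_def fun_eq_iff)

lemma free_N: "graded_free {2, 3} (obj arc_sum i)"
proof (rule model_iso.graded_free[OF model_N])
  show "inj_on poly.coeff S1" by (auto simp: inj_on_def coeff_inject)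
  show "poly.coeff ` S1 = {c. (\<forall>j. c j \<in> pcarrier {2, 3}) \<and> finite {j. c j \<noteq> 0} \<and> (\<forall>j. j \<notin> {..<n - 1} \<longrightarrow> c j = 0)}"
  proof (intro equalityI subsetI)
    fix c assume "c \<in> {c. (\<forall>j. c j \<in> pcarrier {2, 3}) \<and> finite {j. c j \<noteq> 0} \<and> (\<forall>j. j \<notin> {..<n - 1} \<longrightarrow> c j = 0)}"
    then have c: "\<forall>j. c j \<in> pcarrier {2, 3}" "finite {j. c j \<noteq> 0}" "\<forall>j. j \<notin> {..<n - 1} \<longrightarrow> c j = 0" by auto
    obtain p where "poly.coeff p = c" using finite_support_coeff[OF c(2)] .
    then show "c \<in> poly.coeff ` S1"
      using c by (intro image_eqI[of _ _ p]) (auto simp: rpoly_def small_poly_def)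
  qed (auto simp: rpoly_def small_poly_def MOST_iff_cofinite[symmetric] MOST_coeff_eq_0)
  show "a \<in> hom1 i k \<longleftrightarrow> (\<forall>j. poly.coeff a j \<in> hom_poly {2, 3} (k - (dega i + 2 * int j)))" for a k
    by (simp add: hom1_def rpoly_hom_def algebra_simps)
qed auto

lemma generators_N:
  assumes "a \<in> S1"
  shows "\<exists>c. (\<forall>k \<in> {..<n - 1}. c k \<in> pcarrier {2, 3}) \<and> a = (\<Sum>k \<in> {..<n - 1}. Polynomial.smult (c k) (monom 1 k))"
proof (intro exI[of _ "poly.coeff a"] conjI ballI)
  show "a = (\<Sum>k \<in> {..<n - 1}. Polynomial.smult (poly.coeff a k) (monom 1 k))"
    using assms by (intro poly_eqI) (auto simp: coeff_sum smult_monom small_poly_def)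
qed (use assms in \<open>auto simp: rpoly_def\<close>)

end

section \<open>Multiples of x_4 - x_1 in a free module\<close>

lemma ideal_elim_var_kernel:
  "ideal {r \<in> pcarrier {1, 2, 3, 4}. elim_var r = 0} (poly_ring {1, 2, 3, 4})"
proof (rule idealI)
  let ?V = "{1, 2, 3, 4 :: nat}"
  interpret R: cring "poly_ring ?V" by (rule poly_ring_cring)
  show "ring (poly_ring ?V)" by (rule R.ring_axioms)
  show "subgroup {r \<in> pcarrier ?V. elim_var r = 0} (add_monoid (poly_ring ?V))"
    by (rule R.add.subgroupI)
      (auto simp: pcarrier_add pcarrier_uminus poly_ring_a_minus a_inv_def[symmetric] intro: exI[of _ 0])
qed (auto simp: pcarrier_mult)

text \<open>In a free module the submodule I M is read off coordinatewise, and in each coordinate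
  \<open>elim_var_kernel\<close> supplies the factor x_4 - x_1. The other inclusion holds because
  the kernel of \<open>elim_var\<close> is an ideal containing the generator.\<close>

lemma ideal_smult_kernel:
  fixes D :: "'b::finite fact_matrix"
  assumes M: "Module.module (poly_ring {1, 2, 3, 4}) M"
    and carr: "carrier M = {f. \<forall>b. f b \<in> pcarrier {1, 2, 3, 4} \<and> (par D b \<noteq> i \<longrightarrow> f b = 0)}"
    and ops: "\<zero>\<^bsub>M\<^esub> = (\<lambda>b. 0)" "ring.add M = (\<lambda>f g b. f b + g b)" "module.smult M = (\<lambda>r f b. r * f b)"
  shows "ideal_smult {1, 2, 3, 4} (genideal (poly_ring {1, 2, 3, 4}) {var 4 - var 1}) M
      = {f \<in> carrier M. \<forall>b. elim_var (f b) = 0}" (is "ideal_smult ?V ?I M = ?K")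
proof
  interpret M: Module.module "poly_ring ?V" M by (rule M)
  have d: "var 4 - var 1 \<in> pcarrier ?V" by (intro pcarrier_intros) auto
  have "?I \<subseteq> {r \<in> pcarrier ?V. elim_var r = 0}"
    using d by (intro ring.genideal_minimal cring.axioms(1) poly_ring_cring ideal_elim_var_kernel) auto
  moreover have "submodule ?K (poly_ring ?V) M"
  proof (rule M.submoduleI)
    fix f assume f: "f \<in> ?K"
    have "\<ominus>\<^bsub>M\<^esub> f = (\<lambda>b. - f b)"
      using f by (intro M.minus_equality) (auto simp: carr ops pcarrier_uminus)
    then show "\<ominus>\<^bsub>M\<^esub> f \<in> ?K" using f by (auto simp: carr pcarrier_uminus)
  qed (auto simp: carr ops pcarrier_add pcarrier_mult)
  ultimately show "ideal_smult ?V ?I M \<subseteq> ?K"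
    by (intro ideal_smult_least) (auto simp: carr ops pcarrier_mult)
  show "?K \<subseteq> ideal_smult ?V ?I M"
  proof
    fix f assume f: "f \<in> ?K"
    have "\<exists>r \<in> pcarrier ?V. f b = r * (var 4 - var 1)" for b
    proof -
      have "f b \<in> pcarrier ?V" "elim_var (f b) = 0" using f by (auto simp: carr)
      then show ?thesis by (metis elim_var_kernel diff_zero poly_0)
    qed
    then obtain r where r: "\<And>b. r b \<in> pcarrier ?V" "\<And>b. f b = r b * (var 4 - var 1)" by metis
    \<comment> \<open>Cancelling x_4 - x_1 shows that the quotients vanish at basis elements of the
      wrong parity, as f does.\<close>
    have "r \<in> carrier M"
      using f r by (auto simp: carr)
    moreover have "var 4 - var 1 \<in> ?I"
      using d by (intro ring.genideal_self[OF cring.axioms(1)[OF poly_ring_cring], THEN subsetD]) auto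
    moreover have "f = (var 4 - var 1) \<odot>\<^bsub>M\<^esub> r" using r(2) by (simp add: ops fun_eq_iff mult.commute)
    ultimately show "f \<in> ideal_smult ?V ?I M" using smult_in_ideal_smult by metis
  qed
qed

section \<open>The closed wide edge as the mapping cone\<close>

context wide_loop
begin

definition "DW = tensor (koszul n u1 (s - s')) (koszul n u2 (p - p'))"

definition "W = wide_edge n 1 2 3 4"

lemma W_eq: "W = fact_shift (- 1) (free_fact V4 DW)"
  unfolding W_def wide_edge_def Let_def DW_def u1_def u2_def ..

definition "loop = fact_translate (quot_fact V4 (genideal (poly_ring V4) {var 4 - var 1}) W)"

definition K :: "bit \<Rightarrow> (bit \<times> bit \<Rightarrow> qpoly) set" where
  "K i = ideal_smult V4 (genideal (poly_ring V4) {var 4 - var 1}) (obj W i)"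

lemma W_simps:
  "carrier (obj W i) = {f. \<forall>b. f b \<in> pcarrier V4 \<and> (fst b + snd b \<noteq> i \<longrightarrow> f b = 0)}"
  "\<zero>\<^bsub>obj W i\<^esub> = (\<lambda>b. 0)"
  "ring.add (obj W i) = (\<lambda>f g b. f b + g b)"
  "module.smult (obj W i) = (\<lambda>r f b. r * f b)"
  "hcomp (obj W i) k = {f \<in> carrier (obj W i). \<forall>b. f b \<in> hom_poly V4 (k + 1 - bdeg DW b)}"
  "diff W i = (\<lambda>f b'. \<Sum>b \<in> UNIV. f b * entry DW b b')"
  by (auto simp: W_eq fact_shift_simps free_fact_simps DW_def tensor_def koszul_def split_beta)

lemma W_module: "Module.module (poly_ring V4) (obj W i)"
  by (rule module_cong[OF free_fact_module[of V4 DW i]]) (simp_all add: W_eq fact_shift_simps)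

lemma K_eq: "K i = {f \<in> carrier (obj W i). \<forall>b. elim_var (f b) = 0}"
  unfolding K_def
  by (rule ideal_smult_kernel[where D = DW, OF W_module])
    (auto simp: W_simps DW_def tensor_def koszul_def split_beta)

lemma W_neg: "f \<in> carrier (obj W i) \<Longrightarrow> \<ominus>\<^bsub>obj W i\<^esub> f = (\<lambda>b. - f b)"
proof -
  interpret Module.module "poly_ring V4" "obj W i" by (rule W_module)
  assume "f \<in> carrier (obj W i)"
  then show ?thesis by (intro minus_equality) (auto simp: W_simps pcarrier_uminus)
qed

lemma UNIV_bit2: "(UNIV :: (bit \<times> bit) set) = {(0, 0), (0, 1), (1, 0), (1, 1)}"
  by (auto simp: UNIV_bit UNIV_Times_UNIV[symmetric] simp del: UNIV_Times_UNIV)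

lemma diff_W: "diff W i f b' = f (0, 0) * entry DW (0, 0) b' + f (0, 1) * entry DW (0, 1) b'
    + f (1, 0) * entry DW (1, 0) b' + f (1, 1) * entry DW (1, 1) b'"
  by (simp add: W_simps UNIV_bit2 add.assoc)

lemma entry_W:
  "entry DW (0, 0) (0, 0) = 0" "entry DW (0, 0) (0, 1) = u2" "entry DW (0, 0) (1, 0) = u1" "entry DW (0, 0) (1, 1) = 0"
  "entry DW (0, 1) (0, 0) = p - p'" "entry DW (0, 1) (0, 1) = 0" "entry DW (0, 1) (1, 0) = 0" "entry DW (0, 1) (1, 1) = u1"
  "entry DW (1, 0) (0, 0) = s - s'" "entry DW (1, 0) (0, 1) = 0" "entry DW (1, 0) (1, 0) = 0" "entry DW (1, 0) (1, 1) = - u2"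
  "entry DW (1, 1) (0, 0) = 0" "entry DW (1, 1) (0, 1) = s - s'" "entry DW (1, 1) (1, 0) = - (p - p')" "entry DW (1, 1) (1, 1) = 0"
  by (simp_all add: DW_def tensor_def koszul_def)

lemma entry_W_carrier: "entry DW b b' \<in> pcarrier V4"
proof -
  have "u1 \<in> pcarrier V4" "u2 \<in> pcarrier V4" using u1_hom u2_hom by (auto intro: hom_poly_imp_carrier)
  moreover have "s - s' \<in> pcarrier V4" "p - p' \<in> pcarrier V4" by (auto intro!: pcarrier_intros)
  moreover obtain b1 b2 b1' b2' where "b = (b1, b2)" "b' = (b1', b2')" by (cases b; cases b')
  ultimately show ?thesis
    by (cases b1; cases b2; cases b1'; cases b2')
      (simp_all only: entry_W pcarrier_0 pcarrier_uminus)
qed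

lemma W_linear: "linear_map V4 (obj W i) (obj W (i + 1)) (diff W i)"
proof (intro linear_map.intro linear_map_axioms.intro W_module)
  fix f assume f: "f \<in> carrier (obj W i)"
  have "diff W i f b \<in> pcarrier V4" for b
    unfolding diff_W using f entry_W_carrier by (intro pcarrier_intros) (auto simp: W_simps)
  moreover have "diff W i f (b1, b2) = 0" if "b1 + b2 \<noteq> i + 1" for b1 b2
    unfolding diff_W using f that
    by (cases i; cases b1; cases b2) (auto simp: W_simps entry_W)
  ultimately show "diff W i f \<in> carrier (obj W (i + 1))" by (auto simp: W_simps)
qed (auto simp: diff_W W_simps(1-5) algebra_simps)

lemma quotient_W: "quotient_module V4 (obj W i) (K i)"
  unfolding K_def
proof (intro quotient_module.intro W_module submodule_ideal_smult)
  have "ideal (genideal (poly_ring V4) {var 4 - var 1}) (poly_ring V4)"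
    by (rule ring.genideal_ideal[OF cring.axioms(1)[OF poly_ring_cring]])
      (auto intro!: pcarrier_intros)
  then show "genideal (poly_ring V4) {var 4 - var 1} \<subseteq> pcarrier V4"
    by (intro additive_subgroup.a_subset ideal.axioms(1))
qed

interpretation Q: quotient_module V4 "obj W k" "K k" for k
  by (rule quotient_W)

lemma K_diff: "f \<in> K i \<Longrightarrow> diff W i f \<in> K (i + 1)"
proof -
  assume f: "f \<in> K i"
  then have "diff W i f \<in> carrier (obj W (i + 1))"
    unfolding K_eq by (blast intro: linear_map.closed[OF W_linear])
  moreover have "elim_var (f b) = 0" for b using f unfolding K_eq by blast
  then have "elim_var (diff W i f b) = 0" for b
    unfolding diff_W by (simp only: elim_var_simps mult_zero_left add_0_left)
  ultimately show ?thesis unfolding K_eq by blast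
qed

lemma loop_obj: "obj loop i = quot_module (obj W (i + 1)) (K (i + 1))"
  by (simp add: loop_def fact_translate_def quot_fact_def K_def)

lemma loop_diff:
  assumes "f \<in> carrier (obj W (i + 1))"
  shows "diff loop i (K (i + 1) +>\<^bsub>obj W (i + 1)\<^esub> f) = K i +>\<^bsub>obj W i\<^esub> (\<lambda>b. - diff W (i + 1) f b)"
proof -
  have d: "diff W (i + 1) f \<in> carrier (obj W i)"
    using linear_map.closed[OF W_linear assms] by simp
  have "quot_map (obj W (i + 1 + 1)) (K (i + 1 + 1)) (diff W (i + 1)) (K (i + 1) +>\<^bsub>obj W (i + 1)\<^esub> f)
      = K (i + 1 + 1) +>\<^bsub>obj W (i + 1 + 1)\<^esub> diff W (i + 1) f"
    by (rule quot_map_coset[OF W_linear quotient_W quotient_W K_diff assms])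
  then have "diff loop i (K (i + 1) +>\<^bsub>obj W (i + 1)\<^esub> f) = \<ominus>\<^bsub>quot_module (obj W i) (K i)\<^esub> (K i +>\<^bsub>obj W i\<^esub> diff W (i + 1) f)"
    by (simp add: loop_def fact_translate_def quot_fact_def flip: K_def)
  then show ?thesis using d by (simp add: Q.coset_neg W_neg)
qed

text \<open>The pair $(a, c)$ stands for $a f + c\, e_{10}$, with $f = e_{01} - X e_{10}$, in parity 0 of the
  translated factorization (parity 1 of the wide edge), and for $- a\, e_{11} + c\, e_{00}$ in parity 1.\<close>

definition lift :: "bit \<Rightarrow> qpoly poly \<times> qpoly poly \<Rightarrow> bit \<times> bit \<Rightarrow> qpoly poly" where
  "lift i x b =
     (if i = 0 then if b = (0, 1) then fst x else if b = (1, 0) then snd x - [:0, 1:] * fst x else 0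
      else if b = (1, 1) then - fst x else if b = (0, 0) then snd x else 0)"

text \<open>For x in \<open>R2\<close> this is the representative of the coset that does not involve
  x_4.\<close>

definition rep :: "bit \<Rightarrow> qpoly poly \<times> qpoly poly \<Rightarrow> bit \<times> bit \<Rightarrow> qpoly" where
  "rep i x b = poly (lift i x b) (var 1)"

text \<open>The index i + 1 reflects the translation, which exchanges the parities.\<close>

definition \<psi>M :: "bit \<Rightarrow> qpoly poly \<times> qpoly poly \<Rightarrow> (bit \<times> bit \<Rightarrow> qpoly) set" where
  "\<psi>M i x = K (i + 1) +>\<^bsub>obj W (i + 1)\<^esub> rep i x"

lemma X_rpoly: "a \<in> rpoly \<Longrightarrow> [:0, 1:] * a \<in> rpoly"
  by (intro rpoly_closed) auto

lemma lift_rpoly: "x \<in> R2 \<Longrightarrow> lift i x b \<in> rpoly"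
  by (auto simp: lift_def simp del: mult_pCons_left intro!: rpoly_closed X_rpoly)

lemma elim_rep: "x \<in> R2 \<Longrightarrow> elim_var (rep i x b) = lift i x b"
  unfolding rep_def by (intro elim_var_poly lift_rpoly)

lemma rep_carrier: "x \<in> R2 \<Longrightarrow> rep i x \<in> carrier (obj W (i + 1))"
proof -
  assume x: "x \<in> R2"
  have "rep i x b \<in> pcarrier V4" for b
    unfolding rep_def by (intro poly_var_carrier lift_rpoly x)
  moreover have "rep i x (b1, b2) = 0" if "b1 + b2 \<noteq> i + 1" for b1 b2
    using that by (cases i; cases b1; cases b2) (auto simp: rep_def lift_def)
  ultimately show ?thesis by (auto simp: W_simps(1))
qed

lemma rep_add: "rep i (x + z) = (\<lambda>b. rep i x b + rep i z b)"
  by (auto simp: rep_def lift_def fun_eq_iff algebra_simps)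

lemma rep_sm: "rep i (sm2 r x) = (\<lambda>b. r * rep i x b)"
  by (auto simp: rep_def lift_def sm2_def fun_eq_iff algebra_simps)

text \<open>\<open>elim_var\<close> of the coordinates is a complete invariant of a coset, so all
  further identities are between polynomials in X.\<close>

lemma coset_W_eq_iff:
  assumes "f \<in> carrier (obj W i)" "g \<in> carrier (obj W i)"
  shows "K i +>\<^bsub>obj W i\<^esub> f = K i +>\<^bsub>obj W i\<^esub> g \<longleftrightarrow> (\<forall>b. elim_var (f b) = elim_var (g b))"
proof -
  have "f \<ominus>\<^bsub>obj W i\<^esub> g = (\<lambda>b. f b - g b)"
    using assms by (simp add: a_minus_def W_neg W_simps)
  moreover have "f \<ominus>\<^bsub>obj W i\<^esub> g \<in> carrier (obj W i)" using assms Q.M.minus_closed by blast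
  ultimately have "f \<ominus>\<^bsub>obj W i\<^esub> g \<in> K i \<longleftrightarrow> (\<forall>b. elim_var (f b) = elim_var (g b))"
    unfolding K_eq mem_Collect_eq by (simp only: elim_var_simps right_minus_eq simp_thms)
  then show ?thesis unfolding Q.coset_eq_iff[OF assms] .
qed

lemma lift_inj:
  assumes "\<And>b. lift i x b = lift i z b"
  shows "x = z"
proof (cases i)
  case zero
  have "fst x = fst z" using assms[of "(0, 1)"] zero by (simp add: lift_def)
  moreover have "snd x - [:0, 1:] * fst x = snd z - [:0, 1:] * fst z"
    using assms[of "(1, 0)"] zero by (simp add: lift_def)
  ultimately show ?thesis by (simp add: prod_eq_iff)
next
  case one
  then show ?thesis
    using assms[of "(1, 1)"] assms[of "(0, 0)"] by (simp add: lift_def prod_eq_iff)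
qed

lemma lift_surj:
  assumes "f \<in> carrier (obj W (i + 1))"
  obtains x where "x \<in> R2" "\<forall>b. elim_var (f b) = lift i x b"
proof (cases i)
  case zero
  \<comment> \<open>Inverts the change of basis: the coefficient of e_10 beside f is recovered by
    adding X times the coefficient of e_01.\<close>
  let ?x = "(elim_var (f (0, 1)), elim_var (f (1, 0)) + [:0, 1:] * elim_var (f (0, 1)))"
  have "elim_var (f b) \<in> rpoly" for b
    by (rule elim_var_carrier) (use assms in \<open>cases b; simp add: W_simps(1)\<close>)
  then have "?x \<in> R2" by (auto simp del: mult_pCons_left intro!: rpoly_closed X_rpoly)
  moreover have "elim_var (f (b1, b2)) = lift i ?x (b1, b2)" for b1 b2
    using assms zero by (cases b1; cases b2) (auto simp: lift_def W_simps(1))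
  then have "\<forall>b. elim_var (f b) = lift i ?x b" by (metis surj_pair)
  ultimately show ?thesis by (rule that)
next
  case one
  let ?x = "(- elim_var (f (1, 1)), elim_var (f (0, 0)))"
  have "elim_var (f b) \<in> rpoly" for b
    by (rule elim_var_carrier) (use assms in \<open>cases b; simp add: W_simps(1)\<close>)
  then have "?x \<in> R2" by (auto intro!: rpoly_closed)
  moreover have "elim_var (f (b1, b2)) = lift i ?x (b1, b2)" for b1 b2
    using assms one by (cases b1; cases b2) (auto simp: lift_def W_simps(1))
  then have "\<forall>b. elim_var (f b) = lift i ?x b" by (metis surj_pair)
  ultimately show ?thesis by (rule that)
qed

text \<open>X e_10 and e_01 have the same degree, 2 + (1 - n) = 3 - n, so the passage to f is
  homogeneous and degrees may be tested in either basis. The 1 added to k undoes the shift of the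
  wide edge by -1.\<close>

lemma lift_hom_iff:
  "x \<in> hom2 i k \<longleftrightarrow> (\<forall>b. lift i x b \<in> rpoly_hom (k + 1 - bdeg DW b))"
proof -
  have bdeg: "bdeg DW (0, 0) = 0" "bdeg DW (0, 1) = 3 - int n" "bdeg DW (1, 0) = 1 - int n"
    "bdeg DW (1, 1) = 4 - 2 * int n"
    by (simp_all add: DW_def tensor_def koszul_def pdeg_u1 pdeg_u2)
  have X: "[:0, 1:] * a \<in> rpoly_hom (k + int n)" if "a \<in> rpoly_hom (k + int n - 2)" for a
  proof -
    have "[:0, 1:] \<in> rpoly_hom 2"
      by (auto simp: rpoly_hom_def coeff_pCons hom_poly_1 split: nat.splits)
    from rpoly_hom_mult[OF this that] show ?thesis by simp
  qed
  show ?thesis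
  proof (cases i)
    case zero
    have "(\<forall>b. lift i x b \<in> rpoly_hom (k + 1 - bdeg DW b)) \<longleftrightarrow>
      fst x \<in> rpoly_hom (k + int n - 2) \<and> snd x - [:0, 1:] * fst x \<in> rpoly_hom (k + int n)"
      using zero by (auto simp: lift_def bdeg algebra_simps)
    also have "\<dots> \<longleftrightarrow> fst x \<in> rpoly_hom (k + int n - 2) \<and> snd x \<in> rpoly_hom (k + int n)"
      using X rpoly_hom_closed(1)[of "snd x - [:0, 1:] * fst x" "k + int n" "[:0, 1:] * fst x"]
        rpoly_hom_closed(2)[of "snd x" "k + int n" "[:0, 1:] * fst x"] by (auto simp del: mult_pCons_left)
    finally show ?thesis using zero
      by (auto simp: hom2_def dega_def degc_def mem_Times_iff algebra_simps)
  next
    case one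
    have "- a \<in> rpoly_hom d \<longleftrightarrow> a \<in> rpoly_hom d" for a d
      using rpoly_hom_closed(3)[of a d] rpoly_hom_closed(3)[of "- a" d] by auto
    then show ?thesis using one
      by (auto simp: hom2_def dega_def degc_def mem_Times_iff lift_def bdeg algebra_simps)
  qed
qed

lemma model_M: "model_iso {2, 3} sm2 R2 (hom2 i) (\<psi>M i) (obj loop i)"
proof
  show "bij_betw (\<psi>M i) R2 (carrier (obj loop i))"
    unfolding bij_betw_def
  proof
    show "inj_on (\<psi>M i) R2"
    proof (rule inj_onI)
      fix x z assume "x \<in> R2" "z \<in> R2" "\<psi>M i x = \<psi>M i z"
      then have "lift i x b = lift i z b" for b
        by (simp only: \<psi>M_def coset_W_eq_iff rep_carrier elim_rep)
      then show "x = z" by (rule lift_inj)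
    qed
    show "\<psi>M i ` R2 = carrier (obj loop i)"
    proof
      show "\<psi>M i ` R2 \<subseteq> carrier (obj loop i)"
        unfolding loop_obj \<psi>M_def by (intro image_subsetI Q.coset_carrier rep_carrier)
      show "carrier (obj loop i) \<subseteq> \<psi>M i ` R2"
      proof
        fix X assume "X \<in> carrier (obj loop i)"
        then obtain f where f: "f \<in> carrier (obj W (i + 1))" "X = K (i + 1) +>\<^bsub>obj W (i + 1)\<^esub> f"
          unfolding loop_obj Q.carrier_Q by blast
        obtain x where x: "x \<in> R2" "\<forall>b. elim_var (f b) = lift i x b"
          using f(1) by (rule lift_surj)
        then have "X = \<psi>M i x"
          unfolding f(2) \<psi>M_def coset_W_eq_iff[OF f(1) rep_carrier[OF x(1)]] by (simp add: elim_rep)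
        then show "X \<in> \<psi>M i ` R2" using x(1) by blast
      qed
    qed
  qed
  show "\<psi>M i (x + z) = \<psi>M i x \<oplus>\<^bsub>obj loop i\<^esub> \<psi>M i z" if "x \<in> R2" "z \<in> R2" for x z
    unfolding loop_obj \<psi>M_def using that
    by (simp add: Q.coset_add rep_carrier) (simp add: rep_add W_simps)
  show "\<psi>M i 0 = \<zero>\<^bsub>obj loop i\<^esub>"
  proof -
    have "rep i 0 = \<zero>\<^bsub>obj W (i + 1)\<^esub>" by (auto simp: rep_def lift_def W_simps fun_eq_iff)
    then show ?thesis unfolding loop_obj \<psi>M_def by (simp add: Q.coset_zero Q.zero_Q)
  qed
  show "\<psi>M i (sm2 r x) = r \<odot>\<^bsub>obj loop i\<^esub> \<psi>M i x" if "r \<in> pcarrier {2, 3}" "x \<in> R2" for r x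
  proof -
    have "r \<in> pcarrier V4" using that(1) pcarrier_mono[of "{2, 3}" V4] by auto
    then show ?thesis unfolding loop_obj \<psi>M_def using that
      by (simp add: Q.coset_smult rep_carrier) (simp add: rep_sm W_simps)
  qed
  show "hcomp (obj loop i) k = \<psi>M i ` (R2 \<inter> hom2 i k)" for k
  proof -
    have "hcomp (obj loop i) k = (\<lambda>f. K (i + 1) +>\<^bsub>obj W (i + 1)\<^esub> f) ` hcomp (obj W (i + 1)) k"
      by (simp add: loop_obj quot_module_def)
    also have "\<dots> = \<psi>M i ` (R2 \<inter> hom2 i k)"
    proof
      show "(\<lambda>f. K (i + 1) +>\<^bsub>obj W (i + 1)\<^esub> f) ` hcomp (obj W (i + 1)) k \<subseteq> \<psi>M i ` (R2 \<inter> hom2 i k)"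
      proof (rule image_subsetI)
        fix f assume f: "f \<in> hcomp (obj W (i + 1)) k"
        then have fc: "f \<in> carrier (obj W (i + 1))" by (simp add: W_simps(5))
        obtain x where x: "x \<in> R2" "\<forall>b. elim_var (f b) = lift i x b"
          using fc by (rule lift_surj)
        have "elim_var (f b) \<in> rpoly_hom (k + 1 - bdeg DW b)" for b
          by (rule elim_var_hom) (use f in \<open>cases b; simp add: W_simps(5)\<close>)
        then have "x \<in> hom2 i k" using x(2) unfolding lift_hom_iff by metis
        moreover have "K (i + 1) +>\<^bsub>obj W (i + 1)\<^esub> f = \<psi>M i x"
          unfolding \<psi>M_def coset_W_eq_iff[OF fc rep_carrier[OF x(1)]] using x by (simp add: elim_rep)
        ultimately show "K (i + 1) +>\<^bsub>obj W (i + 1)\<^esub> f \<in> \<psi>M i ` (R2 \<inter> hom2 i k)" using x(1) by blast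
      qed
      show "\<psi>M i ` (R2 \<inter> hom2 i k) \<subseteq> (\<lambda>f. K (i + 1) +>\<^bsub>obj W (i + 1)\<^esub> f) ` hcomp (obj W (i + 1)) k"
      proof (rule image_subsetI)
        fix x assume x: "x \<in> R2 \<inter> hom2 i k"
        then have "rep i x b \<in> hom_poly V4 (k + 1 - bdeg DW b)" for b
          unfolding rep_def using x by (intro poly_var_hom) (metis IntD2 lift_hom_iff)
        then have "rep i x \<in> hcomp (obj W (i + 1)) k" using x rep_carrier by (auto simp: W_simps(5))
        then show "\<psi>M i x \<in> (\<lambda>f. K (i + 1) +>\<^bsub>obj W (i + 1)\<^esub> f) ` hcomp (obj W (i + 1)) k"
          unfolding \<psi>M_def by blast
      qed
    qed
    finally show ?thesis .
  qed
qed (auto simp: sm2_def intro!: rpoly_closed simp: zero_prod_def)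

text \<open>From the matrix of the wide edge, with u_1 + X u = v: d f = v e_11, d e_11 = t f, d e_10
  = t e_00 - u e_11 and d e_00 = u f + v e_10. Translation reverses the signs, and the sign before
  e_11 in \<open>lift\<close> lets one formula \<open>cone_diff\<close> serve both parities.\<close>

lemma diff_M:
  assumes "x \<in> R2"
  shows "diff loop i (\<psi>M i x) = \<psi>M (i + 1) (cone_diff i x)"
proof -
  have D: "cone_diff i x \<in> R2" using cone_diff_hom assms by (auto simp: model_hom_def)
  have d: "(\<lambda>b. - diff W (i + 1) (rep i x) b) \<in> carrier (obj W i)"
    using linear_map.closed[OF W_linear rep_carrier[OF assms], of i]
    by (auto simp: W_simps pcarrier_uminus)
  have E: "elim_var (s - s') = [:t:]" "elim_var (p - p') = pCons 0 [:t:]" "elim_var (- (p - p')) = - pCons 0 [:t:]"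
    "elim_var u2 = u" "elim_var (- u2) = - u"
    by (simp_all only: elim_var_s elim_var_p elim_var_simps(4) u_def)
  \<comment> \<open>Eliminating u_1 leaves every entry expressed through v, t, \<open>u\<close> and
    X.\<close>
  have E1: "elim_var u1 = [:v:] - [:0, 1:] * u" unfolding eq_diff_eq by (rule elim_var_u1)
  have "- elim_var (diff W (i + 1) (rep i x) (b1, b2)) = lift (i + 1) (cone_diff i x) (b1, b2)" for b1 b2
  proof -
    have "elim_var (diff W (i + 1) (rep i x) (b1, b2)) =
      lift i x (0, 0) * elim_var (entry DW (0, 0) (b1, b2)) + lift i x (0, 1) * elim_var (entry DW (0, 1) (b1, b2))
       + lift i x (1, 0) * elim_var (entry DW (1, 0) (b1, b2)) + lift i x (1, 1) * elim_var (entry DW (1, 1) (b1, b2))"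
      unfolding diff_W by (simp only: elim_rep[OF assms] elim_var_simps(1,2))
    moreover have "- (lift i x (0, 0) * elim_var (entry DW (0, 0) (b1, b2)) + lift i x (0, 1) * elim_var (entry DW (0, 1) (b1, b2))
       + lift i x (1, 0) * elim_var (entry DW (1, 0) (b1, b2)) + lift i x (1, 1) * elim_var (entry DW (1, 1) (b1, b2)))
       = lift (i + 1) (cone_diff i x) (b1, b2)"
      by (cases i; cases b1; cases b2)
        (simp_all only: entry_W E E1 elim_var_simps(6),
         auto simp: lift_def cone_diff_def y_def smult_diff_right algebra_simps)
    ultimately show ?thesis by simp
  qed
  then have "\<forall>b. - elim_var (diff W (i + 1) (rep i x) b) = lift (i + 1) (cone_diff i x) b" by (metis surj_pair)
  then show ?thesis
    using D d rep_carrier[OF D, of "i + 1"]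
    by (simp add: \<psi>M_def loop_diff[OF rep_carrier[OF assms]] coset_W_eq_iff elim_rep)
qed

lemma free_M: "graded_free {2, 3} (obj loop i)"
proof (rule model_iso.graded_free[OF model_M])
  \<comment> \<open>Coordinates are indexed by the power of X and by a flag for the second
    component. Every index occurs, so the rank over R' is infinite.\<close>
  let ?\<kappa> = "\<lambda>x :: qpoly poly \<times> qpoly poly. \<lambda>(k, c). poly.coeff (if c then snd x else fst x) k"
  show "?\<kappa> (a + b) j = ?\<kappa> a j + ?\<kappa> b j" for a b and j :: "nat \<times> bool"
    by (cases j) auto
  show "?\<kappa> (sm2 r a) j = r * ?\<kappa> a j" for r a and j :: "nat \<times> bool"
    by (cases j) (auto simp: sm2_def)
  show "inj_on ?\<kappa> R2"
  proof (rule inj_onI)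
    fix x z assume eq: "?\<kappa> x = ?\<kappa> z"
    have "fst x = fst z" by (rule poly_eqI) (use fun_cong[OF eq, of "(_, False)"] in simp)
    moreover have "snd x = snd z" by (rule poly_eqI) (use fun_cong[OF eq, of "(_, True)"] in simp)
    ultimately show "x = z" by (simp add: prod_eq_iff)
  qed
  show "?\<kappa> ` R2 = {c. (\<forall>j. c j \<in> pcarrier {2, 3}) \<and> finite {j. c j \<noteq> 0} \<and> (\<forall>j. j \<notin> UNIV \<longrightarrow> c j = 0)}"
  proof (intro equalityI subsetI)
    fix c assume "c \<in> ?\<kappa> ` R2"
    then obtain a b where ab: "a \<in> rpoly" "b \<in> rpoly" "c = ?\<kappa> (a, b)" by auto
    have "{j. c j \<noteq> 0} \<subseteq> {..max (degree a) (degree b)} \<times> UNIV"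
    proof
      fix j assume "j \<in> {j. c j \<noteq> 0}"
      then show "j \<in> {..max (degree a) (degree b)} \<times> UNIV"
        using le_degree[of a "fst j"] le_degree[of b "fst j"] by (cases j) (auto simp: ab(3) split: if_splits)
    qed
    then have "finite {j. c j \<noteq> 0}" by (rule finite_subset) auto
    then show "c \<in> {c. (\<forall>j. c j \<in> pcarrier {2, 3}) \<and> finite {j. c j \<noteq> 0} \<and> (\<forall>j. j \<notin> UNIV \<longrightarrow> c j = 0)}"
      using ab by (auto simp: rpoly_def)
  next
    fix c :: "nat \<times> bool \<Rightarrow> qpoly"
    assume "c \<in> {c. (\<forall>j. c j \<in> pcarrier {2, 3}) \<and> finite {j. c j \<noteq> 0} \<and> (\<forall>j. j \<notin> UNIV \<longrightarrow> c j = 0)}"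
    then have c: "\<And>j. c j \<in> pcarrier {2, 3}" "finite {j. c j \<noteq> 0}" by auto
    have "finite {k. c (k, q) \<noteq> 0}" for q
      by (rule finite_subset[OF _ finite_imageI[OF c(2), of fst]]) force
    then obtain a b where ab: "poly.coeff a = (\<lambda>k. c (k, False))" "poly.coeff b = (\<lambda>k. c (k, True))"
      using finite_support_coeff by metis
    then show "c \<in> ?\<kappa> ` R2"
      using c(1) by (intro image_eqI[of _ _ "(a, b)"]) (auto simp: rpoly_def fun_eq_iff)
  qed
  show "a \<in> hom2 i k \<longleftrightarrow> (\<forall>j. ?\<kappa> a j \<in> hom_poly {2, 3}
      (k - (case j of (l, c) \<Rightarrow> (if c then degc i else dega i) + 2 * int l)))" for a k
    by (auto simp: hom2_def rpoly_hom_def mem_Times_iff algebra_simps split: if_splits)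
qed

lemma loop_iso: "hmf_iso {2, 3} n (var 2 ^ (n + 1) - var 3 ^ (n + 1)) loop arc_sum"
proof (rule hmf_iso_models[where h = div_homotopy and F = rem_map and G = incl_map and DM = cone_diff and y = y and E = "{..<n - 1}"
      and gen = "monom 1", OF _ w_hom free_M free_N model_M model_N diff_M diff_N cone_diff_hom smult_y_hom
      cone_diff_cone_diff _ y_max rem_map_hom rem_map_cone_diff incl_map_hom incl_map_smult rem_map_incl_map div_homotopy_hom div_homotopy_eq _ _ generators_N])
  fix i a
  show "Polynomial.smult (y (i + 1)) (Polynomial.smult (y i) a) =
      Polynomial.smult (var 2 ^ (n + 1) - var 3 ^ (n + 1)) a"
    using y_y[of i] by (simp del: power_Suc)
next
  fix k assume "k \<in> {..<n - 1}"
  then show "monom 1 k \<in> S1" by (auto simp: rpoly_def small_poly_def coeff_monom)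
qed auto

end

theorem proposition29:
  fixes n :: nat
  assumes "n \<ge> 1"
  shows "hmf_iso {2, 3} n (var 2 ^ (n + 1) - var 3 ^ (n + 1))
    (fact_translate
      (quot_fact {1, 2, 3, 4} (genideal (poly_ring {1, 2, 3, 4}) {var 4 - var 1})
        (wide_edge n 1 2 3 4)))
    (fact_sum {0..int n - 2} (\<lambda>i. fact_shift (2 - int n + 2 * i) (arc n 2 3)))"
proof -
  interpret wide_loop n by unfold_locales fact
  show ?thesis using loop_iso unfolding loop_def W_def arc_sum_def .
qed

end
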